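(* There is an algorithm that, given a connected undirected simple graph $G=(V,E)$ with $n=|V|$ and $m=|E|$ and a positive integer $k$, enumerates (outputs each exactly once) all edge $k$-graphlets of $G$ in $O(n+m+k\cdot N)$ total time and $O(n+m)$ space, where $N$ is the number of edge $k$-graphlets of $G$.
   Context: For $F\subseteq E$, the subgraph induced by $F$ is $G[F]=(U,F)$ where $U$ is the set of endpoints of edges in $F$. An edge $k$-graphlet of $G$ is a connected subgraph $G[F]$ induced by a set $F$ of exactly $k$ edges; it is output by listing $F$. The graph is given in adjacency-list form (standard RAM model), supporting iteration over the neighbours of a vertex $v$ in $O(\deg(v))$ time, insertion/deletion of an edge in $O(1)$ time, and contraction of an edge $\{u,v\}$ in $O(\deg(u))$ or $O(\deg(v))$ time. *)

theory Defs
  imports Main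
begin

subsection \<open>Undirected simple graphs and edge graphlets\<close>

type_synonym graph = "nat set \<times> nat set set"

abbreviation verts :: "graph \<Rightarrow> nat set" where "verts \<equiv> fst"
abbreviation edges :: "graph \<Rightarrow> nat set set" where "edges \<equiv> snd"

definition simple_graph :: "graph \<Rightarrow> bool" where
  "simple_graph G \<longleftrightarrow> finite (verts G) \<and> (\<forall>e \<in> edges G. e \<subseteq> verts G \<and> card e = 2)"

definition connected_graph :: "graph \<Rightarrow> bool" where
  "connected_graph G \<longleftrightarrow> verts G \<noteq> {} \<and>
     (\<forall>u \<in> verts G. \<forall>v \<in> verts G. (u, v) \<in> {(x, y). {x, y} \<in> edges G}\<^sup>*)"

definition neighbours :: "graph \<Rightarrow> nat \<Rightarrow> nat set" where
  "neighbours G v = {u. {v, u} \<in> edges G}"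

definition edge_induced :: "nat set set \<Rightarrow> graph" where
  "edge_induced F = (\<Union>F, F)"

definition edge_graphlets :: "graph \<Rightarrow> nat \<Rightarrow> graph set" where
  "edge_graphlets G k =
     {edge_induced F | F. F \<subseteq> edges G \<and> card F = k \<and> connected_graph (edge_induced F)}"

subsection \<open>Unit-cost RAM\<close>

text \<open>
  A RAM in the style of Cook and Reckhow, over natural numbers, with truncated subtraction. Registers
  are named directly by the instructions only, so a program uses a constant number of them; the
  memory is addressed indirectly through registers. The first argument of an arithmetic or load
  instruction is the target register.
\<close>

datatype instr =
    SetConst nat nat
  | Add nat nat nat
  | Sub nat nat nat
  | Load nat nat          \<comment> \<open>\<open>Load r a\<close>: \<open>r := mem[a]\<close>\<close>
  | Store nat nat         \<comment> \<open>\<open>Store a r\<close>: \<open>mem[a] := r\<close>\<close>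
  | JumpLe nat nat nat    \<comment> \<open>\<open>JumpLe r s l\<close>: go to \<open>l\<close> if \<open>r \<le> s\<close>\<close>
  | Out nat               \<comment> \<open>append a word to the write-only output stream\<close>
  | Halt

record config =
  pc :: nat
  regs :: "nat \<Rightarrow> nat"
  mem :: "nat \<Rightarrow> nat"
  outs :: "nat list"

definition set_reg :: "nat \<Rightarrow> nat \<Rightarrow> nat \<Rightarrow> config \<Rightarrow> config option" where
  "set_reg W r x \<sigma> =
     (if x < W then Some (\<sigma>\<lparr>pc := Suc (pc \<sigma>), regs := (regs \<sigma>)(r := x)\<rparr>) else None)"

text \<open>
  The machine has \<open>S\<close> memory cells and its words hold numbers below \<open>W\<close>. An access outside the
  memory or a word overflow is a fault (\<open>None\<close>); there is no step from \<open>Halt\<close> either.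
\<close>

fun exec_instr :: "nat \<Rightarrow> nat \<Rightarrow> instr \<Rightarrow> config \<Rightarrow> config option" where
  "exec_instr S W (SetConst r x) \<sigma> = set_reg W r x \<sigma>"
| "exec_instr S W (Add r s t) \<sigma> = set_reg W r (regs \<sigma> s + regs \<sigma> t) \<sigma>"
| "exec_instr S W (Sub r s t) \<sigma> = set_reg W r (regs \<sigma> s - regs \<sigma> t) \<sigma>"
| "exec_instr S W (Load r a) \<sigma> =
     (if regs \<sigma> a < S then set_reg W r (mem \<sigma> (regs \<sigma> a)) \<sigma> else None)"
| "exec_instr S W (Store a r) \<sigma> =
     (if regs \<sigma> a < S
      then Some (\<sigma>\<lparr>pc := Suc (pc \<sigma>), mem := (mem \<sigma>)(regs \<sigma> a := regs \<sigma> r)\<rparr>) else None)"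
| "exec_instr S W (JumpLe r s l) \<sigma> =
     Some (\<sigma>\<lparr>pc := (if regs \<sigma> r \<le> regs \<sigma> s then l else Suc (pc \<sigma>))\<rparr>)"
| "exec_instr S W (Out r) \<sigma> = Some (\<sigma>\<lparr>pc := Suc (pc \<sigma>), outs := outs \<sigma> @ [regs \<sigma> r]\<rparr>)"
| "exec_instr S W Halt \<sigma> = None"

definition ram_step :: "nat \<Rightarrow> nat \<Rightarrow> instr list \<Rightarrow> config \<Rightarrow> config \<Rightarrow> bool" where
  "ram_step S W P \<sigma> \<sigma>' \<longleftrightarrow> pc \<sigma> < length P \<and> exec_instr S W (P ! pc \<sigma>) \<sigma> = Some \<sigma>'"

definition init_config :: "nat list \<Rightarrow> config" where
  "init_config xs = \<lparr>pc = 0, regs = (\<lambda>_. 0),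
     mem = (\<lambda>a. if a < length xs then xs ! a else 0), outs = []\<rparr>"

definition ram_computes ::
  "nat \<Rightarrow> nat \<Rightarrow> instr list \<Rightarrow> nat list \<Rightarrow> nat \<Rightarrow> nat list \<Rightarrow> bool" where
  "ram_computes S W P xs t ys \<longleftrightarrow>
     length xs \<le> S \<and> (\<forall>x \<in> set xs. x < W) \<and>
     (\<exists>\<sigma>. (ram_step S W P ^^ t) (init_config xs) \<sigma> \<and>
        pc \<sigma> < length P \<and> P ! pc \<sigma> = Halt \<and> outs \<sigma> = ys)"

subsection \<open>Input and output conventions\<close>

definition adjacency_lists :: "graph \<Rightarrow> nat list list \<Rightarrow> bool" where
  "adjacency_lists G adj \<longleftrightarrow> length adj = card (verts G) \<and>
     (\<forall>v < length adj. distinct (adj ! v) \<and> set (adj ! v) = neighbours G v)"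

text \<open>
  Memory layout of the input: cells 0, 1, 2 hold \<open>n\<close>, \<open>m\<close>, \<open>k\<close>; cell \<open>3 + v\<close> holds the address of the
  first entry of the adjacency list of \<open>v\<close>, and cell \<open>3 + n\<close> the address just after the last list;
  the lists follow consecutively from address \<open>n + 4\<close>.
\<close>

definition graph_input :: "graph \<Rightarrow> nat list list \<Rightarrow> nat \<Rightarrow> nat list" where
  "graph_input G adj k =
     [card (verts G), card (edges G), k]
     @ map (\<lambda>v. card (verts G) + 4 + length (concat (take v adj))) [0..<card (verts G) + 1]
     @ concat adj"

definition edge_of :: "nat \<times> nat \<Rightarrow> nat set" where
  "edge_of p = {fst p, snd p}"

text \<open>
  Each graphlet is written as the sequence of its edges, without repetition, an edge being written as
  its two endpoints. All blocks have length \<open>2 * k\<close>, so for \<open>k > 0\<close> the division of the output into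
  blocks is unique.
\<close>

definition enumerates_edge_graphlets :: "graph \<Rightarrow> nat \<Rightarrow> nat list \<Rightarrow> bool" where
  "enumerates_edge_graphlets G k ys \<longleftrightarrow>
     (\<exists>Ls :: (nat \<times> nat) list list.
        ys = concat (map (\<lambda>L. concat (map (\<lambda>p. [fst p, snd p]) L)) Ls) \<and>
        (\<forall>L \<in> set Ls. distinct (map edge_of L)) \<and>
        distinct (map (\<lambda>L. edge_induced (edge_of ` set L)) Ls) \<and>
        set (map (\<lambda>L. edge_induced (edge_of ` set L)) Ls) = edge_graphlets G k)"

end

theory Submission
  imports Defs
begin

text \<open>
  The connected sets of \<open>k\<close> edges that contain a connected set \<open>S\<close> and avoid a set \<open>X\<close> are split on an
  edge \<open>e\<close> that touches \<open>S\<close>: either \<open>e\<close> is excluded (this branch is empty iff the component of \<open>S\<close> in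
  \<open>G - X - e\<close> has fewer than \<open>k\<close> edges) or \<open>e\<close> is included (never empty, as long as the component of
  \<open>S\<close> in \<open>G - X\<close> has at least \<open>k\<close> edges). If both branches are nonempty at every branching, the search tree
  has at most \<open>2 N\<close> nodes, so it is enough to spend \<open>O(k)\<close> time on finding the next branching edge.

  Edges that cannot be excluded have to be passed over without restarting the test. The edge \<open>e\<close> is
  deleted (\<open>reserved\<close>) and the graph is searched from a vertex of \<open>S\<close>. If \<open>k\<close> edges are found, \<open>e\<close> is a
  branching edge. If the search ends with fewer edges, \<open>e\<close> is forced into \<open>S\<close>; all other edges
  at the scanned vertices have been counted, so the search just goes on at the far end of \<open>e\<close>, where the
  next edge is reserved. A search scans each edge at most twice and stops after about \<open>2 k\<close> arcs. If it ends
  with no edge reserved, the component has exactly \<open>k\<close> edges and is the only solution.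

  Excluded edges must not be seen again, so the adjacency lists are doubly linked and an edge is
  unlinked when it is excluded; decisions are undone in reverse order, when relinking is an exact
  inverse. At the top level the edges are taken in the reverse of a breadth-first order: all
  prefixes of that order are connected, so none of the initial subproblems with at least \<open>k\<close> edges is
  empty.
\<close>

section \<open>Structured programs and their compilation\<close>

text \<open>The delicate point is that the time between two events, an event being a branching or an
  output, must be \<open>O(k)\<close> although one search may force many edges. With nothing
  reserved, the scanned and the included edges together number at most \<open>k\<close>; this
  invariant survives forcing, because an edge is forced only when the search has ended at least two
  arcs short of \<open>2 * k\<close>. Hence scanned arcs, finished vertices and included edges form
  a potential bounded by a multiple of \<open>k\<close>. Backtracking pops at most \<open>k\<close>
  included edges before it meets an excluded one, and visit marks are cleared along the queue, never
  over all vertices. Solvability of the subproblems is never proved as such: the count of outputs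
  rests on every search ending in a branching or in exactly one output. Edges are pairs of opposite
  arcs, so sizes are doubled and always even. A search sees an edge from both ends, and
  \<open>2 * k - 1\<close> scanned arcs already witness \<open>k\<close> edges. The array size
  \<open>n + 2 * m + 4\<close> is the length of the input, which thereby is itself array 0.\<close>

text \<open>
  Registers of a command are the machine registers below 90. Array \<open>a\<close> is the block of \<open>M\<close> cells from
  address \<open>a * M\<close>, which is kept in register \<open>100 + a\<close>; register 99 is scratch. \<open>CLoad r a i\<close> and
  \<open>CStore a i r\<close> access array \<open>a\<close> at the index held by register \<open>i\<close>; \<open>CIf r s\<close> tests \<open>r \<le> s\<close>,
  \<open>CWhile r s\<close> tests \<open>r < s\<close>. A state consists of registers, arrays, output and elapsed time; the flat
  charge of 3 per command bounds the number of instructions it is compiled to.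
\<close>

datatype com =
    CConst nat nat
  | CAdd nat nat nat
  | CSub nat nat nat
  | CLoad nat nat nat
  | CStore nat nat nat
  | COut nat
  | CSkip
  | CSeq com com (infixr ";;" 60)
  | CIf nat nat com com
  | CWhile nat nat com

type_synonym state = "(nat \<Rightarrow> nat) \<times> (nat \<Rightarrow> nat \<Rightarrow> nat) \<times> nat list \<times> nat"

text \<open>Addition is the only command with an overflow premise: stored words are bounded by the
  simulation relation, constants by \<open>wf_com\<close>, and truncated subtraction never
  grows.\<close>

inductive exec :: "nat \<Rightarrow> nat \<Rightarrow> com \<Rightarrow> state \<Rightarrow> state \<Rightarrow> bool" for M W where
  exec_Const: "exec M W (CConst r x) (R, A, Y, T) (R(r := x), A, Y, 3 + T)"
| exec_Add: "R s + R t < W \<Longrightarrow> exec M W (CAdd r s t) (R, A, Y, T) (R(r := R s + R t), A, Y, 3 + T)"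
| exec_Sub: "exec M W (CSub r s t) (R, A, Y, T) (R(r := R s - R t), A, Y, 3 + T)"
| exec_Load: "R i < M \<Longrightarrow> exec M W (CLoad r a i) (R, A, Y, T) (R(r := A a (R i)), A, Y, 3 + T)"
| exec_Store: "R i < M \<Longrightarrow>
    exec M W (CStore a i r) (R, A, Y, T) (R, A(a := (A a)(R i := R r)), Y, 3 + T)"
| exec_Out: "exec M W (COut r) (R, A, Y, T) (R, A, Y @ [R r], 3 + T)"
| exec_Skip: "exec M W CSkip (R, A, Y, T) (R, A, Y, T)"
| exec_Seq: "exec M W c1 \<sigma> \<sigma>' \<Longrightarrow> exec M W c2 \<sigma>' \<sigma>'' \<Longrightarrow> exec M W (c1 ;; c2) \<sigma> \<sigma>''"
| exec_IfT: "R r \<le> R s \<Longrightarrow> exec M W c1 (R, A, Y, 3 + T) \<sigma> \<Longrightarrow> exec M W (CIf r s c1 c2) (R, A, Y, T) \<sigma>"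
| exec_IfF: "\<not> R r \<le> R s \<Longrightarrow> exec M W c2 (R, A, Y, 3 + T) \<sigma> \<Longrightarrow>
    exec M W (CIf r s c1 c2) (R, A, Y, T) \<sigma>"
| exec_WhileF: "\<not> R r < R s \<Longrightarrow> exec M W (CWhile r s c) (R, A, Y, T) (R, A, Y, 3 + T)"
| exec_WhileT: "R r < R s \<Longrightarrow> exec M W c (R, A, Y, 3 + T) \<sigma> \<Longrightarrow> exec M W (CWhile r s c) \<sigma> \<sigma>' \<Longrightarrow>
    exec M W (CWhile r s c) (R, A, Y, T) \<sigma>'"

fun comp_len :: "com \<Rightarrow> nat" where
  "comp_len (CLoad r a i) = 2"
| "comp_len (CStore a i r) = 2"
| "comp_len CSkip = 0"
| "comp_len (c1 ;; c2) = comp_len c1 + comp_len c2"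
| "comp_len (CIf r s c1 c2) = comp_len c1 + comp_len c2 + 2"
| "comp_len (CWhile r s c) = comp_len c + 2"
| "comp_len _ = 1"

text \<open>Jump targets are absolute, hence the position argument \<open>l\<close>.
  \<open>JumpLe 0 0\<close> compares a register with itself and serves as the unconditional
  jump.\<close>

fun compile :: "nat \<Rightarrow> com \<Rightarrow> instr list" where
  "compile l (CConst r x) = [SetConst r x]"
| "compile l (CAdd r s t) = [Add r s t]"
| "compile l (CSub r s t) = [Sub r s t]"
| "compile l (CLoad r a i) = [Add 99 (100 + a) i, Load r 99]"
| "compile l (CStore a i r) = [Add 99 (100 + a) i, Store 99 r]"
| "compile l (COut r) = [Out r]"
| "compile l CSkip = []"
| "compile l (c1 ;; c2) = compile l c1 @ compile (l + comp_len c1) c2"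
| "compile l (CIf r s c1 c2) =
     JumpLe r s (l + comp_len c2 + 2) # compile (l + 1) c2
     @ JumpLe 0 0 (l + comp_len c1 + comp_len c2 + 2) # compile (l + comp_len c2 + 2) c1"
| "compile l (CWhile r s c) =
     JumpLe s r (l + comp_len c + 2) # compile (l + 1) c @ [JumpLe 0 0 l]"

fun wf_com :: "com \<Rightarrow> bool" where
  "wf_com (CConst r x) = (r < 90 \<and> x < 10)"
| "wf_com (CAdd r s t) = (r < 90 \<and> s < 90 \<and> t < 90)"
| "wf_com (CSub r s t) = (r < 90 \<and> s < 90 \<and> t < 90)"
| "wf_com (CLoad r a i) = (r < 90 \<and> a < 11 \<and> i < 90)"
| "wf_com (CStore a i r) = (r < 90 \<and> a < 11 \<and> i < 90)"
| "wf_com (COut r) = (r < 90)"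
| "wf_com CSkip = True"
| "wf_com (c1 ;; c2) = (wf_com c1 \<and> wf_com c2)"
| "wf_com (CIf r s c1 c2) = (r < 90 \<and> s < 90 \<and> wf_com c1 \<and> wf_com c2)"
| "wf_com (CWhile r s c) = (r < 90 \<and> s < 90 \<and> wf_com c)"

lemma length_compile [simp]: "length (compile l c) = comp_len c"
  by (induction c arbitrary: l) auto

text \<open>The bound on words covers the whole machine, also scratch registers and cells outside
  the arrays, so that loads and copies can never overflow. The program counter is left out because
  commands do not know their position.\<close>

definition represents :: "nat \<Rightarrow> nat \<Rightarrow> state \<Rightarrow> config \<Rightarrow> bool" where
  "represents M W = (\<lambda>(R, A, Y, T) \<sigma>.
     (\<forall>r < 90. regs \<sigma> r = R r) \<and> (\<forall>a < 11. regs \<sigma> (100 + a) = a * M) \<and>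
     (\<forall>a < 11. \<forall>i < M. mem \<sigma> (a * M + i) = A a i) \<and> outs \<sigma> = Y \<and>
     (\<forall>r. regs \<sigma> r < W) \<and> (\<forall>i. mem \<sigma> i < W))"

lemma array_cell_less:
  fixes a :: nat
  assumes "a < b" "i < M"
  shows "a * M + i < b * M"
proof -
  have "a * M + i < Suc a * M" using assms by simp
  also have "\<dots> \<le> b * M" using assms by (intro mult_le_mono1) simp
  finally show ?thesis .
qed

lemma array_cell_eq_iff:
  fixes a :: nat
  assumes "i < M" "j < M"
  shows "a * M + i = b * M + j \<longleftrightarrow> a = b \<and> i = j"
proof
  assume eq: "a * M + i = b * M + j"
  have "(a * M + i) div M = a" "(b * M + j) div M = b" using assms by auto
  with eq show "a = b \<and> i = j" by simp
qed simp

lemma represents_regs_upd: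
  assumes "represents M W (R, A, Y, T) \<sigma>" "r < 90" "x < W"
  shows "represents M W (R(r := x), A, Y, T') (\<sigma>\<lparr>pc := l, regs := (regs \<sigma>)(r := x)\<rparr>)"
  using assms by (auto simp: represents_def)

lemma represents_scratch:
  assumes "represents M W (R, A, Y, T) \<sigma>" "x < W"
  shows "represents M W (R, A, Y, T') (\<sigma>\<lparr>pc := l, regs := (regs \<sigma>)(99 := x)\<rparr>)"
  using assms by (auto simp: represents_def)

lemma represents_store:
  assumes "represents M W (R, A, Y, T) \<sigma>" "a < 11" "i < M" "x < W"
  shows "represents M W (R, A(a := (A a)(i := x)), Y, T') (\<sigma>\<lparr>pc := l, mem := (mem \<sigma>)(a * M + i := x)\<rparr>)"
  using assms by (auto simp: represents_def array_cell_eq_iff)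

lemma represents_pc:
  assumes "represents M W (R, A, Y, T) \<sigma>"
  shows "represents M W (R, A, Y, T') (\<sigma>\<lparr>pc := l\<rparr>)"
  using assms by (auto simp: represents_def)

lemma ram_step_run:
  assumes "P = pre @ i # post" "length pre = pc \<sigma>" "exec_instr S W i \<sigma> = Some \<sigma>'"
  shows "(ram_step S W P ^^ 1) \<sigma> \<sigma>'"
  unfolding One_nat_def relpowp_1[unfolded One_nat_def]
  using assms by (auto simp: ram_step_def nth_append)

lemma ram_steps_trans:
  assumes "(ram_step S W P ^^ s) \<sigma> \<sigma>'" "(ram_step S W P ^^ t) \<sigma>' \<sigma>''"
  shows "(ram_step S W P ^^ (s + t)) \<sigma> \<sigma>''"
  using assms by (auto simp: relpowp_add)

text \<open>The time of the state only has to dominate the number of machine steps, so a flat charge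
  that overestimates is harmless.\<close>

definition simulated :: "nat \<Rightarrow> nat \<Rightarrow> nat \<Rightarrow> instr list \<Rightarrow> nat \<Rightarrow> state \<Rightarrow> config \<Rightarrow> state \<Rightarrow> bool" where
  "simulated M S W P l s \<sigma> s' \<longleftrightarrow> (\<exists>t \<sigma>'. (ram_step S W P ^^ t) \<sigma> \<sigma>' \<and> pc \<sigma>' = l \<and>
     represents M W s' \<sigma>' \<and> snd (snd (snd s)) + t \<le> snd (snd (snd s')))"

lemma simulatedI:
  assumes "(ram_step S W P ^^ t) \<sigma> \<sigma>'" "pc \<sigma>' = l" "represents M W (R', A', Y', T') \<sigma>'" "T + t \<le> T'"
  shows "simulated M S W P l (R, A, Y, T) \<sigma> (R', A', Y', T')"
  unfolding simulated_def using assms by auto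

lemma simulated_step:
  assumes "(ram_step S W P ^^ t) \<sigma> \<sigma>'" "simulated M S W P l (R', A', Y', T') \<sigma>' s" "T + t \<le> T'"
  shows "simulated M S W P l (R, A, Y, T) \<sigma> s"
proof -
  obtain t' \<sigma>'' where "(ram_step S W P ^^ t') \<sigma>' \<sigma>''" "pc \<sigma>'' = l" "represents M W s \<sigma>''"
    "T' + t' \<le> snd (snd (snd s))"
    using assms(2) unfolding simulated_def by auto
  with ram_steps_trans[OF assms(1)] assms(3) show ?thesis
    unfolding simulated_def by (metis (no_types, lifting) add.assoc add_le_mono1 dual_order.trans snd_conv)
qed

text \<open>The surrounding code \<open>pre\<close> and \<open>post\<close> and the configuration
  are generalized in the induction: the body of a loop is placed inside the loop's own code, and the
  remaining iterations are simulated again from the same position.\<close>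

theorem compile_correct:
  assumes "exec M W c s s'" "wf_com c" "11 * M \<le> S" "11 * M \<le> W" "10 \<le> W"
    and "P = pre @ compile (length pre) c @ post" "represents M W s \<sigma>" "pc \<sigma> = length pre"
  shows "simulated M S W P (length pre + comp_len c) s \<sigma> s'"
  using assms
proof (induction arbitrary: pre post \<sigma> rule: exec.induct)
  case (exec_Const r x R A Y T)
  have "(ram_step S W P ^^ 1) \<sigma> (\<sigma>\<lparr>pc := Suc (pc \<sigma>), regs := (regs \<sigma>)(r := x)\<rparr>)"
    by (rule ram_step_run[of _ pre "SetConst r x" post]) (use exec_Const in \<open>auto simp: set_reg_def\<close>)
  then show ?case
    by (rule simulatedI) (use exec_Const in \<open>auto intro: represents_regs_upd\<close>)
next
  case (exec_Add R s t r A Y T)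
  have eq: "regs \<sigma> s = R s" "regs \<sigma> t = R t" using exec_Add by (auto simp: represents_def)
  have "(ram_step S W P ^^ 1) \<sigma> (\<sigma>\<lparr>pc := Suc (pc \<sigma>), regs := (regs \<sigma>)(r := R s + R t)\<rparr>)"
    by (rule ram_step_run[of _ pre "Add r s t" post]) (use exec_Add eq in \<open>auto simp: set_reg_def\<close>)
  then show ?case
    by (rule simulatedI) (use exec_Add in \<open>auto intro: represents_regs_upd\<close>)
next
  case (exec_Sub r s t R A Y T)
  have eq: "regs \<sigma> s = R s" "regs \<sigma> t = R t" "R s < W"
    using exec_Sub by (auto simp: represents_def) metis
  have "(ram_step S W P ^^ 1) \<sigma> (\<sigma>\<lparr>pc := Suc (pc \<sigma>), regs := (regs \<sigma>)(r := R s - R t)\<rparr>)"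
    by (rule ram_step_run[of _ pre "Sub r s t" post]) (use exec_Sub eq in \<open>auto simp: set_reg_def\<close>)
  then show ?case
    by (rule simulatedI) (use exec_Sub eq in \<open>auto intro!: represents_regs_upd\<close>)
next
  case (exec_Load R i r a A Y T)
  let ?x = "a * M + R i"
  have a: "a < 11" "i < 90" "r < 90" using exec_Load by auto
  have lt: "?x < 11 * M" using array_cell_less a exec_Load by blast
  have eq: "regs \<sigma> i = R i" "regs \<sigma> (100 + a) = a * M" "mem \<sigma> ?x = A a (R i)"
    using exec_Load a by (auto simp: represents_def)
  have "mem \<sigma> ?x < W" using exec_Load.prems by (simp add: represents_def)
  with eq have lW: "A a (R i) < W" by simp
  let ?\<sigma>1 = "\<sigma>\<lparr>pc := Suc (pc \<sigma>), regs := (regs \<sigma>)(99 := ?x)\<rparr>"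
  let ?\<sigma>2 = "?\<sigma>1\<lparr>pc := Suc (Suc (pc \<sigma>)), regs := (regs ?\<sigma>1)(r := A a (R i))\<rparr>"
  have 1: "(ram_step S W P ^^ 1) \<sigma> ?\<sigma>1"
    by (rule ram_step_run[of _ pre "Add 99 (100 + a) i" "Load r 99 # post"])
      (use exec_Load eq lt in \<open>auto simp: set_reg_def\<close>)
  have 2: "(ram_step S W P ^^ 1) ?\<sigma>1 ?\<sigma>2"
    by (rule ram_step_run[of _ "pre @ [Add 99 (100 + a) i]" "Load r 99" post])
      (use exec_Load eq lt lW in \<open>auto simp: set_reg_def\<close>)
  have "represents M W (R, A, Y, T) ?\<sigma>1"
    using exec_Load lt by (intro represents_scratch) auto
  then have 3: "represents M W (R(r := A a (R i)), A, Y, 3 + T) ?\<sigma>2"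
    using eq a lW by (intro represents_regs_upd) auto
  show ?case
    by (rule simulatedI[OF ram_steps_trans[OF 1 2] _ 3]) (use exec_Load.prems in auto)
next
  case (exec_Store R i a r A Y T)
  let ?x = "a * M + R i"
  have a: "a < 11" "i < 90" "r < 90" using exec_Store by auto
  have lt: "?x < 11 * M" using array_cell_less a exec_Store by blast
  have eq: "regs \<sigma> i = R i" "regs \<sigma> (100 + a) = a * M" "regs \<sigma> r = R r" "R r < W"
    using exec_Store a by (auto simp: represents_def) metis
  let ?\<sigma>1 = "\<sigma>\<lparr>pc := Suc (pc \<sigma>), regs := (regs \<sigma>)(99 := ?x)\<rparr>"
  let ?\<sigma>2 = "?\<sigma>1\<lparr>pc := Suc (Suc (pc \<sigma>)), mem := (mem ?\<sigma>1)(?x := R r)\<rparr>"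
  have 1: "(ram_step S W P ^^ 1) \<sigma> ?\<sigma>1"
    by (rule ram_step_run[of _ pre "Add 99 (100 + a) i" "Store 99 r # post"])
      (use exec_Store eq lt in \<open>auto simp: set_reg_def\<close>)
  have 2: "(ram_step S W P ^^ 1) ?\<sigma>1 ?\<sigma>2"
    by (rule ram_step_run[of _ "pre @ [Add 99 (100 + a) i]" "Store 99 r" post])
      (use exec_Store eq lt a in \<open>auto simp: set_reg_def\<close>)
  have "represents M W (R, A, Y, T) ?\<sigma>1"
    using exec_Store lt by (intro represents_scratch) auto
  then have 3: "represents M W (R, A(a := (A a)(R i := R r)), Y, 3 + T) ?\<sigma>2"
    using eq a exec_Store by (intro represents_store) auto
  show ?case
    by (rule simulatedI[OF ram_steps_trans[OF 1 2] _ 3]) (use exec_Store.prems in auto)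
next
  case (exec_Out r R A Y T)
  have eq: "regs \<sigma> r = R r" using exec_Out by (auto simp: represents_def)
  have "(ram_step S W P ^^ 1) \<sigma> (\<sigma>\<lparr>pc := Suc (pc \<sigma>), outs := outs \<sigma> @ [R r]\<rparr>)"
    by (rule ram_step_run[of _ pre "Out r" post]) (use exec_Out eq in auto)
  then show ?case
    by (rule simulatedI) (use exec_Out in \<open>auto simp: represents_def\<close>)
next
  case (exec_Skip R A Y T)
  have "(ram_step S W P ^^ 0) \<sigma> \<sigma>" by simp
  then show ?case
    by (rule simulatedI) (use exec_Skip in auto)
next
  case (exec_Seq c1 s s' c2 s'')
  have "simulated M S W P (length pre + comp_len c1) s \<sigma> s'"
    by (rule exec_Seq.IH(1)[of _ "compile (length pre + comp_len c1) c2 @ post"]) (use exec_Seq in auto)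
  then obtain t1 \<sigma>1 where 1: "(ram_step S W P ^^ t1) \<sigma> \<sigma>1" "pc \<sigma>1 = length pre + comp_len c1"
    "represents M W s' \<sigma>1" "snd (snd (snd s)) + t1 \<le> snd (snd (snd s'))"
    unfolding simulated_def by blast
  have "simulated M S W P (length (pre @ compile (length pre) c1) + comp_len c2) s' \<sigma>1 s''"
    by (rule exec_Seq.IH(2)[of _ post]) (use exec_Seq 1 in auto)
  with 1 show ?case
    by (cases s; cases s') (auto intro: simulated_step simp: add.assoc)
next
  case (exec_IfT R r s c1 A Y T s' c2)
  have eq: "regs \<sigma> r = R r" "regs \<sigma> s = R s" using exec_IfT by (auto simp: represents_def)
  let ?l = "length pre + comp_len c2 + 2"
  have 1: "(ram_step S W P ^^ 1) \<sigma> (\<sigma>\<lparr>pc := ?l\<rparr>)"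
    by (rule ram_step_run[of _ pre "JumpLe r s ?l"]) (use exec_IfT eq in auto)
  let ?pre = "pre @ JumpLe r s ?l # compile (length pre + 1) c2
     @ [JumpLe 0 0 (length pre + comp_len c1 + comp_len c2 + 2)]"
  have "simulated M S W P (length ?pre + comp_len c1) (R, A, Y, 3 + T) (\<sigma>\<lparr>pc := ?l\<rparr>) s'"
    by (rule exec_IfT.IH[of _ post]) (use exec_IfT in \<open>auto intro: represents_pc\<close>)
  then have "simulated M S W P (length pre + comp_len (CIf r s c1 c2)) (R, A, Y, 3 + T) (\<sigma>\<lparr>pc := ?l\<rparr>) s'"
    by (simp add: ac_simps)
  with 1 show ?case by (rule simulated_step) simp
next
  case (exec_IfF R r s c2 A Y T s' c1)
  have eq: "regs \<sigma> r = R r" "regs \<sigma> s = R s" using exec_IfF by (auto simp: represents_def)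
  let ?l = "length pre + comp_len c2 + 2" and ?e = "length pre + comp_len c1 + comp_len c2 + 2"
  have 1: "(ram_step S W P ^^ 1) \<sigma> (\<sigma>\<lparr>pc := length pre + 1\<rparr>)"
    by (rule ram_step_run[of _ pre "JumpLe r s ?l"]) (use exec_IfF eq in auto)
  let ?pre = "pre @ [JumpLe r s ?l]"
  let ?post = "JumpLe 0 0 ?e # compile ?l c1 @ post"
  have "simulated M S W P (length ?pre + comp_len c2) (R, A, Y, 3 + T) (\<sigma>\<lparr>pc := length pre + 1\<rparr>) s'"
    by (rule exec_IfF.IH[of _ ?post]) (use exec_IfF in \<open>auto intro: represents_pc\<close>)
  then obtain t2 \<sigma>2 where 2: "(ram_step S W P ^^ t2) (\<sigma>\<lparr>pc := length pre + 1\<rparr>) \<sigma>2"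
    "pc \<sigma>2 = length pre + 1 + comp_len c2" "represents M W s' \<sigma>2" "3 + T + t2 \<le> snd (snd (snd s'))"
    unfolding simulated_def by auto
  have 3: "(ram_step S W P ^^ 1) \<sigma>2 (\<sigma>2\<lparr>pc := ?e\<rparr>)"
    by (rule ram_step_run[of _ "?pre @ compile (length pre + 1) c2" "JumpLe 0 0 ?e"])
      (use exec_IfF 2 in auto)
  obtain R' A' Y' T' where s': "s' = (R', A', Y', T')" by (cases s') auto
  show ?case unfolding s'
    by (rule simulatedI[OF ram_steps_trans[OF ram_steps_trans[OF 1 2(1)] 3] _
          represents_pc[OF 2(3)[unfolded s']]]) (use 2 s' in auto)
next
  case (exec_WhileF R r s c A Y T)
  have eq: "regs \<sigma> r = R r" "regs \<sigma> s = R s" using exec_WhileF by (auto simp: represents_def)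
  let ?e = "length pre + comp_len c + 2"
  have "(ram_step S W P ^^ 1) \<sigma> (\<sigma>\<lparr>pc := ?e\<rparr>)"
    by (rule ram_step_run[of _ pre "JumpLe s r ?e"]) (use exec_WhileF eq in auto)
  then show ?case
    by (rule simulatedI) (use exec_WhileF in \<open>auto intro: represents_pc\<close>)
next
  case (exec_WhileT R r s c A Y T s' s'')
  have eq: "regs \<sigma> r = R r" "regs \<sigma> s = R s" using exec_WhileT by (auto simp: represents_def)
  let ?e = "length pre + comp_len c + 2"
  have 1: "(ram_step S W P ^^ 1) \<sigma> (\<sigma>\<lparr>pc := length pre + 1\<rparr>)"
    by (rule ram_step_run[of _ pre "JumpLe s r ?e"]) (use exec_WhileT eq in auto)
  let ?pre = "pre @ [JumpLe s r ?e]"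
  let ?post = "JumpLe 0 0 (length pre) # post"
  have "simulated M S W P (length ?pre + comp_len c) (R, A, Y, 3 + T) (\<sigma>\<lparr>pc := length pre + 1\<rparr>) s'"
    by (rule exec_WhileT.IH(1)[of _ ?post]) (use exec_WhileT in \<open>auto intro: represents_pc\<close>)
  then obtain t2 \<sigma>2 where 2: "(ram_step S W P ^^ t2) (\<sigma>\<lparr>pc := length pre + 1\<rparr>) \<sigma>2"
    "pc \<sigma>2 = length pre + 1 + comp_len c" "represents M W s' \<sigma>2" "3 + T + t2 \<le> snd (snd (snd s'))"
    unfolding simulated_def by auto
  have 3: "(ram_step S W P ^^ 1) \<sigma>2 (\<sigma>2\<lparr>pc := length pre\<rparr>)"
    by (rule ram_step_run[of _ "?pre @ compile (length pre + 1) c" "JumpLe 0 0 (length pre)"])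
      (use exec_WhileT 2 in auto)
  have 4: "represents M W s' (\<sigma>2\<lparr>pc := length pre\<rparr>)"
    using 2 by (cases s') (auto intro: represents_pc)
  have 5: "simulated M S W P (length pre + comp_len (CWhile r s c)) s' (\<sigma>2\<lparr>pc := length pre\<rparr>) s''"
    by (rule exec_WhileT.IH(2)[of _ post]) (use exec_WhileT 4 in auto)
  obtain R' A' Y' T' where s': "s' = (R', A', Y', T')" by (cases s') auto
  show ?case
    by (rule simulated_step[OF ram_steps_trans[OF ram_steps_trans[OF 1 2(1)] 3] 5[unfolded s']])
      (use 2 s' in auto)
qed

section \<open>Weakest preconditions for total correctness\<close>

definition wp :: "nat \<Rightarrow> nat \<Rightarrow> com \<Rightarrow> (state \<Rightarrow> bool) \<Rightarrow> state \<Rightarrow> bool" where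
  "wp M W c Q s \<longleftrightarrow> (\<exists>s'. exec M W c s s' \<and> Q s')"

inductive_cases exec_CConstE: "exec M W (CConst r x) s s'"
inductive_cases exec_CAddE: "exec M W (CAdd r s t) \<sigma> s'"
inductive_cases exec_CSubE: "exec M W (CSub r s t) \<sigma> s'"
inductive_cases exec_CLoadE: "exec M W (CLoad r a i) \<sigma> s'"
inductive_cases exec_CStoreE: "exec M W (CStore a i r) \<sigma> s'"
inductive_cases exec_COutE: "exec M W (COut r) \<sigma> s'"
inductive_cases exec_CSkipE: "exec M W CSkip \<sigma> s'"
inductive_cases exec_CSeqE: "exec M W (c1 ;; c2) \<sigma> s'"
inductive_cases exec_CIfE: "exec M W (CIf r s c1 c2) \<sigma> s'"

lemma wp_Const [simp]: "wp M W (CConst r x) Q (R, A, Y, T) = Q (R(r := x), A, Y, 3 + T)"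
  unfolding wp_def by (blast elim: exec_CConstE intro: exec.intros)
lemma wp_Add [simp]: "wp M W (CAdd r s t) Q (R, A, Y, T) =
    (R s + R t < W \<and> Q (R(r := R s + R t), A, Y, 3 + T))"
  unfolding wp_def by (blast elim: exec_CAddE intro: exec.intros)
lemma wp_Sub [simp]: "wp M W (CSub r s t) Q (R, A, Y, T) = Q (R(r := R s - R t), A, Y, 3 + T)"
  unfolding wp_def by (blast elim: exec_CSubE intro: exec.intros)
lemma wp_Load [simp]: "wp M W (CLoad r a i) Q (R, A, Y, T) =
    (R i < M \<and> Q (R(r := A a (R i)), A, Y, 3 + T))"
  unfolding wp_def by (blast elim: exec_CLoadE intro: exec.intros)
lemma wp_Store [simp]: "wp M W (CStore a i r) Q (R, A, Y, T) =
    (R i < M \<and> Q (R, A(a := (A a)(R i := R r)), Y, 3 + T))"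
  unfolding wp_def by (blast elim: exec_CStoreE intro: exec.intros)
lemma wp_Out [simp]: "wp M W (COut r) Q (R, A, Y, T) = Q (R, A, Y @ [R r], 3 + T)"
  unfolding wp_def by (blast elim: exec_COutE intro: exec.intros)
lemma wp_Skip [simp]: "wp M W CSkip Q (R, A, Y, T) = Q (R, A, Y, T)"
  unfolding wp_def by (blast elim: exec_CSkipE intro: exec.intros)
lemma wp_Seq [simp]: "wp M W (c1 ;; c2) Q s = wp M W c1 (wp M W c2 Q) s"
  unfolding wp_def by (blast elim: exec_CSeqE intro: exec.intros)
lemma wp_If [simp]: "wp M W (CIf r s c1 c2) Q (R, A, Y, T) =
    (if R r \<le> R s then wp M W c1 Q (R, A, Y, 3 + T) else wp M W c2 Q (R, A, Y, 3 + T))"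
  unfolding wp_def by (cases "R r \<le> R s") (simp_all, (blast elim: exec_CIfE intro: exec.intros)+)

text \<open>The invariant carries the number \<open>i\<close> of finished iterations. A bound on it
  gives termination, and running times enter the invariants as \<open>T0 + c * i\<close>.\<close>

lemma wp_While:
  assumes "I 0 (R, A, Y, T)"
    and step: "\<And>i R A Y T. I i (R, A, Y, T) \<Longrightarrow> R r < R s \<Longrightarrow>
      wp M W c (I (Suc i)) (R, A, Y, 3 + T)"
    and bound: "\<And>i R A Y T. I i (R, A, Y, T) \<Longrightarrow> R r < R s \<Longrightarrow> i < B"
    and exit: "\<And>i R A Y T. I i (R, A, Y, T) \<Longrightarrow> \<not> R r < R s \<Longrightarrow> Q (R, A, Y, 3 + T)"
  shows "wp M W (CWhile r s c) Q (R, A, Y, T)"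
proof -
  have "I i (R, A, Y, T) \<Longrightarrow> wp M W (CWhile r s c) Q (R, A, Y, T)" for i R A Y T
  proof (induction "B - i" arbitrary: i R A Y T rule: less_induct)
    case less
    show ?case
    proof (cases "R r < R s")
      case True
      obtain R' A' Y' T' where 1: "exec M W c (R, A, Y, 3 + T) (R', A', Y', T')" "I (Suc i) (R', A', Y', T')"
        using step[OF less.prems True] unfolding wp_def by auto
      have "wp M W (CWhile r s c) Q (R', A', Y', T')"
        using less.hyps[OF _ 1(2)] bound[OF less.prems True] by simp
      with 1 True show ?thesis unfolding wp_def by (blast intro: exec.intros)
    next
      case False
      then show ?thesis using exit[OF less.prems] unfolding wp_def by (blast intro: exec.intros)
    qed
  qed
  with assms(1) show ?thesis by blast
qed

section \<open>Arc sets, components and decision stacks\<close>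

text \<open>An edge is a pair of arcs exchanged by the fixed-point-free involution
  \<open>tw\<close>; \<open>tg\<close> is the head of an arc. Arcs are numbered from
  \<open>n\<close> on, so vertices and arcs share one index range without overlap.\<close>

locale arc_graph =
  fixes n m k :: nat and tg tw :: "nat \<Rightarrow> nat"
  assumes tw_arc: "a \<in> {n..<n + 2 * m} \<Longrightarrow> tw a \<in> {n..<n + 2 * m}"
    and tw_tw: "a \<in> {n..<n + 2 * m} \<Longrightarrow> tw (tw a) = a"
    and tw_neq: "a \<in> {n..<n + 2 * m} \<Longrightarrow> tw a \<noteq> a"
    and tg_less: "a \<in> {n..<n + 2 * m} \<Longrightarrow> tg a < n"
    and no_loop: "a \<in> {n..<n + 2 * m} \<Longrightarrow> tg (tw a) \<noteq> tg a"
    and k_pos: "0 < k"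
begin

definition arcs :: "nat set" where "arcs = {n..<n + 2 * m}"

definition src :: "nat \<Rightarrow> nat" where "src a = tg (tw a)"

definition symm :: "nat set \<Rightarrow> bool" where
  "symm F \<longleftrightarrow> F \<subseteq> arcs \<and> (\<forall>a \<in> F. tw a \<in> F)"

definition reach :: "nat set \<Rightarrow> (nat \<times> nat) set" where
  "reach F = {(src a, tg a) | a. a \<in> F}\<^sup>*"

text \<open>Comparing sources is enough: in a symmetric set every endpoint is the source of some
  arc.\<close>

definition conn :: "nat set \<Rightarrow> bool" where
  "conn F \<longleftrightarrow> (\<forall>a \<in> F. \<forall>b \<in> F. (src a, src b) \<in> reach F)"

definition rooted :: "nat \<Rightarrow> nat set \<Rightarrow> bool" where
  "rooted r F \<longleftrightarrow> (\<forall>a \<in> F. (r, src a) \<in> reach F)"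

definition component :: "nat set \<Rightarrow> nat \<Rightarrow> nat set" where
  "component F r = {a \<in> F. (r, src a) \<in> reach F}"

definition sols :: "nat set \<Rightarrow> nat set \<Rightarrow> nat set set" where
  "sols S X = {F. symm F \<and> conn F \<and> card F = 2 * k \<and> S \<subseteq> F \<and> F \<inter> X = {}}"

section \<open>Symmetric arc sets, reachability and components\<close>

lemma finite_arcs [simp]: "finite arcs" and card_arcs [simp]: "card arcs = 2 * m"
  by (simp_all add: arcs_def)

lemma arc_ge: "a \<in> arcs \<Longrightarrow> n \<le> a" and arc_less: "a \<in> arcs \<Longrightarrow> a < n + 2 * m"
  by (simp_all add: arcs_def)

lemma tw_in [simp]: "a \<in> arcs \<Longrightarrow> tw a \<in> arcs"
  and tw_inv [simp]: "a \<in> arcs \<Longrightarrow> tw (tw a) = a"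
  and tw_ne [simp]: "a \<in> arcs \<Longrightarrow> tw a \<noteq> a"
  and tg_lt [simp]: "a \<in> arcs \<Longrightarrow> tg a < n"
  using tw_arc tw_tw tw_neq tg_less by (auto simp: arcs_def)

lemma src_lt [simp]: "a \<in> arcs \<Longrightarrow> src a < n"
  and src_tw [simp]: "a \<in> arcs \<Longrightarrow> src (tw a) = tg a"
  and src_ne_tg: "a \<in> arcs \<Longrightarrow> src a \<noteq> tg a"
  using no_loop by (simp_all add: src_def) (simp add: arcs_def)

lemma tg_tw [simp]: "tg (tw a) = src a"
  by (simp add: src_def)

lemma symm_sub: "symm F \<Longrightarrow> F \<subseteq> arcs" and symm_tw: "symm F \<Longrightarrow> a \<in> F \<Longrightarrow> tw a \<in> F"
  by (auto simp: symm_def)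

lemma symm_fin: "symm F \<Longrightarrow> finite F"
  by (metis finite_arcs rev_finite_subset symm_sub)

lemma symm_empty [simp]: "symm {}" and symm_arcs [simp]: "symm arcs"
  by (auto simp: symm_def)

lemma symm_pair [simp]: "a \<in> arcs \<Longrightarrow> symm {a, tw a}"
  by (auto simp: symm_def)

lemma symm_Un: "symm F \<Longrightarrow> symm F' \<Longrightarrow> symm (F \<union> F')"
  by (auto simp: symm_def)

lemma symm_Diff: "symm F \<Longrightarrow> symm F' \<Longrightarrow> symm (F - F')"
  unfolding symm_def by (metis Diff_iff subset_iff tw_inv)

lemma symm_tw_iff: "symm F \<Longrightarrow> a \<in> arcs \<Longrightarrow> tw a \<in> F \<longleftrightarrow> a \<in> F"
  by (metis symm_tw tw_inv)

text \<open>Arcs pair off under \<open>tw\<close>. This parity is what allows a search to stop one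
  arc short of \<open>2 * k\<close>.\<close>

lemma symm_even:
  assumes "symm F"
  shows "even (card F)"
  using symm_fin[OF assms] assms
proof (induction "card F" arbitrary: F rule: less_induct)
  case less
  show ?case
  proof (cases "F = {}")
    case False
    then obtain a where a: "a \<in> F" by auto
    with less have a': "a \<in> arcs" "tw a \<in> F" "tw a \<noteq> a" by (auto simp: symm_def)
    have sub: "{a, tw a} \<subseteq> F" using a a' by auto
    have "card F = card (F - {a, tw a}) + card {a, tw a}"
      using less.prems(1) sub by (metis card_Diff_subset card_mono finite_subset le_add_diff_inverse2)
    then have "card F = card (F - {a, tw a}) + 2" using a' by simp
    moreover have "even (card (F - {a, tw a}))"
      using less.prems a' calculation by (intro less.hyps symm_Diff symm_pair) auto
    ultimately show ?thesis by simp
  qed simp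
qed

lemma reach_refl [simp]: "(x, x) \<in> reach F"
  by (simp add: reach_def)

lemma reach_trans: "(x, y) \<in> reach F \<Longrightarrow> (y, z) \<in> reach F \<Longrightarrow> (x, z) \<in> reach F"
  by (simp add: reach_def)

lemma reach_arc: "a \<in> F \<Longrightarrow> (src a, tg a) \<in> reach F"
  unfolding reach_def by blast

lemma reach_step: "(x, src a) \<in> reach F \<Longrightarrow> a \<in> F \<Longrightarrow> (x, tg a) \<in> reach F"
  using reach_arc reach_trans by blast

lemma reach_mono: "F \<subseteq> F' \<Longrightarrow> (x, y) \<in> reach F \<Longrightarrow> (x, y) \<in> reach F'"
  unfolding reach_def by (rule subsetD[OF rtrancl_mono]) auto

lemma reach_induct [consumes 1, case_names base step]:
  assumes "(x, y) \<in> reach F" "P x"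
    and "\<And>a. a \<in> F \<Longrightarrow> (x, src a) \<in> reach F \<Longrightarrow> P (src a) \<Longrightarrow> P (tg a)"
  shows "P y"
  using assms(1) unfolding reach_def
proof (induction rule: rtrancl_induct)
  case (step y z)
  then show ?case using assms(3) unfolding reach_def by auto
qed (rule assms(2))

lemma reach_sym:
  assumes "symm F" "(x, y) \<in> reach F"
  shows "(y, x) \<in> reach F"
  using assms(2)
proof (induction rule: reach_induct)
  case (step a)
  have "(tg a, src a) \<in> reach F"
    using reach_arc[of "tw a" F] step assms(1) by (metis src_tw subsetD symm_sub symm_tw tg_tw)
  then show ?case using step reach_trans by blast
qed simp

lemma rooted_conn: "symm F \<Longrightarrow> rooted r F \<Longrightarrow> conn F"
  unfolding rooted_def conn_def using reach_sym reach_trans by blast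

lemma symm_component:
  assumes "symm F" shows "symm (component F r)"
  unfolding symm_def component_def
  using assms symm_sub[OF assms] by (auto simp: symm_tw) (metis reach_step src_tw subsetD)

lemma reach_component:
  assumes "(r, x) \<in> reach F" shows "(r, x) \<in> reach (component F r)"
  using assms by (induction rule: reach_induct) (auto intro: reach_step simp: component_def)

lemma rooted_component: "rooted r (component F r)"
  unfolding rooted_def using reach_component by (auto simp: component_def)

lemma rooted_le_component: "S \<subseteq> F \<Longrightarrow> rooted r S \<Longrightarrow> S \<subseteq> component F r"
  unfolding rooted_def component_def using reach_mono by blast

text \<open>The certificate left by a finished search: the vertex set \<open>Q\<close> is closed
  under the arcs leaving it, so nothing else is reachable, and all of it is reached along arcs
  already collected.\<close>

lemma component_eqI:
  assumes "r \<in> Q" "A = {a \<in> F. src a \<in> Q}" "tg ` A \<subseteq> Q" "\<And>v. v \<in> Q \<Longrightarrow> (r, v) \<in> reach A"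
  shows "component F r = A"
proof
  show "component F r \<subseteq> A"
  proof
    fix a assume a: "a \<in> component F r"
    then have "(r, src a) \<in> reach F" by (simp add: component_def)
    then have "src a \<in> Q"
      by (induction rule: reach_induct) (use assms in auto)
    with a show "a \<in> A" using assms by (simp add: component_def)
  qed
  show "A \<subseteq> component F r"
    using assms reach_mono[of A F] unfolding component_def by blast
qed

lemma rooted_insert:
  assumes "rooted r S" "a \<in> arcs" "(r, src a) \<in> reach S"
  shows "rooted r (S \<union> {a, tw a})"
proof -
  have "(r, src a) \<in> reach (S \<union> {a, tw a})" using assms(3) reach_mono by blast
  then show ?thesis
    using assms(1,2) reach_step[of r a "S \<union> {a, tw a}"] reach_mono[of S "S \<union> {a, tw a}"]
    unfolding rooted_def by auto
qed

section \<open>Solutions of a subproblem and the two branches of a decision\<close>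

lemma sols_split:
  assumes "a \<in> arcs"
  shows "sols S X = sols (S \<union> {a, tw a}) X \<union> sols S (X \<union> {a, tw a})"
  using assms symm_tw_iff unfolding sols_def by auto

lemma sols_subset_component:
  assumes "F \<in> sols S X" "b \<in> S" "src b = r"
  shows "F \<subseteq> component (arcs - X) r"
proof -
  have F: "F \<subseteq> arcs - X" "b \<in> F" "conn F" using assms by (auto simp: sols_def symm_def)
  show ?thesis
    using F assms(3) reach_mono[OF F(1)] unfolding component_def conn_def by blast
qed

lemma sols_small:
  assumes "b \<in> S" "src b = r" "card (component (arcs - X) r) < 2 * k"
  shows "sols S X = {}"
proof (rule ccontr)
  assume "sols S X \<noteq> {}"
  then obtain F where F: "F \<in> sols S X" by auto
  have "card F \<le> card (component (arcs - X) r)"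
    using sols_subset_component[OF F assms(1,2)]
    by (intro card_mono) (auto simp: component_def intro: finite_subset[OF _ finite_arcs])
  with F assms(3) show False by (simp add: sols_def)
qed

lemma sols_full:
  assumes "symm S" "conn S" "card S = 2 * k" "S \<inter> X = {}"
  shows "sols S X = {S}"
proof -
  have "F = S" if "F \<in> sols S X" for F
    using that assms card_subset_eq[of F S] symm_fin by (auto simp: sols_def)
  with assms show ?thesis by (auto simp: sols_def)
qed

lemma sols_component:
  assumes "b \<in> S" "src b = r" "symm X" "rooted r S" "S \<subseteq> arcs - X"
    "card (component (arcs - X) r) = 2 * k"
  shows "sols S X = {component (arcs - X) r}"
proof -
  let ?C = "component (arcs - X) r"
  have symm: "symm ?C" using assms by (intro symm_component symm_Diff) auto
  have "F = ?C" if "F \<in> sols S X" for F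
    using card_subset_eq[OF symm_fin[OF symm] sols_subset_component[OF that assms(1,2)]] that assms
    by (simp add: sols_def)
  moreover have "?C \<inter> X = {}" by (auto simp: component_def)
  then have "?C \<in> sols S X"
    using symm rooted_conn[OF symm rooted_component] assms(6) rooted_le_component[OF assms(5,4)]
    unfolding sols_def by blast
  ultimately show ?thesis by blast
qed

text \<open>
  A decision stack lists the decided edges, the latest first, each represented by one of its arcs
  and marked True if it is included and False if it is excluded. Only for an excluded edge the
  other decision is still to be explored.
\<close>

definition included :: "(nat \<times> bool) list \<Rightarrow> nat list" where
  "included st = map fst (filter snd st)"

definition excluded :: "(nat \<times> bool) list \<Rightarrow> nat list" where
  "excluded st = map fst (filter (\<lambda>p. \<not> snd p) st)"

definition both :: "nat list \<Rightarrow> nat set" where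
  "both l = set l \<union> tw ` set l"

abbreviation "inc st \<equiv> both (included st)"
abbreviation "exc st \<equiv> both (excluded st)"

text \<open>The last entry of \<open>included\<close> lies deepest in the stack, so the root does
  not move while further edges are pushed.\<close>

definition root :: "(nat \<times> bool) list \<Rightarrow> nat" where
  "root st = src (last (included st))"

text \<open>For a valid stack this is solvability of the subproblem: the included edges can be
  grown, edge by edge inside their component, to a connected set of \<open>k\<close> edges.\<close>

definition good :: "(nat \<times> bool) list \<Rightarrow> bool" where
  "good st \<longleftrightarrow> included st \<noteq> [] \<and> rooted (root st) (inc st) \<and> card (inc st) \<le> 2 * k \<and>
     2 * k \<le> card (component (arcs - exc st) (root st))"

fun valid :: "(nat \<times> bool) list \<Rightarrow> bool" where
  "valid [] = True"
| "valid ((a, b) # st) \<longleftrightarrow> valid st \<and> a \<in> arcs \<and> a \<notin> inc st \<and> a \<notin> exc st \<and>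
     (b \<or> good ((a, True) # st))"

text \<open>An excluded entry stands for the alternative subproblem that includes it. Only the
  entries below it take part, since those above will have been undone by then.\<close>

fun pending :: "(nat \<times> bool) list \<Rightarrow> nat set set" where
  "pending [] = {}"
| "pending ((a, b) # st) = (if b then {} else sols (inc ((a, True) # st)) (exc st)) \<union> pending st"

lemma included_simps [simp]:
  "included [] = []" "included ((a, True) # st) = a # included st"
  "included ((a, False) # st) = included st"
  by (simp_all add: included_def)

lemma excluded_simps [simp]:
  "excluded [] = []" "excluded ((a, False) # st) = a # excluded st"
  "excluded ((a, True) # st) = excluded st"
  by (simp_all add: excluded_def)

lemma both_simps [simp]: "both [] = {}" "both (a # l) = both l \<union> {a, tw a}"
  by (auto simp: both_def)

lemma symm_both: "set l \<subseteq> arcs \<Longrightarrow> symm (both l)"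
  by (auto simp: symm_def both_def)

lemma valid_arcs:
  assumes "valid st"
  shows "set (included st) \<subseteq> arcs" "set (excluded st) \<subseteq> arcs"
proof -
  have "set (included st) \<subseteq> arcs \<and> set (excluded st) \<subseteq> arcs"
    using assms
  proof (induction st rule: valid.induct)
    case (2 a b st)
    then show ?case by (cases b) simp_all
  qed simp
  then show "set (included st) \<subseteq> arcs" "set (excluded st) \<subseteq> arcs" by auto
qed

lemma valid_symm:
  assumes "valid st" shows "symm (inc st)" "symm (exc st)"
  using valid_arcs[OF assms] symm_both by blast+

lemma valid_disjoint:
  assumes "valid st" shows "inc st \<inter> exc st = {}"
  using assms
proof (induction st rule: valid.induct)
  case (2 a b st)
  then have "tw a \<notin> inc st" "tw a \<notin> exc st"
    using symm_tw_iff valid_symm by auto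
  with 2 show ?case by (cases b) auto
qed simp

lemma card_both_Cons:
  assumes "a \<in> arcs" "symm (both l)" "a \<notin> both l"
  shows "card (both (a # l)) = card (both l) + 2"
proof -
  have "tw a \<notin> both l" using assms symm_tw_iff by auto
  then show ?thesis using assms symm_fin[OF assms(2)] tw_ne[OF assms(1)]
    by (simp add: card_insert_if eq_commute[of a])
qed

lemma valid_card:
  assumes "valid st"
  shows "card (inc st) = 2 * length (included st)" "card (exc st) = 2 * length (excluded st)"
proof -
  have "card (inc st) = 2 * length (included st) \<and> card (exc st) = 2 * length (excluded st)"
    using assms
  proof (induction st rule: valid.induct)
    case (2 a b st)
    then show ?case
      using card_both_Cons[of a "included st"] card_both_Cons[of a "excluded st"] valid_symm[of st]
      by (cases b) auto
  qed simp
  then show "card (inc st) = 2 * length (included st)" "card (exc st) = 2 * length (excluded st)"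
    by auto
qed

lemma length_included_excluded: "length (included st) + length (excluded st) = length st"
  by (induction st) (auto simp: included_def excluded_def)

lemma valid_length:
  assumes "valid st" shows "length st \<le> m"
proof -
  have "card (inc st \<union> exc st) \<le> card arcs"
    using valid_symm[OF assms] symm_sub by (intro card_mono) auto
  moreover have "card (inc st \<union> exc st) = card (inc st) + card (exc st)"
    using valid_symm[OF assms] valid_disjoint[OF assms] symm_fin by (intro card_Un_disjoint) auto
  ultimately show ?thesis
    using valid_card[OF assms] length_included_excluded[of st] by simp
qed

text \<open>Every pending solution contains an edge that is excluded in \<open>st\<close> and hence
  lies in \<open>X\<close>.\<close>

lemma sols_pending_disjoint:
  "X \<supseteq> exc st \<Longrightarrow> sols S X \<inter> pending st = {}"
proof (induction st arbitrary: X rule: pending.induct)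
  case (2 a b st)
  then show ?case by (cases b) (auto simp: sols_def)
qed simp

lemma finite_sols: "finite (sols S X)"
  by (rule finite_subset[of _ "Pow arcs"]) (auto simp: sols_def symm_def)

lemma good_root:
  assumes "good st" shows "last (included st) \<in> inc st" "src (last (included st)) = root st"
  using assms by (auto simp: good_def both_def root_def)

lemma root_Cons: "included st \<noteq> [] \<Longrightarrow> root ((a, b) # st) = root st"
  by (cases b) (auto simp: root_def)

text \<open>Without \<open>a\<close> the component is too small, so the excluding branch is empty by
  \<open>sols_small\<close> and the inclusion leaves no alternative to come back to.\<close>

lemma valid_force:
  assumes "valid st" "good st" "a \<in> arcs" "a \<notin> inc st" "a \<notin> exc st"
    "(root st, src a) \<in> reach (inc st)"
    "card (component (arcs - (exc st \<union> {a, tw a})) (root st)) < 2 * k"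
    "card (inc st) < 2 * k"
  shows "valid ((a, True) # st)" "good ((a, True) # st)"
    "sols (inc st) (exc st) = sols (inc ((a, True) # st)) (exc ((a, True) # st))"
    "pending ((a, True) # st) = pending st"
proof -
  \<comment> \<open>Both sides are even, so the strict inequality leaves room for both arcs of the
    edge.\<close>
  have even: "card (inc st) + 2 \<le> 2 * k"
    using assms(8) valid_card[OF assms(1)] by simp
  have "rooted (root st) (inc ((a, True) # st))"
    using rooted_insert assms by (auto simp: good_def)
  then show "good ((a, True) # st)"
    using assms even card_both_Cons[OF assms(3) valid_symm(1)[OF assms(1)] assms(4)]
    by (auto simp: good_def root_Cons)
  show "sols (inc st) (exc st) = sols (inc ((a, True) # st)) (exc ((a, True) # st))"
    by (subst sols_split[OF assms(3)]) (simp add: sols_small[OF good_root[OF assms(2)] assms(7)] del: Un_insert_right)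
qed (use assms in auto)

text \<open>The search goes on in the excluding branch and the including one becomes pending. The
  latter is \<open>good\<close> because an edge attached to the included set keeps it rooted and the
  component does not change.\<close>

lemma valid_branch:
  assumes "valid st" "good st" "a \<in> arcs" "a \<notin> inc st" "a \<notin> exc st"
    "(root st, src a) \<in> reach (inc st)"
    "2 * k \<le> card (component (arcs - (exc st \<union> {a, tw a})) (root st))"
    "card (inc st) < 2 * k"
  shows "valid ((a, False) # st)" "good ((a, False) # st)"
    "sols (inc st) (exc st) \<union> pending st =
     sols (inc ((a, False) # st)) (exc ((a, False) # st)) \<union> pending ((a, False) # st)"
proof -
  have even: "card (inc st) + 2 \<le> 2 * k"
    using assms(8) valid_card[OF assms(1)] by simp
  have "rooted (root st) (inc ((a, True) # st))"
    using rooted_insert assms by (auto simp: good_def)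
  then have "good ((a, True) # st)"
    using assms even card_both_Cons[OF assms(3) valid_symm(1)[OF assms(1)] assms(4)]
    by (auto simp: good_def root_Cons)
  then show "valid ((a, False) # st)" using assms by auto
  show "good ((a, False) # st)"
    using assms by (auto simp: good_def root_Cons)
  show "sols (inc st) (exc st) \<union> pending st =
     sols (inc ((a, False) # st)) (exc ((a, False) # st)) \<union> pending ((a, False) # st)"
    by (subst sols_split[OF assms(3)]) auto
qed

end

section \<open>Doubly linked adjacency lists\<close>

type_synonym links = "(nat \<Rightarrow> nat) \<times> (nat \<Rightarrow> nat)"

text \<open>With equal ends, \<open>seg f v xs v\<close> is a circular doubly linked list with
  sentinel \<open>v\<close>.\<close>

fun seg :: "links \<Rightarrow> nat \<Rightarrow> nat list \<Rightarrow> nat \<Rightarrow> bool" where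
  "seg f x [] y \<longleftrightarrow> fst f x = y \<and> snd f y = x"
| "seg f x (z # zs) y \<longleftrightarrow> fst f x = z \<and> snd f z = x \<and> seg f z zs y"

definition unlink :: "nat \<Rightarrow> links \<Rightarrow> links" where
  "unlink a f = ((fst f)(snd f a := fst f a), (snd f)(fst f a := snd f a))"

text \<open>A removed cell keeps its own two pointers; they still name the neighbours between which
  it has to be put back.\<close>

definition relink :: "nat \<Rightarrow> links \<Rightarrow> links" where
  "relink a f = ((fst f)(snd f a := a), (snd f)(fst f a := a))"

definition insert_front :: "nat \<Rightarrow> nat \<Rightarrow> links \<Rightarrow> links" where
  "insert_front v a f = ((fst f)(a := fst f v, v := a), (snd f)(a := v, fst f v := a))"

lemma seg_append: "seg f x (xs @ a # ys) y \<longleftrightarrow> seg f x xs a \<and> seg f a ys y"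
  by (induction xs arbitrary: x) auto

lemma seg_hd: "seg f x xs y \<Longrightarrow> fst f x = hd (xs @ [y]) \<and> snd f (hd (xs @ [y])) = x"
  by (cases xs) auto

lemma seg_last: "seg f x xs y \<Longrightarrow> snd f y = last (x # xs) \<and> fst f (last (x # xs)) = y"
  by (induction xs arbitrary: x) auto

lemma seg_frame:
  assumes "seg f x zs y" "\<And>p. p \<in> set (x # zs) \<Longrightarrow> fst g p = fst f p"
    "\<And>q. q \<in> set (zs @ [y]) \<Longrightarrow> snd g q = snd f q"
  shows "seg g x zs y"
  using assms by (induction zs arbitrary: x) auto

lemma seg_unlink:
  assumes "seg f x (xs @ a # ys) y" "distinct (xs @ a # ys)" "x \<notin> set (xs @ a # ys)" "y \<notin> set (xs @ a # ys)"
  shows "seg (unlink a f) x (xs @ ys) y"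
  using assms
proof (induction xs arbitrary: x)
  case Nil
  show ?case
  proof (cases ys)
    case Nil
    then show ?thesis using Nil.prems by (auto simp: unlink_def)
  next
    case (Cons z zs)
    have "seg (unlink a f) z zs y"
      by (rule seg_frame[of f]) (use Nil.prems Cons in \<open>auto simp: unlink_def\<close>)
    then show ?thesis using Nil.prems Cons by (auto simp: unlink_def)
  qed
next
  case (Cons w xs)
  have 1: "seg f w xs a" "seg f a ys y" using Cons.prems by (auto simp: seg_append)
  have "snd f a = last (w # xs)" "fst f a = hd (ys @ [y])" using seg_last[OF 1(1)] seg_hd[OF 1(2)] by auto
  moreover have "last (w # xs) \<in> set (w # xs)" "hd (ys @ [y]) \<in> set (ys @ [y])"
    by (rule last_in_set, simp) (rule hd_in_set, simp)
  ultimately have "snd f a \<noteq> x" "fst f a \<noteq> w" using Cons.prems by auto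
  moreover have "seg (unlink a f) w (xs @ ys) y" by (rule Cons.IH) (use Cons.prems in auto)
  ultimately show ?case using Cons.prems by (auto simp: unlink_def)
qed

lemma seg_insert_front:
  assumes "seg f v xs v" "a \<notin> set (v # xs)" "v \<notin> set xs" "distinct xs"
  shows "seg (insert_front v a f) v (a # xs) v"
proof (cases xs)
  case (Cons z zs)
  have "seg (insert_front v a f) z zs v"
    by (rule seg_frame[of f]) (use assms Cons in \<open>auto simp: insert_front_def\<close>)
  then show ?thesis using assms Cons by (auto simp: insert_front_def)
qed (use assms in \<open>auto simp: insert_front_def\<close>)

section \<open>One circular list of outgoing arcs per vertex\<close>

context arc_graph
begin

definition out_lists :: "(nat \<Rightarrow> nat list) \<Rightarrow> bool" where
  "out_lists out \<longleftrightarrow> (\<forall>v < n. distinct (out v) \<and> (\<forall>a \<in> set (out v). a \<in> arcs \<and> src a = v))"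

definition linked :: "links \<Rightarrow> (nat \<Rightarrow> nat list) \<Rightarrow> bool" where
  "linked f out \<longleftrightarrow> (\<forall>v < n. seg f v (out v) v)"

lemma out_lists_less: "out_lists out \<Longrightarrow> v < n \<Longrightarrow> v \<notin> set (out v')" if "v' < n"
  using arc_ge that by (fastforce simp: out_lists_def)

lemma linked_neighbours:
  assumes "linked f out" "out_lists out" "v < n" "a \<in> set (out v)"
  shows "fst f (snd f a) = a" "snd f (fst f a) = a" "snd f a \<noteq> a" "fst f a \<noteq> a"
    "snd f a \<in> insert v (set (out v))" "fst f a \<in> insert v (set (out v))"
proof -
  obtain xs ys where sp: "out v = xs @ a # ys" using assms(4) by (meson split_list)
  have seg: "seg f v xs a" "seg f a ys v"
    using assms(1,3) sp by (auto simp: linked_def seg_append)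
  have d: "distinct (xs @ a # ys)" "v \<notin> set (xs @ a # ys)"
    using assms(2,3) out_lists_less[OF assms(3,2,3)] unfolding sp[symmetric] by (auto simp: out_lists_def)
  note l = seg_last[OF seg(1)] note h = seg_hd[OF seg(2)]
  have m: "last (v # xs) \<in> set (v # xs)" "hd (ys @ [v]) \<in> set (ys @ [v])"
    by (rule last_in_set, simp) (rule hd_in_set, simp)
  show "fst f (snd f a) = a" "snd f (fst f a) = a" using l h by auto
  show "snd f a \<noteq> a" "fst f a \<noteq> a" using l h m d by auto
  show "snd f a \<in> insert v (set (out v))" "fst f a \<in> insert v (set (out v))"
    using l h m sp by auto
qed

text \<open>Unlinking writes only to the two neighbours of the cell. Neither is the cell itself, so
  its own pointers survive and the removal can be inverted exactly.\<close>

lemma relink_unlink: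
  assumes "linked f out" "out_lists out" "v < n" "a \<in> set (out v)"
  shows "relink a (unlink a f) = f"
  using linked_neighbours[OF assms] by (cases f) (auto simp: relink_def unlink_def fun_eq_iff)

lemma linked_unlink:
  assumes "linked f out" "out_lists out" "v < n" "a \<in> set (out v)"
  shows "linked (unlink a f) (\<lambda>u. filter (\<lambda>b. b \<noteq> a) (out u))"
  unfolding linked_def
proof (intro allI impI)
  fix u assume u: "u < n"
  show "seg (unlink a f) u (filter (\<lambda>b. b \<noteq> a) (out u)) u"
  proof (cases "u = v")
    case True
    obtain xs ys where sp: "out v = xs @ a # ys" using assms(4) by (meson split_list)
    have d: "distinct (xs @ a # ys)" "v \<notin> set (xs @ a # ys)"
      using assms(2,3) out_lists_less[OF assms(3,2,3)] unfolding sp[symmetric] by (auto simp: out_lists_def)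
    have "filter (\<lambda>b. b \<noteq> a) zs = zs" if "a \<notin> set zs" for zs
      using that by (metis (mono_tags, lifting) filter_True)
    then have "filter (\<lambda>b. b \<noteq> a) (out v) = xs @ ys" using sp d by auto
    moreover have "seg f v (xs @ a # ys) v" using assms sp by (auto simp: linked_def)
    ultimately show ?thesis using seg_unlink[OF _ d(1) d(2) d(2)] True by simp
  next
    case False
    have dis: "x \<notin> insert v (set (out v))" if "x \<in> insert u (set (out u))" for x
      using that False u assms(2,3) arc_ge unfolding out_lists_def
      by (metis insert_iff leD)
    then have "a \<notin> set (out u)" using assms(4) by auto
    then have "filter (\<lambda>b. b \<noteq> a) (out u) = out u" by (metis (mono_tags, lifting) filter_True)
    moreover have "seg (unlink a f) u (out u) u"
      by (rule seg_frame[of f])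
        (use assms(1) u dis linked_neighbours(5,6)[OF assms] in \<open>auto simp: linked_def unlink_def\<close>)
    ultimately show ?thesis by simp
  qed
qed

lemma out_lists_filter: "out_lists out \<Longrightarrow> out_lists (\<lambda>u. filter P (out u))"
  by (auto simp: out_lists_def)

end

locale linked_graph = arc_graph +
  fixes ol :: "nat \<Rightarrow> nat list" and f0 :: links
  assumes ol: "v < n \<Longrightarrow> distinct (ol v)" "v < n \<Longrightarrow> set (ol v) = {a \<in> arcs. src a = v}"
    and f0: "linked f0 ol"
    and f0_bound: "x < n + 2 * m \<Longrightarrow> fst f0 x < n + 2 * m \<and> snd f0 x < n + 2 * m"
begin

text \<open>Filtering keeps the original order, so the scanned part of a list stays a prefix when an
  arc ahead of it is deleted.\<close>

definition live :: "nat set \<Rightarrow> nat \<Rightarrow> nat list" where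
  "live X v = filter (\<lambda>a. a \<notin> X) (ol v)"

text \<open>The pointers are a function of the deletion history alone. Undoing the latest deletion
  therefore restores literally the pointers of the shorter history, and the invariants need to name
  only the history.\<close>

fun lk :: "nat list \<Rightarrow> links" where
  "lk [] = f0"
| "lk (a # D) = unlink (tw a) (unlink a (lk D))"

fun deletable :: "nat list \<Rightarrow> bool" where
  "deletable [] = True"
| "deletable (a # D) \<longleftrightarrow> deletable D \<and> a \<in> arcs \<and> a \<notin> both D"

lemma set_live: "v < n \<Longrightarrow> set (live X v) = {a \<in> arcs - X. src a = v}"
  using ol by (auto simp: live_def)

lemma distinct_live: "v < n \<Longrightarrow> distinct (live X v)"
  using ol by (auto simp: live_def)

lemma out_lists_live: "out_lists (live X)"
  using ol by (auto simp: live_def out_lists_def)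

text \<open>The twin of \<open>p\<close> starts at the other end of the edge, so only
  \<open>p\<close> disappears from this list.\<close>

lemma live_split:
  assumes "live X v = xs @ p # ys" "v < n"
  shows "live (X \<union> {p, tw p}) v = xs @ ys"
proof -
  have p: "p \<in> arcs" "src p = v" using set_live[OF assms(2), of X] assms(1) by auto
  have "tw p \<notin> set (live X v)" using set_live[OF assms(2), of X] p src_ne_tg[of p] by auto
  moreover have "live (X \<union> {p, tw p}) v = filter (\<lambda>a. a \<noteq> p \<and> a \<noteq> tw p) (live X v)"
    unfolding live_def filter_filter by (rule filter_cong) auto
  moreover have "distinct (xs @ p # ys)" using distinct_live[OF assms(2), of X] assms(1) by simp
  moreover have "filter (\<lambda>a. a \<noteq> p \<and> a \<noteq> tw p) zs = zs" if "p \<notin> set zs" "tw p \<notin> set zs" for zs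
    using that by (metis (mono_tags, lifting) filter_True)
  ultimately show ?thesis using assms(1) by auto
qed

lemma deletable_arcs: "deletable D \<Longrightarrow> set D \<subseteq> arcs"
  by (induction D) auto

lemma unlink_chain:
  assumes "linked f (live (both D))" "a \<in> arcs" "a \<notin> both D" "symm (both D)"
  shows "linked (unlink a f) (\<lambda>u. filter (\<lambda>b. b \<noteq> a) (live (both D) u))"
    "tw a \<in> set (filter (\<lambda>b. b \<noteq> a) (live (both D) (tg a)))"
    "a \<in> set (live (both D) (src a))"
    "linked (unlink (tw a) (unlink a f)) (live (both (a # D)))"
proof -
  show a: "a \<in> set (live (both D) (src a))" using assms by (simp add: set_live)
  show 1: "linked (unlink a f) (\<lambda>u. filter (\<lambda>b. b \<noteq> a) (live (both D) u))"
    by (rule linked_unlink[OF assms(1) out_lists_live _ a]) (use assms in simp)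
  show 2: "tw a \<in> set (filter (\<lambda>b. b \<noteq> a) (live (both D) (tg a)))"
    using assms symm_tw_iff[OF assms(4,2)] by (simp add: set_live)
  have "linked (unlink (tw a) (unlink a f)) (\<lambda>u. filter (\<lambda>b. b \<noteq> tw a) (filter (\<lambda>b. b \<noteq> a) (live (both D) u)))"
    by (rule linked_unlink[OF 1 out_lists_filter[OF out_lists_live] _ 2]) (use assms in simp)
  moreover have "(\<lambda>u. filter (\<lambda>b. b \<noteq> tw a) (filter (\<lambda>b. b \<noteq> a) (live (both D) u))) = live (both (a # D))"
    unfolding live_def filter_filter by (intro ext filter_cong) auto
  ultimately show "linked (unlink (tw a) (unlink a f)) (live (both (a # D)))" by simp
qed

lemma linked_lk: "deletable D \<Longrightarrow> linked (lk D) (live (both D))"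
proof (induction D)
  case Nil
  have "live {} = ol" by (simp add: live_def fun_eq_iff)
  then show ?case using f0 by simp
next
  case (Cons a D)
  then show ?case
    using unlink_chain(4)[of "lk D" D a] symm_both deletable_arcs by auto
qed

lemma relink_lk:
  assumes "deletable (a # D)"
  shows "relink a (relink (tw a) (lk (a # D))) = lk D"
proof -
  have D: "deletable D" "a \<in> arcs" "a \<notin> both D" "symm (both D)"
    using assms symm_both deletable_arcs by auto
  note c = unlink_chain[OF linked_lk[OF D(1)] D(2,3,4)]
  have "relink (tw a) (unlink (tw a) (unlink a (lk D))) = unlink a (lk D)"
    by (rule relink_unlink[OF c(1) out_lists_filter[OF out_lists_live] _ c(2)]) (use D in simp)
  moreover have "relink a (unlink a (lk D)) = lk D"
    by (rule relink_unlink[OF linked_lk[OF D(1)] out_lists_live _ c(3)]) (use D in simp)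
  ultimately show ?thesis by simp
qed

lemma unlink_bound:
  assumes "\<And>x. x < N \<Longrightarrow> fst f x < N \<and> snd f x < N" "a < N" "x < N"
  shows "fst (unlink a f) x < N" "snd (unlink a f) x < N"
  using assms by (auto simp: unlink_def)

lemma lk_bound:
  assumes "deletable D" "x < n + 2 * m"
  shows "fst (lk D) x < n + 2 * m" "snd (lk D) x < n + 2 * m"
proof -
  have "fst (lk D) x < n + 2 * m \<and> snd (lk D) x < n + 2 * m"
    using assms
  proof (induction D arbitrary: x)
    case Nil
    then show ?case using f0_bound by simp
  next
    case (Cons a D)
    have a: "a < n + 2 * m" "tw a < n + 2 * m" using Cons arc_less tw_in by auto
    have "fst (unlink a (lk D)) x < n + 2 * m \<and> snd (unlink a (lk D)) x < n + 2 * m"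
      if "x < n + 2 * m" for x
      using that a Cons unlink_bound[of "n + 2 * m" "lk D" a x] by auto
    then show ?case
      using a Cons unlink_bound[of "n + 2 * m" "unlink a (lk D)" "tw a" x] by auto
  qed
  then show "fst (lk D) x < n + 2 * m" "snd (lk D) x < n + 2 * m" by auto
qed

lemma lk_first:
  assumes "deletable D" "v < n"
  shows "fst (lk D) v = hd (live (both D) v @ [v])"
  using seg_hd linked_lk[OF assms(1)] assms(2) by (auto simp: linked_def)

lemma lk_next:
  assumes "deletable D" "v < n" "live (both D) v = xs @ p # ys"
  shows "fst (lk D) p = hd (ys @ [v])"
proof -
  have "seg (lk D) p ys v"
    using linked_lk[OF assms(1)] assms(2,3) by (auto simp: linked_def seg_append)
  then show ?thesis using seg_hd by blast
qed

text \<open>The search moves on from an arc it has just unlinked. The forward pointer of that arc is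
  still right: unlinking \<open>p\<close> writes to its neighbours, and unlinking the twin writes
  within the list of another vertex.\<close>

lemma lk_next_deleted:
  assumes "deletable (p # D)" "v < n" "live (both D) v = xs @ p # ys"
  shows "fst (lk (p # D)) p = hd (ys @ [v])"
proof -
  have D: "deletable D" "p \<in> arcs" "p \<notin> both D" "symm (both D)"
    using assms symm_both deletable_arcs by auto
  note c = unlink_chain[OF linked_lk[OF D(1)] D(2,3,4)]
  have "snd (unlink p (lk D)) (tw p) \<in> insert (tg p) (set (filter (\<lambda>b. b \<noteq> p) (live (both D) (tg p))))"
    by (rule linked_neighbours(5)[OF c(1) out_lists_filter[OF out_lists_live] _ c(2)]) (use D in simp)
  then have "snd (unlink p (lk D)) (tw p) \<noteq> p" using D arc_ge tg_lt by fastforce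
  then have "fst (lk (p # D)) p = fst (unlink p (lk D)) p" by (simp add: unlink_def[of "tw p"])
  also have "snd (lk D) p \<noteq> p"
    by (rule linked_neighbours(3)[OF linked_lk[OF D(1)] out_lists_live _ c(3)]) (use D in simp)
  then have "fst (unlink p (lk D)) p = fst (lk D) p" by (simp add: unlink_def)
  also have "\<dots> = hd (ys @ [v])" by (rule lk_next[OF D(1) assms(2,3)])
  finally show ?thesis .
qed

lemma valid_deletable: "valid st \<Longrightarrow> deletable (excluded st)"
proof (induction st rule: valid.induct)
  case (2 a b st)
  then show ?case by (cases b) auto
qed simp

end

section \<open>Searching for the next branching edge\<close>

context linked_graph
begin

text \<open>The value 0 is free to mean absence, because arcs are numbered from \<open>n\<close> on
  and \<open>n\<close> is positive wherever an edge gets reserved.\<close>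

definition deleted :: "(nat \<times> bool) list \<Rightarrow> nat \<Rightarrow> nat set" where
  "deleted st res = exc st \<union> (if res = 0 then {} else {res, tw res})"

text \<open>
  The graph without the excluded edges and without the reserved edge \<open>res\<close> (0 if there is none) is
  searched from the root. The vertices in \<open>take qh Q\<close> have been scanned, the list of \<open>Q ! qh\<close> up to
  \<open>xs\<close>, and \<open>L\<close> lists the scanned arcs. As long as nothing is reserved, the search has
  scanned at most \<open>k\<close> edges, and the vertices still to be scanned are reached by included edges.
\<close>

definition explored ::
  "(nat \<times> bool) list \<Rightarrow> nat \<Rightarrow> nat list \<Rightarrow> nat \<Rightarrow> nat list \<Rightarrow> nat list \<Rightarrow> nat list \<Rightarrow> bool" where
  "explored st res Q qh xs ys L \<longleftrightarrow>
     valid st \<and> good st \<and> distinct Q \<and> set Q \<subseteq> {..<n} \<and> root st \<in> set Q \<and> qh \<le> length Q \<and>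
     distinct L \<and>
     set L = {a \<in> arcs - deleted st res. src a \<in> set (take qh Q)} \<union> set xs \<and>
     (qh < length Q \<longrightarrow> live (deleted st res) (Q ! qh) = xs @ ys) \<and> (qh = length Q \<longrightarrow> xs = []) \<and>
     tg ` set L \<subseteq> set Q \<and> (\<forall>v \<in> set Q. (root st, v) \<in> reach (set L)) \<and> length Q \<le> 1 + length L \<and>
     (res \<noteq> 0 \<longrightarrow> res \<in> arcs \<and> res \<notin> inc st \<and> res \<notin> exc st \<and> src res \<in> set Q \<and>
        (root st, src res) \<in> reach (inc st) \<and> card (inc st) < 2 * k) \<and>
     (res = 0 \<longrightarrow> (\<forall>a \<in> set L. a \<in> inc st \<or> tw a \<in> set L) \<and>
        card (set L \<union> tw ` set L \<union> inc st) \<le> 2 * k \<and>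
        (\<forall>v \<in> set (drop qh Q). (root st, v) \<in> reach (inc st)))"

lemma exploredD:
  assumes "explored st res Q qh xs ys L"
  shows "valid st" "good st" "distinct Q" "set Q \<subseteq> {..<n}" "root st \<in> set Q" "qh \<le> length Q"
    "length L = card (set L)" "distinct L"
    "set L = {a \<in> arcs - deleted st res. src a \<in> set (take qh Q)} \<union> set xs"
    "qh < length Q \<Longrightarrow> live (deleted st res) (Q ! qh) = xs @ ys" "qh = length Q \<Longrightarrow> xs = []"
    "tg ` set L \<subseteq> set Q" "\<And>v. v \<in> set Q \<Longrightarrow> (root st, v) \<in> reach (set L)" "length Q \<le> 1 + length L"
    "res \<noteq> 0 \<Longrightarrow> res \<in> arcs" "res \<noteq> 0 \<Longrightarrow> res \<notin> inc st" "res \<noteq> 0 \<Longrightarrow> res \<notin> exc st"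
    "res \<noteq> 0 \<Longrightarrow> src res \<in> set Q" "res \<noteq> 0 \<Longrightarrow> (root st, src res) \<in> reach (inc st)"
    "res \<noteq> 0 \<Longrightarrow> card (inc st) < 2 * k"
    "res = 0 \<Longrightarrow> \<forall>a \<in> set L. a \<in> inc st \<or> tw a \<in> set L"
    "res = 0 \<Longrightarrow> card (set L \<union> tw ` set L \<union> inc st) \<le> 2 * k"
    "res = 0 \<Longrightarrow> \<forall>v \<in> set (drop qh Q). (root st, v) \<in> reach (inc st)"
proof -
  show "length L = card (set L)"
    using assms distinct_card[of L] unfolding explored_def by metis
qed (use assms in \<open>unfold explored_def, blast+\<close>)

lemma exploredI:
  assumes "valid st" "good st" "distinct Q" "set Q \<subseteq> {..<n}" "root st \<in> set Q" "qh \<le> length Q"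
    "distinct L" "set L = {a \<in> arcs - deleted st res. src a \<in> set (take qh Q)} \<union> set xs"
    "qh < length Q \<Longrightarrow> live (deleted st res) (Q ! qh) = xs @ ys" "qh = length Q \<Longrightarrow> xs = []"
    "tg ` set L \<subseteq> set Q" "\<And>v. v \<in> set Q \<Longrightarrow> (root st, v) \<in> reach (set L)" "length Q \<le> 1 + length L"
    "res \<noteq> 0 \<Longrightarrow> res \<in> arcs" "res \<noteq> 0 \<Longrightarrow> res \<notin> inc st" "res \<noteq> 0 \<Longrightarrow> res \<notin> exc st"
    "res \<noteq> 0 \<Longrightarrow> src res \<in> set Q" "res \<noteq> 0 \<Longrightarrow> (root st, src res) \<in> reach (inc st)"
    "res \<noteq> 0 \<Longrightarrow> card (inc st) < 2 * k"
    "res = 0 \<Longrightarrow> \<forall>a \<in> set L. a \<in> inc st \<or> tw a \<in> set L"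
    "res = 0 \<Longrightarrow> card (set L \<union> tw ` set L \<union> inc st) \<le> 2 * k"
    "res = 0 \<Longrightarrow> \<forall>v \<in> set (drop qh Q). (root st, v) \<in> reach (inc st)"
  shows "explored st res Q qh xs ys L"
  unfolding explored_def by (intro conjI impI; (fact assms | erule assms | (rule ballI, erule assms)))

lemma root_less: "valid st \<Longrightarrow> good st \<Longrightarrow> root st < n"
  using valid_arcs[of st] by (auto simp: good_def root_def intro!: src_lt)

lemma explored_init:
  assumes "valid st" "good st"
  shows "explored st 0 [root st] 0 [] (live (exc st) (root st)) []"
  using assms root_less[OF assms] by (auto simp: explored_def deleted_def good_def)

lemma explored_nth_less:
  assumes "explored st res Q qh xs ys L" "i < length Q"
  shows "Q ! i < n"
  using exploredD(4)[OF assms(1)] nth_mem[OF assms(2)] by auto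

lemma explored_arcs:
  assumes "explored st res Q qh xs ys L"
  shows "set L \<subseteq> arcs - deleted st res" "src ` set L \<subseteq> set Q"
proof -
  note D = exploredD[OF assms]
  have "set xs \<subseteq> {a \<in> arcs - deleted st res. src a \<in> set Q}"
  proof (cases "qh < length Q")
    case True
    have "set xs \<subseteq> set (live (deleted st res) (Q ! qh))" unfolding D(10)[OF True] by simp
    then have "set xs \<subseteq> {a \<in> arcs - deleted st res. src a = Q ! qh}"
      unfolding set_live[OF explored_nth_less[OF assms True]] .
    also have "\<dots> \<subseteq> {a \<in> arcs - deleted st res. src a \<in> set Q}" using nth_mem[OF True] by (intro Collect_mono) simp
    finally show ?thesis .
  next
    case False
    then show ?thesis using D(6,11) by simp
  qed
  moreover have "set (take qh Q) \<subseteq> set Q" by (rule set_take_subset)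
  ultimately show "set L \<subseteq> arcs - deleted st res" "src ` set L \<subseteq> set Q"
    unfolding D(9) by auto
qed

lemma explored_symm:
  assumes "explored st res Q qh xs ys L"
  shows "symm (deleted st res)" "symm (arcs - deleted st res)"
proof -
  show "symm (deleted st res)"
    using exploredD(1,15)[OF assms] valid_symm(2)[of st] symm_Un[OF _ symm_pair]
    by (simp add: deleted_def)
  then show "symm (arcs - deleted st res)" by (intro symm_Diff symm_arcs)
qed

lemma explored_bound:
  assumes "explored st 0 Q qh xs ys L"
  shows "length L \<le> 2 * k"
proof -
  note D = exploredD[OF assms]
  have "card (set L) \<le> card (set L \<union> tw ` set L \<union> inc st)"
    using symm_fin[OF valid_symm(1)[OF D(1)]] by (intro card_mono) auto
  then show ?thesis using D(7,22) by simp
qed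

lemma explored_component:
  assumes "explored st res Q qh xs ys L"
  shows "set L \<subseteq> component (arcs - deleted st res) (root st)"
  using explored_arcs[OF assms] exploredD(13)[OF assms] reach_mono[OF explored_arcs(1)[OF assms]]
  unfolding component_def by blast

text \<open>One arc may be missing: the component is symmetric, hence of even size, so
  \<open>2 * k - 1\<close> arcs force \<open>2 * k\<close>.\<close>

lemma explored_large:
  assumes "explored st res Q qh xs ys L" "2 * k \<le> length L + 1"
  shows "2 * k \<le> card (component (arcs - deleted st res) (root st))"
proof -
  let ?C = "component (arcs - deleted st res) (root st)"
  have symm: "symm ?C" by (rule symm_component[OF explored_symm(2)[OF assms(1)]])
  have "card (set L) \<le> card ?C"
    using explored_component[OF assms(1)] symm_fin[OF symm] by (intro card_mono) auto
  then have "2 * k \<le> card ?C + 1" using assms(2) exploredD(7)[OF assms(1)] by simp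
  moreover obtain c where "card ?C = 2 * c" using symm_even[OF symm] by (auto elim: evenE)
  ultimately show ?thesis by simp
qed

lemma explored_exhausted:
  assumes "explored st res Q qh xs ys L" "qh = length Q"
  shows "component (arcs - deleted st res) (root st) = set L"
proof -
  note D = exploredD[OF assms(1)]
  show ?thesis
    by (rule component_eqI[OF D(5) _ D(12,13)]) (use D(9) D(11)[OF assms(2)] assms(2) in simp_all)
qed

lemma explored_current:
  assumes "explored st res Q qh xs (p # ys) L" "qh < length Q"
  shows "p \<in> arcs - deleted st res" "src p = Q ! qh" "p \<notin> set L" "Q ! qh < n"
proof -
  note D = exploredD[OF assms(1)]
  show v: "Q ! qh < n" by (rule explored_nth_less[OF assms])
  note l = D(10)[OF assms(2)]
  then have "p \<in> set (live (deleted st res) (Q ! qh))" by simp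
  then show p: "p \<in> arcs - deleted st res" "src p = Q ! qh" unfolding set_live[OF v] by auto
  have "p \<notin> set xs" using distinct_live[OF v, of "deleted st res"] l by auto
  moreover have "Q ! qh \<notin> set (take qh Q)"
    using D(3) assms(2) by (auto simp: in_set_conv_nth nth_eq_iff_index_eq)
  ultimately show "p \<notin> set L" unfolding D(9) using p by auto
qed

lemma take_Suc_set: "i < length xs \<Longrightarrow> set (take (Suc i) xs) = insert (xs ! i) (set (take i xs))"
  by (simp add: take_Suc_conv_app_nth)

lemma explored_next_vertex:
  assumes "explored st res Q qh xs [] L" "qh < length Q"
  shows "explored st res Q (Suc qh) [] (live (deleted st res) (Q ! Suc qh)) L"
proof -
  note D = exploredD[OF assms(1)]
  have v: "Q ! qh < n" by (rule explored_nth_less[OF assms])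
  have "set xs = {a \<in> arcs - deleted st res. src a = Q ! qh}"
    using D(10)[OF assms(2)] set_live[OF v, of "deleted st res"] by simp
  then have L: "set L = {a \<in> arcs - deleted st res. src a \<in> set (take (Suc qh) Q)} \<union> set []"
    unfolding D(9) take_Suc_set[OF assms(2)] by auto
  have "set (drop (Suc qh) Q) \<subseteq> set (drop qh Q)" by (simp add: set_drop_subset_set_drop)
  then have r: "res = 0 \<Longrightarrow> \<forall>v \<in> set (drop (Suc qh) Q). (root st, v) \<in> reach (inc st)" using D(23) by blast
  show ?thesis
    by (rule exploredI; (fact D L r | simp add: assms(2) Suc_le_eq))
qed

text \<open>As long as nothing is reserved only included arcs are scanned. They are counted already,
  so the bound \<open>2 * k\<close> on scanned and included arcs is kept, and the far end is again
  reached by included edges.\<close>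

lemma explored_scan:
  assumes "explored st res Q qh xs (p # ys) L" "qh < length Q" "res \<noteq> 0 \<or> p \<in> inc st"
  shows "explored st res (if tg p \<in> set Q then Q else Q @ [tg p]) qh (xs @ [p]) ys (L @ [p])"
proof -
  let ?Q = "if tg p \<in> set Q then Q else Q @ [tg p]"
  note c = explored_current[OF assms(1,2)]
  have E: "valid st" "good st" "distinct Q" "set Q \<subseteq> {..<n}" "root st \<in> set Q" "distinct L"
     "set L = {a \<in> arcs - deleted st res. src a \<in> set (take qh Q)} \<union> set xs"
     "live (deleted st res) (Q ! qh) = xs @ p # ys"
     "tg ` set L \<subseteq> set Q" "\<forall>v \<in> set Q. (root st, v) \<in> reach (set L)" "length Q \<le> 1 + length L"
    using exploredD[OF assms(1)] assms(2) by blast+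
  have "src p \<in> set Q" using c assms(2) by simp
  then have "(root st, src p) \<in> reach (set L)" using E by blast
  then have rp: "(root st, tg p) \<in> reach (set (L @ [p]))"
    using reach_mono[of "set L" "set (L @ [p])"] reach_step[of _ p] by auto
  have r: "\<forall>v \<in> set ?Q. (root st, v) \<in> reach (set (L @ [p]))"
    using E(10) rp reach_mono[of "set L" "set (L @ [p])"] by auto
  have take: "take qh ?Q = take qh Q" "?Q ! qh = Q ! qh" "qh < length ?Q"
    using assms(2) by (auto simp: nth_append)
  have P: "(\<forall>a \<in> set (L @ [p]). a \<in> inc st \<or> tw a \<in> set (L @ [p])) \<and>
        card (set (L @ [p]) \<union> tw ` set (L @ [p]) \<union> inc st) \<le> 2 * k \<and>
        (\<forall>v \<in> set (drop qh ?Q). (root st, v) \<in> reach (inc st))" if res: "res = 0"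
  proof -
    have pi: "p \<in> inc st" using assms(3) res by simp
    have tpi: "tw p \<in> inc st" using valid_symm(1)[OF E(1)] pi symm_tw by auto
    have eq: "set (L @ [p]) \<union> tw ` set (L @ [p]) \<union> inc st = set L \<union> tw ` set L \<union> inc st"
      using pi tpi by auto
    have "Q ! qh \<in> set (drop qh Q)" using assms(2) by (metis Cons_nth_drop_Suc list.set_intros(1))
    then have "(root st, src p) \<in> reach (inc st)" using exploredD(23)[OF assms(1) res] c by simp
    then have "(root st, tg p) \<in> reach (inc st)" using pi reach_step by blast
    then show ?thesis
      using exploredD(21,22,23)[OF assms(1) res] pi assms(2) unfolding eq by auto
  qed
  have Q': "res \<noteq> 0 \<longrightarrow> res \<in> arcs \<and> res \<notin> inc st \<and> res \<notin> exc st \<and> src res \<in> set ?Q \<and>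
        (root st, src res) \<in> reach (inc st) \<and> card (inc st) < 2 * k"
    using exploredD(15-20)[OF assms(1)] by auto
  have L: "set (L @ [p]) = {a \<in> arcs - deleted st res. src a \<in> set (take qh Q)} \<union> set (xs @ [p])"
    using E(7) by auto
  have Q: "distinct ?Q" "set ?Q \<subseteq> {..<n}" "root st \<in> set ?Q" "tg ` set (L @ [p]) \<subseteq> set ?Q"
    "distinct (L @ [p])" "length ?Q \<le> 1 + length (L @ [p])"
    using E(3-6,9,11) c(1,3) tg_lt[of p] by auto
  have live: "live (deleted st res) (?Q ! qh) = (xs @ [p]) @ ys" using E(8) take by simp
  show ?thesis
    by (rule exploredI, unfold take(1);
        (fact E L Q r[rule_format] | rule live | (use Q' in blast) | (use P in blast) | (use take(3) in simp)))
qed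

text \<open>Deleting the edge must not invalidate the arcs scanned so far, so the point is that
  neither of its two arcs is in \<open>L\<close>.\<close>

lemma explored_reserve:
  assumes "explored st 0 Q qh xs (p # ys) L" "qh < length Q" "p \<notin> inc st" "card (inc st) < 2 * k" "0 < n"
  shows "explored st p Q qh xs ys L" "p \<noteq> 0"
proof -
  note c = explored_current[OF assms(1,2)]
  have p0: "p \<noteq> 0" using c arc_ge assms(5) by fastforce
  then show "p \<noteq> 0" .
  have E: "valid st" "good st" "distinct Q" "set Q \<subseteq> {..<n}" "root st \<in> set Q" "distinct L"
     "set L = {a \<in> arcs - exc st. src a \<in> set (take qh Q)} \<union> set xs"
     "live (exc st) (Q ! qh) = xs @ p # ys"
     "tg ` set L \<subseteq> set Q" "\<forall>v \<in> set Q. (root st, v) \<in> reach (set L)" "length Q \<le> 1 + length L"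
     "\<forall>a \<in> set L. a \<in> inc st \<or> tw a \<in> set L" "\<forall>v \<in> set (drop qh Q). (root st, v) \<in> reach (inc st)"
    using exploredD[OF assms(1)] assms(2) unfolding deleted_def by simp_all
  have p: "p \<in> arcs" "p \<notin> exc st" using c by (auto simp: deleted_def)
  have "tw p \<notin> inc st" using valid_symm(1)[OF E(1)] symm_tw_iff p assms(3) by auto
  \<comment> \<open>A scanned twin would be included or have its own twin \<open>p\<close> scanned,
    by the closure property that holds while nothing is reserved.\<close>
  then have tp: "tw p \<notin> set L" using E(12) c(3) p by force
  have del: "deleted st p = exc st \<union> {p, tw p}" using p0 by (simp add: deleted_def)
  have "{a \<in> arcs - (exc st \<union> {p, tw p}). src a \<in> set (take qh Q)} =
        {a \<in> arcs - exc st. src a \<in> set (take qh Q)} - {p, tw p}" by auto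
  also have "\<dots> = {a \<in> arcs - exc st. src a \<in> set (take qh Q)}"
    using E(7) c(3) tp by auto
  finally have L: "set L = {a \<in> arcs - deleted st p. src a \<in> set (take qh Q)} \<union> set xs"
    using E(7) del by simp
  have live: "live (deleted st p) (Q ! qh) = xs @ ys"
    unfolding del by (rule live_split[OF E(8) c(4)])
  have "Q ! qh \<in> set (drop qh Q)" using assms(2) by (metis Cons_nth_drop_Suc list.set_intros(1))
  then have rp: "(root st, src p) \<in> reach (inc st)" using E(13) c by simp
  show "explored st p Q qh xs ys L"
    by (rule exploredI; (fact E L E(10)[rule_format] | rule live p rp assms(3,4) | (use assms(2) in \<open>simp add: p0 c(2)\<close>)))
qed

text \<open>The exhausted search stays valid after the edge is put back. If its far end is in
  \<open>Q\<close>, that vertex is completely scanned and both arcs have to be appended at once.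
  Otherwise the far end is the one new vertex to scan, and the twin will be met in its list.\<close>

lemma explored_force:
  assumes "explored st res Q qh xs ys L" "qh = length Q" "res \<noteq> 0" "length L + 2 \<le> 2 * k"
  defines "st' \<equiv> (res, True) # st"
  shows "valid st'" "good st'" "sols (inc st) (exc st) = sols (inc st') (exc st')"
    "tg res \<in> set Q \<Longrightarrow> explored st' 0 Q qh [] [] (L @ [res, tw res])"
    "tg res \<notin> set Q \<Longrightarrow> explored st' 0 (Q @ [tg res]) qh [] (live (exc st) (tg res)) (L @ [res])"
proof -
  have E: "valid st" "good st" "distinct Q" "set Q \<subseteq> {..<n}" "root st \<in> set Q" "distinct L"
     "set L = {a \<in> arcs - deleted st res. src a \<in> set Q}"
     "tg ` set L \<subseteq> set Q" "\<forall>v \<in> set Q. (root st, v) \<in> reach (set L)" "length Q \<le> 1 + length L"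
     "res \<in> arcs" "res \<notin> inc st" "res \<notin> exc st" "src res \<in> set Q"
     "(root st, src res) \<in> reach (inc st)" "card (inc st) < 2 * k"
    using exploredD[OF assms(1)] assms(2,3) by simp_all
  have del: "deleted st res = exc st \<union> {res, tw res}" using assms(3) by (simp add: deleted_def)
  have comp: "component (arcs - deleted st res) (root st) = set L"
    by (rule explored_exhausted[OF assms(1,2)])
  have symmL: "symm (set L)"
    unfolding comp[symmetric] by (rule symm_component[OF explored_symm(2)[OF assms(1)]])
  have cardL: "card (set L) = length L" using exploredD(7)[OF assms(1)] by simp
  have small: "card (component (arcs - (exc st \<union> {res, tw res})) (root st)) < 2 * k"
    using comp cardL assms(4) del k_pos by simp
  note f = valid_force[OF E(1,2,11,12,13,15) small E(16)]
  show v: "valid st'" and g: "good st'" and "sols (inc st) (exc st) = sols (inc st') (exc st')"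
    using f unfolding st'_def by blast+
  have ne: "included st \<noteq> []" using E(2) by (simp add: good_def)
  have root: "root st' = root st" unfolding st'_def by (rule root_Cons[OF ne])
  have incs: "inc st' = inc st \<union> {res, tw res}" "exc st' = exc st" "deleted st' 0 = exc st"
    by (simp_all add: st'_def deleted_def)
  have resL: "res \<notin> set L" "tw res \<notin> set L" using E(7) del by auto
  have twx: "tw res \<notin> inc st" "tw res \<notin> exc st"
    using valid_symm[OF E(1)] symm_tw_iff E(11,12,13) by auto
  then have "inc st \<subseteq> arcs - deleted st res"
    using del E(12) valid_symm(1)[OF E(1)] symm_sub valid_disjoint[OF E(1)] by auto
  moreover have "rooted (root st) (inc st)" using E(2) by (simp add: good_def)
  \<comment> \<open>The included edges lie in the exhausted component and are counted in
    \<open>L\<close>; only the forced edge adds to the total.\<close>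
  ultimately have incL: "inc st \<subseteq> set L" using rooted_le_component comp by metis
  have card2: "card (set L \<union> {res, tw res}) \<le> 2 * k"
    using card_Un_le[of "set L" "{res, tw res}"] cardL assms(4) card_insert_le_m1[of 2 "{tw res}" res]
    by simp
  have twL: "tw ` set L \<subseteq> set L" using symmL symm_tw by auto
  { assume v: "tg res \<in> set Q"
    have "res \<in> {a \<in> arcs - exc st. src a \<in> set Q}" "tw res \<in> {a \<in> arcs - exc st. src a \<in> set Q}"
      using E(11,13,14) v twx by simp_all
    moreover have "set (L @ [res, tw res]) = {a \<in> arcs - exc st. src a \<in> set Q} - {res, tw res} \<union> {res, tw res}"
      unfolding set_append E(7) del by auto
    ultimately have L: "set (L @ [res, tw res]) = {a \<in> arcs - exc st. src a \<in> set Q}" by blast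
    have "set (L @ [res, tw res]) \<union> tw ` set (L @ [res, tw res]) \<union> inc st' = set L \<union> {res, tw res}"
      using twL incL incs E(11) by auto
    then have c: "card (set (L @ [res, tw res]) \<union> tw ` set (L @ [res, tw res]) \<union> inc st') \<le> 2 * k"
      using card2 by simp
    have r: "\<forall>v \<in> set Q. (root st, v) \<in> reach (set (L @ [res, tw res]))"
      using E(9) reach_mono[of "set L" "set (L @ [res, tw res])"] by auto
    have cl: "\<forall>a \<in> set (L @ [res, tw res]). a \<in> inc st' \<or> tw a \<in> set (L @ [res, tw res])"
      using twL E(11) by auto
    have f: "distinct (L @ [res, tw res])" "tg ` set (L @ [res, tw res]) \<subseteq> set Q"
      "length Q \<le> 1 + length (L @ [res, tw res])" "qh \<le> length Q"
      using E(6,8,10,11,14) v resL tw_ne[OF E(11)] assms(2) by (simp_all add: eq_commute[of res])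
    have L': "set (L @ [res, tw res]) = {a \<in> arcs - exc st. src a \<in> set (take qh Q)} \<union> set []"
      using L assms(2) by simp
    show "explored st' 0 Q qh [] [] (L @ [res, tw res])"
      by (rule exploredI, unfold root incs(3);
          (fact \<open>valid st'\<close> g E f L' r[rule_format] | rule c cl | (use assms(2) in simp))) }
  { assume v: "tg res \<notin> set Q"
    have "res \<in> {a \<in> arcs - exc st. src a \<in> set Q}" "tw res \<notin> {a \<in> arcs - exc st. src a \<in> set Q}"
      using E(11,13,14) v by simp_all
    moreover have "set (L @ [res]) = {a \<in> arcs - exc st. src a \<in> set Q} - {res, tw res} \<union> {res}"
      unfolding set_append E(7) del by auto
    ultimately have L: "set (L @ [res]) = {a \<in> arcs - exc st. src a \<in> set Q}" by blast
    have "set (L @ [res]) \<union> tw ` set (L @ [res]) \<union> inc st' = set L \<union> {res, tw res}"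
      using twL incL incs E(11) by auto
    then have c: "card (set (L @ [res]) \<union> tw ` set (L @ [res]) \<union> inc st') \<le> 2 * k"
      using card2 by simp
    have "(root st, src res) \<in> reach (set (L @ [res]))"
      using E(9,14) reach_mono[of "set L" "set (L @ [res])"] by auto
    then have "(root st, tg res) \<in> reach (set (L @ [res]))" by (rule reach_step) simp
    then have r: "\<forall>v \<in> set (Q @ [tg res]). (root st, v) \<in> reach (set (L @ [res]))"
      using E(9) reach_mono[of "set L" "set (L @ [res])"] by auto
    have "(root st, src res) \<in> reach (inc st')"
      using E(15) reach_mono[of "inc st" "inc st'"] incs(1) by auto
    then have r2: "(root st, tg res) \<in> reach (inc st')" by (rule reach_step) (simp add: incs)
    \<comment> \<open>The twin of \<open>res\<close> is still unscanned, but \<open>res\<close>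
      itself is now included, so the closure property holds.\<close>
    have cl: "\<forall>a \<in> set (L @ [res]). a \<in> inc st' \<or> tw a \<in> set (L @ [res])" using twL incs by auto
    let ?Q = "Q @ [tg res]"
    have f: "distinct (L @ [res])" "tg ` set (L @ [res]) \<subseteq> set ?Q" "distinct ?Q" "set ?Q \<subseteq> {..<n}"
      "length ?Q \<le> 1 + length (L @ [res])" "qh \<le> length ?Q" "root st \<in> set ?Q"
      using E(3-6,8,10,11,14) v resL tg_lt[OF E(11)] assms(2) by auto
    have L': "set (L @ [res]) = {a \<in> arcs - exc st. src a \<in> set (take qh ?Q)} \<union> set []"
      using L assms(2) by simp
    show "explored st' 0 ?Q qh [] (live (exc st) (tg res)) (L @ [res])"
      by (rule exploredI, unfold root incs(3);
          (fact \<open>valid st'\<close> g f L' r[rule_format] | rule c cl | (use assms(2) r2 in simp))) }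
qed

text \<open>The counting invariant allows at most \<open>2 * k\<close> arcs and \<open>good\<close>
  demands at least as many, so the component is the solution.\<close>

lemma explored_leaf:
  assumes "explored st 0 Q qh xs ys L" "qh = length Q"
  shows "sols (inc st) (exc st) = {set L}" "symm (set L)" "length L = 2 * k"
proof -
  have E: "valid st" "good st" "deleted st 0 = exc st" using assms by (auto simp: explored_def deleted_def)
  have comp: "component (arcs - exc st) (root st) = set L"
    using explored_exhausted[OF assms] E by simp
  show "symm (set L)"
    using symm_component[OF explored_symm(2)[OF assms(1)]] E(3) comp by metis
  note l = exploredD(7)[OF assms(1)]
  then show len: "length L = 2 * k"
    using explored_bound[OF assms(1)] E(2) comp by (simp add: good_def)
  have "inc st \<subseteq> arcs - exc st"
    using valid_symm(1)[OF E(1)] symm_sub valid_disjoint[OF E(1)] by auto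
  moreover have "rooted (root st) (inc st)" using E(2) by (simp add: good_def)
  ultimately show "sols (inc st) (exc st) = {set L}"
    using sols_component[OF good_root[OF E(2)] valid_symm(2)[OF E(1)]] comp l len by simp
qed

lemma full_leaf:
  assumes "valid st" "good st" "card (inc st) = 2 * k"
  shows "sols (inc st) (exc st) = {inc st}"
  using assms by (intro sols_full valid_symm valid_disjoint rooted_conn[of _ "root st"])
    (auto simp: good_def)

end

section \<open>The enumeration loop\<close>

text \<open>
  The vertices \<open>0..<n\<close> double as sentinels of their circular adjacency lists, whose cells are the arcs
  \<open>n..<n + 2 * m\<close>. Array \<open>aFl\<close> marks the visited vertices and the included arcs, so that an entry of the
  decision stack \<open>aZ\<close> is known to be excluded by its missing mark. \<open>aS\<close> holds the included arcs, \<open>aT\<close>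
  the arcs scanned by the current search. \<open>rSt\<close> is 0 during a search, 1 after a branching, 2 after
  an output, 3 at the end.
\<close>

abbreviation (input) "rZero \<equiv> 10 :: nat"
abbreviation (input) "rOne \<equiv> 11 :: nat"
abbreviation (input) "rTwo \<equiv> 12 :: nat"
abbreviation (input) "rThree \<equiv> 13 :: nat"
abbreviation (input) "rN \<equiv> 14 :: nat"
abbreviation (input) "rM \<equiv> 15 :: nat"
abbreviation (input) "rK \<equiv> 16 :: nat"
abbreviation (input) "rTop \<equiv> 17 :: nat"
abbreviation (input) "rInc \<equiv> 18 :: nat"
abbreviation (input) "rSt \<equiv> 19 :: nat"
abbreviation (input) "rHd \<equiv> 20 :: nat"
abbreviation (input) "rTl \<equiv> 21 :: nat"
abbreviation (input) "rCnt \<equiv> 22 :: nat"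
abbreviation (input) "rP \<equiv> 23 :: nat"
abbreviation (input) "rRes \<equiv> 24 :: nat"
abbreviation (input) "rB \<equiv> 25 :: nat"
abbreviation (input) "rA \<equiv> 26 :: nat"
abbreviation (input) "rF \<equiv> 27 :: nat"
abbreviation (input) "rV \<equiv> 28 :: nat"
abbreviation (input) "rGo \<equiv> 29 :: nat"

abbreviation (input) "aIn \<equiv> 0 :: nat"
abbreviation (input) "aNx \<equiv> 2 :: nat"
abbreviation (input) "aPv \<equiv> 3 :: nat"
abbreviation (input) "aTg \<equiv> 4 :: nat"
abbreviation (input) "aTw \<equiv> 5 :: nat"
abbreviation (input) "aFl \<equiv> 6 :: nat"
abbreviation (input) "aQ \<equiv> 7 :: nat"
abbreviation (input) "aZ \<equiv> 8 :: nat"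
abbreviation (input) "aS \<equiv> 9 :: nat"
abbreviation (input) "aT \<equiv> 10 :: nat"

definition unlink_code :: "nat \<Rightarrow> com" where
  "unlink_code a = CLoad 41 aNx a ;; CLoad 42 aPv a ;; CStore aNx 42 41 ;; CStore aPv 41 42"

definition relink_code :: "nat \<Rightarrow> com" where
  "relink_code a = CLoad 41 aNx a ;; CLoad 42 aPv a ;; CStore aNx 42 a ;; CStore aPv 41 a"

definition unlink_edge :: "nat \<Rightarrow> com" where
  "unlink_edge a = CLoad 40 aTw a ;; unlink_code a ;; unlink_code 40"

definition relink_edge :: "nat \<Rightarrow> com" where
  "relink_edge a = CLoad 40 aTw a ;; relink_code 40 ;; relink_code a"

definition emit_loop :: "nat \<Rightarrow> nat \<Rightarrow> com" where
  "emit_loop arr len = CConst 40 0 ;; CWhile 40 len (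
     CLoad 41 arr 40 ;; CLoad 42 aTw 41 ;;
     CIf 42 41 CSkip (CLoad 43 aTg 42 ;; COut 43 ;; CLoad 43 aTg 41 ;; COut 43) ;;
     CAdd 40 40 rOne)"

definition enqueue_code :: com where
  "enqueue_code = CStore aFl rV rOne ;; CStore aQ rTl rV ;; CAdd rTl rTl rOne"

definition scan_code :: com where
  "scan_code = CStore aT rCnt rP ;; CAdd rCnt rCnt rOne ;; CLoad rV aTg rP ;; CLoad rF aFl rV ;;
     CIf rF rZero enqueue_code CSkip ;; CLoad rP aNx rP"

definition reserve_code :: com where
  "reserve_code = unlink_edge rP ;; CSub rRes rP rZero ;; CLoad rP aNx rP"

text \<open>The first test asks whether an edge is reserved. The second compares
  \<open>2 * k\<close> with one more than the number of scanned arcs, as in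
  \<open>explored_large\<close>.\<close>

definition check_code :: com where
  "check_code = CIf rOne rRes (CAdd rF rCnt rOne ;;
     CIf rK rF (CConst rSt 1 ;; CStore aZ rTop rRes ;; CAdd rTop rTop rOne) CSkip) CSkip"

text \<open>The mark plus \<open>rRes\<close> is zero exactly if the arc is not included and nothing
  is reserved, so one comparison decides between reserving and scanning.\<close>

definition arc_code :: com where
  "arc_code = CLoad rF aFl rP ;; CAdd rF rF rRes ;; CIf rF rZero reserve_code scan_code ;; check_code"

definition next_code :: com where
  "next_code = CAdd rHd rHd rOne ;; CIf rTl rHd CSkip (CLoad rV aQ rHd ;; CLoad rP aNx rV)"

definition include_code :: com where
  "include_code = CStore aFl rA rOne ;; CStore aFl rB rOne ;; CStore aS rInc rA ;;
     CAdd rInc rInc rOne ;; CStore aS rInc rB ;; CAdd rInc rInc rOne"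

definition force_code :: com where
  "force_code = CSub rA rRes rZero ;; CLoad rB aTw rA ;; relink_edge rA ;; include_code ;;
     CStore aZ rTop rA ;; CAdd rTop rTop rOne ;; CStore aT rCnt rA ;; CAdd rCnt rCnt rOne ;;
     CConst rRes 0 ;; CLoad rV aTg rA ;; CLoad rF aFl rV ;;
     CIf rF rZero (enqueue_code ;; CLoad rP aNx rV) (CStore aT rCnt rB ;; CAdd rCnt rCnt rOne)"

text \<open>A full included set is recognised first, so any edge reserved afterwards still has room.
  The test \<open>rN <= rP\<close> tells an arc from the sentinel that closes a list.\<close>

definition explore_step :: com where
  "explore_step = CIf rK rInc (emit_loop aS rInc ;; CConst rSt 2)
     (CIf rTl rHd (CIf rRes rZero (emit_loop aT rCnt ;; CConst rSt 2) force_code)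
        (CIf rN rP arc_code next_code))"

definition start_code :: com where
  "start_code = CLoad rA aS rZero ;; CLoad rA aTw rA ;; CLoad rV aTg rA ;; CStore aQ rZero rV ;;
     CStore aFl rV rOne ;; CConst rHd 0 ;; CConst rTl 1 ;; CConst rCnt 0 ;; CConst rRes 0 ;;
     CLoad rP aNx rV"

text \<open>Following the queue keeps the cost proportional to the vertices visited, at most
  \<open>2 * k + 1\<close> of them, instead of \<open>n\<close>.\<close>

definition clear_code :: com where
  "clear_code = CConst 40 0 ;; CWhile 40 rTl (CLoad 41 aQ 40 ;; CStore aFl 41 rZero ;; CAdd 40 40 rOne)"

definition explore_code :: com where
  "explore_code = start_code ;; CWhile rSt rOne explore_step ;; clear_code"

text \<open>An excluded entry is turned into an included one in place: the stack array keeps the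
  entry and the new mark changes its meaning. Included entries have both branches behind them, or
  never had a second one, and are popped.\<close>

definition backtrack_step :: com where
  "backtrack_step = CIf rTop rZero (CConst rGo 0 ;; CConst rSt 3)
     (CSub rA rTop rOne ;; CLoad rA aZ rA ;; CLoad rF aFl rA ;; CLoad rB aTw rA ;;
      CIf rF rZero (relink_edge rA ;; include_code ;; CConst rGo 0 ;; CConst rSt 0)
        (CStore aFl rA rZero ;; CStore aFl rB rZero ;; CSub rTop rTop rOne ;;
         CSub rInc rInc rTwo))"

definition backtrack_code :: com where
  "backtrack_code = CConst rGo 1 ;; CWhile rZero rGo backtrack_step"

text \<open>Starting in state 2 makes the first iteration backtrack: the initial stack consists of
  exclusions only and is not itself a subproblem to search.\<close>

definition main_loop :: com where
  "main_loop = CConst rSt 2 ;; CWhile rSt rThree (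
     CIf rTwo rSt backtrack_code (CConst rSt 0) ;; CIf rThree rSt CSkip explore_code)"

section \<open>Array contents, link operations and output on the machine\<close>

definition holds :: "(nat \<Rightarrow> nat) \<Rightarrow> nat list \<Rightarrow> bool" where
  "holds f xs \<longleftrightarrow> (\<forall>i < length xs. f i = xs ! i)"

lemma holds_Nil [simp]: "holds f []"
  by (simp add: holds_def)

lemma holds_snoc [simp]: "holds f xs \<Longrightarrow> holds (f(length xs := x)) (xs @ [x])"
  by (auto simp: holds_def nth_append)

lemma holds_append: "holds f (xs @ ys) \<Longrightarrow> holds f xs"
  unfolding holds_def by (metis length_append nth_append trans_less_add1)

lemma holds_nth: "holds f xs \<Longrightarrow> i < length xs \<Longrightarrow> f i = xs ! i"
  by (simp add: holds_def)

locale machine_graph = linked_graph +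
  fixes M W :: nat
  assumes M_def: "M = n + 2 * m + 4" and W_large: "11 * M \<le> W" and k_le_m: "k \<le> m" and n_pos: "0 < n"
begin

lemma lt_M: "x \<le> n + 2 * m \<Longrightarrow> x < M" "x < n \<Longrightarrow> x < M" "a \<in> arcs \<Longrightarrow> a < M" "x \<le> 2 * k + 3 \<Longrightarrow> x < M"
  "x \<le> m + 3 \<Longrightarrow> x < M" "x \<le> 2 * k + 3 \<Longrightarrow> x < W" "x \<le> n + 2 * m + 3 \<Longrightarrow> x < W"
  using M_def arc_less[of x] arc_less[of a] k_le_m W_large by (auto simp: arcs_def)

lemma wp_unlink_edge:
  assumes "R a = x" "a < 40" "A aNx = fst (lk D)" "A aPv = snd (lk D)" "A aTw = tw" "deletable (x # D)"
    and Q: "\<And>R'. (\<And>r. r < 40 \<Longrightarrow> R' r = R r) \<Longrightarrow>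
      Q (R', A(aNx := fst (lk (x # D)), aPv := snd (lk (x # D))), Y, 27 + T)"
  shows "wp M W (unlink_edge a) Q (R, A, Y, T)"
proof -
  have x: "x \<in> arcs" "tw x \<in> arcs" "x < n + 2 * m" "tw x < n + 2 * m" "deletable D"
    using assms(6) arc_less by auto
  have b: "fst (lk D) y < n + 2 * m" "snd (lk D) y < n + 2 * m" if "y < n + 2 * m" for y
    using lk_bound[OF x(5) that] by auto
  have b': "fst (unlink x (lk D)) y < n + 2 * m" "snd (unlink x (lk D)) y < n + 2 * m" if "y < n + 2 * m" for y
    using unlink_bound[of "n + 2 * m" "lk D" x y] b that x by auto
  have M: "y < n + 2 * m \<Longrightarrow> y < M" for y using M_def by simp
  have l: "lk (x # D) = unlink (tw x) (unlink x (lk D))" by simp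
  have q: "Q (R(40 := tw x, 41 := fst (unlink x (lk D)) (tw x), 42 := snd (unlink x (lk D)) (tw x)),
      A(aNx := fst (lk (x # D)), aPv := snd (lk (x # D))), Y, 27 + T)"
    by (rule Q) auto
  show ?thesis
    unfolding unlink_edge_def unlink_code_def
    using assms(1-5) x b[OF x(3)] b'[OF x(4)] q
    by (auto simp: unlink_def[of x] unlink_def[of "tw x"] M fun_upd_twist)
qed

lemma relink_bound:
  assumes "\<And>x. x < N \<Longrightarrow> fst f x < N \<and> snd f x < N" "a < N" "x < N"
  shows "fst (relink a f) x < N" "snd (relink a f) x < N"
  using assms by (auto simp: relink_def)

lemma wp_relink_edge:
  assumes "R a = x" "a < 40" "A aNx = fst (lk (x # D))" "A aPv = snd (lk (x # D))" "A aTw = tw"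
    "deletable (x # D)"
    and Q: "\<And>R'. (\<And>r. r < 40 \<Longrightarrow> R' r = R r) \<Longrightarrow>
      Q (R', A(aNx := fst (lk D), aPv := snd (lk D)), Y, 27 + T)"
  shows "wp M W (relink_edge a) Q (R, A, Y, T)"
proof -
  have x: "x \<in> arcs" "tw x \<in> arcs" "x < n + 2 * m" "tw x < n + 2 * m" "deletable D"
    using assms(6) arc_less by auto
  define f where "f = lk (x # D)"
  have b: "fst f y < n + 2 * m" "snd f y < n + 2 * m" if "y < n + 2 * m" for y
    using lk_bound[OF assms(6) that] unfolding f_def by auto
  have b': "fst (relink (tw x) f) y < n + 2 * m" "snd (relink (tw x) f) y < n + 2 * m" if "y < n + 2 * m" for y
    using relink_bound[of "n + 2 * m" f "tw x" y] b that x by auto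
  have M: "y < n + 2 * m \<Longrightarrow> y < M" for y using M_def by simp
  have l: "lk D = relink x (relink (tw x) f)" unfolding f_def by (rule relink_lk[OF assms(6), symmetric])
  have q: "Q (R(40 := tw x, 41 := fst (relink (tw x) f) x, 42 := snd (relink (tw x) f) x),
      A(aNx := fst (lk D), aPv := snd (lk D)), Y, 27 + T)"
    by (rule Q) auto
  show ?thesis
    unfolding relink_edge_def relink_code_def
    using assms(1-2,5) assms(3,4)[folded f_def] x b[OF x(4)] b'[OF x(3)] q[unfolded l]
    by (auto simp: relink_def[of x] relink_def[of "tw x"] M fun_upd_twist)
qed

text \<open>Of two opposite arcs the one with the smaller number is written, so each edge appears
  once.\<close>

definition emit :: "nat list \<Rightarrow> nat list" where
  "emit L = concat (map (\<lambda>a. [src a, tg a]) (filter (\<lambda>a. a < tw a) L))"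

definition const_regs :: "(nat \<Rightarrow> nat) \<Rightarrow> bool" where
  "const_regs R \<longleftrightarrow> R rZero = 0 \<and> R rOne = 1 \<and> R rTwo = 2 \<and> R rThree = 3 \<and> R rN = n \<and> R rM = m \<and> R rK = 2 * k"

lemma wp_emit_loop:
  assumes "R len = length L" "len < 40" "R rOne = 1" "holds (A arr) L" "set L \<subseteq> arcs" "length L \<le> 2 * k"
    "A aTw = tw" "A aTg = tg"
    and Q: "\<And>R' T'. (\<And>r. r < 40 \<Longrightarrow> R' r = R r) \<Longrightarrow> T' \<le> T + 27 * length L + 6 \<Longrightarrow>
      Q (R', A, Y @ emit L, T')"
  shows "wp M W (emit_loop arr len) Q (R, A, Y, T)"
proof -
  define I where "I = (\<lambda>i (R', A', Y', T'). (\<forall>r < 40. R' r = R r) \<and> R' 40 = i \<and> i \<le> length L \<and>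
    A' = A \<and> Y' = Y @ emit (take i L) \<and> T' \<le> T + 3 + 27 * i)"
  have "wp M W (CWhile 40 len (
     CLoad 41 arr 40 ;; CLoad 42 aTw 41 ;;
     CIf 42 41 CSkip (CLoad 43 aTg 42 ;; COut 43 ;; CLoad 43 aTg 41 ;; COut 43) ;;
     CAdd 40 40 rOne)) Q (R(40 := 0), A, Y, 3 + T)"
  proof (rule wp_While[where I = I and B = "length L"])
    show "I 0 (R(40 := 0), A, Y, 3 + T)" by (simp add: I_def emit_def)
  next
    fix i R' A' Y' T' assume I: "I i (R', A', Y', T')" and lt: "R' 40 < R' len"
    have r: "R' rOne = 1" "R' len = length L" "R' 40 = i" "A' = A"
      using I assms by (auto simp: I_def)
    then have i: "i < length L" using lt by simp
    have a: "L ! i \<in> arcs" using assms(5) i by auto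
    have Ai: "A arr i = L ! i" using assms(4) i by (rule holds_nth)
    have t: "take (Suc i) L = take i L @ [L ! i]" using i by (simp add: take_Suc_conv_app_nth)
    have b: "i < M" "L ! i < M" "tw (L ! i) < M" "i + 1 < W"
      using i assms(6) lt_M(3)[OF a] lt_M(3)[OF tw_in[OF a]] lt_M(4)[of i] lt_M(6)[of "i + 1"] by auto
    show "wp M W (CLoad 41 arr 40 ;; CLoad 42 aTw 41 ;;
     CIf 42 41 CSkip (CLoad 43 aTg 42 ;; COut 43 ;; CLoad 43 aTg 41 ;; COut 43) ;;
     CAdd 40 40 rOne) (I (Suc i)) (R', A', Y', 3 + T')"
    proof (cases "tw (L ! i) \<le> L ! i")
      case True
      then show ?thesis
        using I r i b Ai t assms(2,7,8) tw_ne[OF a] by (auto simp: I_def emit_def)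
    next
      case False
      then show ?thesis
        using I r i b Ai t assms(2,7,8) by (auto simp: I_def emit_def)
    qed
  next
    fix i R' A' Y' T' assume I: "I i (R', A', Y', T')" and lt: "R' 40 < R' len"
    then show "i < length L" using assms(1,2) by (auto simp: I_def)
  next
    fix i R' A' Y' T' assume I: "I i (R', A', Y', T')" and lt: "\<not> R' 40 < R' len"
    then have "i = length L" using assms(1,2) by (auto simp: I_def)
    then have "Q (R', A, Y @ emit L, 3 + T')" using I by (intro Q) (auto simp: I_def)
    then show "Q (R', A', Y', 3 + T')" using I \<open>i = length L\<close> by (auto simp: I_def)
  qed
  then show ?thesis by (simp add: emit_loop_def)
qed

definition inc_list :: "(nat \<times> bool) list \<Rightarrow> nat list" where
  "inc_list st = concat (map (\<lambda>a. [a, tw a]) (rev (included st)))"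

lemma inc_list_True: "inc_list ((a, True) # st) = inc_list st @ [a, tw a]"
  and inc_list_False: "inc_list ((a, False) # st) = inc_list st"
  by (simp_all add: inc_list_def)

lemma set_inc_list: "set (inc_list st) = inc st"
  by (auto simp: inc_list_def both_def)

lemma length_inc_list: "length (inc_list st) = 2 * length (included st)"
proof -
  have "length (concat (map (\<lambda>a. [a, tw a]) l)) = 2 * length l" for l :: "nat list"
    by (induction l) auto
  then show ?thesis by (simp add: inc_list_def)
qed

lemma distinct_inc_list: "valid st \<Longrightarrow> distinct (inc_list st)"
  using valid_card(1)[of st] length_inc_list[of st] set_inc_list[of st] by (metis card_distinct)

definition stack_rep :: "(nat \<times> bool) list \<Rightarrow> (nat \<Rightarrow> nat) \<Rightarrow> (nat \<Rightarrow> nat \<Rightarrow> nat) \<Rightarrow> bool" where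
  "stack_rep st R A \<longleftrightarrow> const_regs R \<and> R rTop = length st \<and> holds (A aZ) (rev (map fst st)) \<and>
     R rInc = length (inc_list st) \<and> holds (A aS) (inc_list st) \<and> A aTg = tg \<and> A aTw = tw \<and>
     (\<forall>a \<in> arcs. A aFl a = (if a \<in> inc st then 1 else 0))"

definition queue_rep :: "nat list \<Rightarrow> (nat \<Rightarrow> nat) \<Rightarrow> (nat \<Rightarrow> nat \<Rightarrow> nat) \<Rightarrow> bool" where
  "queue_rep Q R A \<longleftrightarrow> (\<forall>v < n. A aFl v = (if v \<in> set Q then 1 else 0)) \<and> holds (A aQ) Q \<and>
     R rTl = length Q"

definition link_rep :: "nat list \<Rightarrow> (nat \<Rightarrow> nat \<Rightarrow> nat) \<Rightarrow> bool" where
  "link_rep D A \<longleftrightarrow> A aNx = fst (lk D) \<and> A aPv = snd (lk D)"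

definition dels :: "(nat \<times> bool) list \<Rightarrow> nat \<Rightarrow> nat list" where
  "dels st res = (if res = 0 then excluded st else res # excluded st)"

definition search_rep ::
  "(nat \<times> bool) list \<Rightarrow> nat \<Rightarrow> nat list \<Rightarrow> nat \<Rightarrow> nat list \<Rightarrow> nat list \<Rightarrow> (nat \<Rightarrow> nat) \<Rightarrow> (nat \<Rightarrow> nat \<Rightarrow> nat) \<Rightarrow> bool" where
  "search_rep st res Q qh ys L R A \<longleftrightarrow> stack_rep st R A \<and> queue_rep Q R A \<and> link_rep (dels st res) A \<and>
     R rHd = qh \<and> holds (A aT) L \<and> R rCnt = length L \<and> R rRes = res \<and> R rSt = 0 \<and>
     (qh < length Q \<longrightarrow> R rP = hd (ys @ [Q ! qh]))"

lemma both_dels: "both (dels st res) = deleted st res"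
  by (simp add: dels_def deleted_def)

lemma explored_deletable:
  assumes "explored st res Q qh xs ys L"
  shows "deletable (dels st res)"
  using exploredD(1,15,17)[OF assms] valid_deletable by (auto simp: dels_def)

lemma explored_length_Q:
  assumes "explored st res Q qh xs ys L" shows "length Q \<le> n"
  using exploredD(3,4)[OF assms] card_mono[of "{..<n}" "set Q"] by (simp add: distinct_card)

lemma explored_lengths:
  assumes "explored st res Q qh xs ys L"
  shows "length st \<le> m" "length (inc_list st) \<le> 2 * k" "set L \<subseteq> arcs"
  using valid_length[OF exploredD(1)[OF assms]] valid_card(1)[OF exploredD(1)[OF assms]]
    exploredD(2)[OF assms] explored_arcs(1)[OF assms] by (auto simp: good_def length_inc_list)

section \<open>The individual moves of a search\<close>

lemma wp_next_code:
  assumes E: "explored st res Q qh xs [] L" and qh: "qh < length Q"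
    and rep: "search_rep st res Q qh [] L R A"
    and Q: "\<And>R' T'. search_rep st res Q (Suc qh) (live (deleted st res) (Q ! Suc qh)) L R' A \<Longrightarrow>
      T' \<le> T + 12 \<Longrightarrow> Qp (R', A, Y, T')"
  shows "wp M W next_code Qp (R, A, Y, T)"
proof -
  have l: "length Q \<le> n" by (rule explored_length_Q[OF E])
  have r: "R rHd = qh" "R rOne = 1" "R rTl = length Q" "holds (A aQ) Q" "A aNx = fst (lk (dels st res))"
    using rep by (auto simp: search_rep_def stack_rep_def const_regs_def queue_rep_def link_rep_def)
  have W: "qh + 1 < W" "qh + 1 < M" using qh l M_def W_large by auto
  show ?thesis
  proof (cases "length Q \<le> Suc qh")
    case True
    have "Qp (R(rHd := Suc qh), A, Y, 6 + T)"
      by (rule Q) (use rep True in \<open>auto simp: search_rep_def stack_rep_def const_regs_def queue_rep_def\<close>)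
    then show ?thesis using r W True by (simp add: next_code_def)
  next
    case False
    then have v: "Q ! Suc qh < n" "A aQ (Suc qh) = Q ! Suc qh"
      using explored_nth_less[OF E] holds_nth[OF r(4)] by auto
    have f: "fst (lk (dels st res)) (Q ! Suc qh) = hd (live (deleted st res) (Q ! Suc qh) @ [Q ! Suc qh])"
      using lk_first[OF explored_deletable[OF E] v(1)] by (simp add: both_dels)
    have "Qp (R(rHd := Suc qh, rV := Q ! Suc qh, rP := fst (lk (dels st res)) (Q ! Suc qh)), A, Y, 12 + T)"
      by (rule Q) (use rep f in \<open>auto simp: search_rep_def stack_rep_def const_regs_def queue_rep_def\<close>)
    then show ?thesis using r W False v lt_M(2)[OF v(1)] by (simp add: next_code_def)
  qed
qed

lemma wp_scan_code:
  assumes E: "explored st res Q qh xs (p # ys) L" and qh: "qh < length Q"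
    and rep: "search_rep st res Q qh (p # ys) L R A" and l: "length L \<le> 2 * k"
    and Q: "\<And>R' A' T'. search_rep st res (if tg p \<in> set Q then Q else Q @ [tg p]) qh ys (L @ [p]) R' A' \<Longrightarrow>
      T' \<le> T + 27 \<Longrightarrow> Qp (R', A', Y, T')"
    and E': "explored st res (if tg p \<in> set Q then Q else Q @ [tg p]) qh (xs @ [p]) ys (L @ [p])"
  shows "wp M W scan_code Qp (R, A, Y, T)"
proof -
  note c = explored_current[OF E qh]
  have p: "p \<in> arcs" "tg p < n" "p < M" "tg p < M" using c(1) lt_M(3)[of p] lt_M(2)[of "tg p"] by auto
  have lq: "length Q < M" "length Q + 1 < W" using explored_length_Q[OF E] M_def W_large by auto
  have r: "R rHd = qh" "R rOne = 1" "R rTl = length Q" "holds (A aQ) Q" "A aNx = fst (lk (dels st res))"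
    "R rP = p" "R rCnt = length L" "A aTg = tg" "A aFl (tg p) = (if tg p \<in> set Q then 1 else 0)"
    "R rZero = 0"
    using rep qh p by (auto simp: search_rep_def stack_rep_def const_regs_def queue_rep_def link_rep_def)
  have W: "length L < M" "length L + 1 < W" using l M_def W_large k_le_m by auto
  have "live (both (dels st res)) (Q ! qh) = xs @ p # ys"
    using exploredD(10)[OF E qh] by (simp add: both_dels)
  then have nx: "fst (lk (dels st res)) p = hd (ys @ [Q ! qh])"
    by (rule lk_next[OF explored_deletable[OF E] c(4)])
  show ?thesis
  proof (cases "tg p \<in> set Q")
    case True
    have "Qp (R(rCnt := Suc (length L), rV := tg p, rF := 1, rP := hd (ys @ [Q ! qh])),
        A(aT := (A aT)(length L := p)), Y, 18 + T)"
      by (rule Q) (use rep True in \<open>auto simp: search_rep_def stack_rep_def const_regs_def queue_rep_def link_rep_def\<close>)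
    then show ?thesis using r W True p nx by (simp add: scan_code_def)
  next
    case False
    have a: "tg p \<noteq> a" if "a \<in> arcs" for a using that arc_ge p(2) by fastforce
    have "Qp (R(rCnt := Suc (length L), rV := tg p, rF := 0, rTl := Suc (length Q), rP := hd (ys @ [Q ! qh])),
        A(aT := (A aT)(length L := p), aFl := (A aFl)(tg p := 1), aQ := (A aQ)(length Q := tg p)), Y, 27 + T)"
      by (rule Q) (use rep False a p(2) qh in \<open>auto simp: search_rep_def stack_rep_def const_regs_def queue_rep_def link_rep_def nth_append\<close>)
    then show ?thesis using r W False p nx lq by (simp add: scan_code_def enqueue_code_def)
  qed
qed

lemmas rep_defs = search_rep_def stack_rep_def const_regs_def queue_rep_def link_rep_def

lemma wp_reserve_code:
  assumes E: "explored st 0 Q qh xs (p # ys) L" and qh: "qh < length Q"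
    and rep: "search_rep st 0 Q qh (p # ys) L R A" and E': "explored st p Q qh xs ys L" and p0: "p \<noteq> 0"
    and Q: "\<And>R' A' T'. search_rep st p Q qh ys L R' A' \<Longrightarrow> T' \<le> T + 33 \<Longrightarrow> Qp (R', A', Y, T')"
  shows "wp M W reserve_code Qp (R, A, Y, T)"
proof -
  note c = explored_current[OF E qh]
  have p: "p \<in> arcs" "p < M" using c(1) lt_M(3)[of p] by auto
  have del: "deletable (p # excluded st)"
    using explored_deletable[OF E'] p0 by (simp add: dels_def)
  have r: "R rP = p" "A aNx = fst (lk (excluded st))" "A aPv = snd (lk (excluded st))" "A aTw = tw" "R rZero = 0"
    using rep qh by (auto simp: rep_defs dels_def)
  have "live (both (excluded st)) (Q ! qh) = xs @ p # ys"
    using exploredD(10)[OF E qh] by (simp add: deleted_def)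
  then have nx: "fst (lk (p # excluded st)) p = hd (ys @ [Q ! qh])"
    by (rule lk_next_deleted[OF del c(4)])
  show ?thesis
    unfolding reserve_code_def wp_Seq
  proof (rule wp_unlink_edge[where D = "excluded st" and x = p])
    fix R' assume R': "\<And>r. r < 40 \<Longrightarrow> R' r = R r"
    let ?A = "A(aNx := fst (lk (p # excluded st)), aPv := snd (lk (p # excluded st)))"
    have "Qp (R'(rRes := p, rP := hd (ys @ [Q ! qh])), ?A, Y, 33 + T)"
      by (rule Q) (use rep R' p0 in \<open>auto simp: rep_defs dels_def\<close>)
    then show "wp M W (CSub rRes rP rZero) (wp M W (CLoad rP aNx rP) Qp) (R', ?A, Y, 27 + T)"
      using R' r p nx by simp
  qed (use r del in auto)
qed

text \<open>A branching needs no list operation: the reserved edge is unlinked already, and pushing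
  it turns the reservation into an exclusion.\<close>

lemma wp_check_code:
  assumes E: "explored st res Q qh xs ys L" and rep: "search_rep st res Q qh ys L R A"
    and l: "length L \<le> 2 * k"
    and Q1: "\<And>R' A' T'. res \<noteq> 0 \<Longrightarrow> 2 * k \<le> length L + 1 \<Longrightarrow> stack_rep ((res, False) # st) R' A' \<Longrightarrow>
      queue_rep Q R' A' \<Longrightarrow> link_rep (res # excluded st) A' \<Longrightarrow> R' rSt = 1 \<Longrightarrow> T' \<le> T + 18 \<Longrightarrow> Qp (R', A', Y, T')"
    and Q2: "\<And>R' T'. (res \<noteq> 0 \<Longrightarrow> length L + 2 \<le> 2 * k) \<Longrightarrow> search_rep st res Q qh ys L R' A \<Longrightarrow>
      T' \<le> T + 9 \<Longrightarrow> Qp (R', A, Y, T')"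
  shows "wp M W check_code Qp (R, A, Y, T)"
proof -
  have r: "R rRes = res" "R rOne = 1" "R rK = 2 * k" "R rCnt = length L" "R rTop = length st"
    using rep by (auto simp: rep_defs)
  have W: "length L + 1 < W" "length st < M" "length st + 1 < W"
    using l explored_lengths(1)[OF E] M_def W_large k_le_m by auto
  show ?thesis
  proof (cases "res \<noteq> 0 \<and> 2 * k \<le> length L + 1")
    case True
    have "Qp (R(rF := Suc (length L), rSt := 1, rTop := Suc (length st)), A(aZ := (A aZ)(length st := res)), Y, 18 + T)"
      by (rule Q1) (use True rep holds_snoc[of "A aZ" "rev (map fst st)" res] in
        \<open>auto simp: rep_defs dels_def inc_list_False\<close>)
    then show ?thesis using r W True by (simp add: check_code_def)
  next
    case False
    show ?thesis
    proof (cases "res = 0")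
      case True
      have "Qp (R, A, Y, 3 + T)" by (rule Q2) (use True rep in auto)
      then show ?thesis using r True by (simp add: check_code_def)
    next
      case False': False
      have "Qp (R(rF := Suc (length L)), A, Y, 9 + T)"
        by (rule Q2) (use False rep in \<open>auto simp: rep_defs\<close>)
      then show ?thesis using r W False False' by (simp add: check_code_def)
    qed
  qed
qed

lemma holds_snoc2: "holds f xs \<Longrightarrow> holds (f(length xs := x, Suc (length xs) := y)) (xs @ [x, y])"
  using holds_snoc[of "f(length xs := x)" "xs @ [x]" y] by simp

lemma wp_force_code:
  assumes E: "explored st res Q qh xs ys L" and qh: "qh = length Q" and res: "res \<noteq> 0"
    and l: "length L + 2 \<le> 2 * k" and rep: "search_rep st res Q qh ys L R A"
    and Q1: "\<And>R' A' T'. tg res \<in> set Q \<Longrightarrow> search_rep ((res, True) # st) 0 Q qh [] (L @ [res, tw res]) R' A' \<Longrightarrow>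
      T' \<le> T + 90 \<Longrightarrow> Qp (R', A', Y, T')"
    and Q2: "\<And>R' A' T'. tg res \<notin> set Q \<Longrightarrow>
      search_rep ((res, True) # st) 0 (Q @ [tg res]) qh (live (exc st) (tg res)) (L @ [res]) R' A' \<Longrightarrow>
      T' \<le> T + 90 \<Longrightarrow> Qp (R', A', Y, T')"
  shows "wp M W force_code Qp (R, A, Y, T)"
proof -
  have x: "res \<in> arcs" "tw res \<in> arcs" "tg res < n" "res < M" "tw res < M" "tg res < M"
    using exploredD(15)[OF E res] lt_M(3)[of res] lt_M(3)[of "tw res"] lt_M(2)[of "tg res"] by auto
  have del: "deletable (res # excluded st)"
    using explored_deletable[OF E] res by (simp add: dels_def)
  then have del': "deletable (excluded st)" by simp
  have r: "R rRes = res" "R rZero = 0" "R rOne = 1" "R rInc = length (inc_list st)" "R rTop = length st"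
    "R rCnt = length L" "R rTl = length Q" "A aTw = tw" "A aTg = tg"
    "A aNx = fst (lk (res # excluded st))" "A aPv = snd (lk (res # excluded st))"
    "holds (A aS) (inc_list st)" "holds (A aZ) (rev (map fst st))" "holds (A aT) L" "holds (A aQ) Q"
    using rep res by (auto simp: rep_defs dels_def)
  have lens: "length (inc_list st) + 2 \<le> 2 * k"
    using valid_card(1)[OF exploredD(1)[OF E]] exploredD(20)[OF E res] length_inc_list[of st] by simp
  have W: "length (inc_list st) < M" "Suc (length (inc_list st)) < M" "Suc (length (inc_list st)) < W"
    "Suc (Suc (length (inc_list st))) < W" "length st < M" "Suc (length st) < W" "length L < M"
    "Suc (length L) < M" "Suc (length L) < W" "Suc (Suc (length L)) < W" "length Q < M" "Suc (length Q) < W"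
    using l lens explored_lengths(1)[OF E] explored_length_Q[OF E] M_def W_large k_le_m by auto
  \<comment> \<open>Vertices and arcs share the array of marks; this keeps the mark of a new vertex
    from touching marks of arcs.\<close>
  have small: "v \<noteq> a" if "v < n" "a \<in> arcs" for v a using that arc_ge[of a] by auto
  have tgn: "tg res \<notin> arcs" using small[OF x(3)] by blast
  have ne: "tg res \<noteq> res" "tg res \<noteq> tw res" "tw res \<noteq> res"
    using small[OF x(3,1)] small[OF x(3,2)] tw_ne[OF x(1)] by auto
  have vfl: "A aFl v = (if v \<in> set Q then 1 else 0)" if "v < n" for v
    using rep that by (auto simp: rep_defs)
  have f: "fst (lk (excluded st)) (tg res) = hd (live (exc st) (tg res) @ [tg res])"
    by (rule lk_first[OF del' x(3)])
  show ?thesis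
    unfolding force_code_def
  proof (simp add: r x, rule wp_relink_edge[where D = "excluded st" and x = res])
    fix R' assume "\<And>r. r < 40 \<Longrightarrow> R' r = (R(rA := res, rB := tw res)) r"
    then have R': "\<And>r. r < 40 \<Longrightarrow> R' r = (if r = rA then res else if r = rB then tw res else R r)"
      by auto
    show "wp M W (include_code ;; CStore aZ rTop rA ;; CAdd rTop rTop rOne ;; CStore aT rCnt rA ;;
       CAdd rCnt rCnt rOne ;; CConst rRes 0 ;; CLoad rV aTg rA ;; CLoad rF aFl rV ;;
       CIf rF rZero (enqueue_code ;; CLoad rP aNx rV) (CStore aT rCnt rB ;; CAdd rCnt rCnt rOne)) Qp
       (R', A(aNx := fst (lk (excluded st)), aPv := snd (lk (excluded st))), Y, 27 + (6 + T))"
    proof (cases "tg res \<in> set Q")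
      case True
      show ?thesis
        unfolding include_code_def
        apply (simp add: True W R' x r ne vfl)
        apply (rule Q1[OF True])
        using rep R' x small qh True holds_snoc[OF r(13), of res] holds_snoc2[OF r(12), of res "tw res"]
          holds_snoc2[OF r(14), of res "tw res"]
         apply (auto simp: rep_defs inc_list_True dels_def)
        done
    next
      case False
      show ?thesis
        unfolding include_code_def enqueue_code_def
        apply (simp add: False W R' x r ne vfl)
        apply (rule Q2[OF False])
        using rep R' x small qh False holds_snoc[OF r(13), of res] holds_snoc2[OF r(12), of res "tw res"]
          holds_snoc[OF r(14), of res] holds_snoc[OF r(15), of "tg res"] f tgn
         apply (auto simp: rep_defs inc_list_True dels_def nth_append)
        done
    qed
  qed (use r del in auto)
qed

section \<open>The search loop and its potential\<close>

definition same_problem :: "(nat \<times> bool) list \<Rightarrow> (nat \<times> bool) list \<Rightarrow> bool" where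
  "same_problem st0 st \<longleftrightarrow> excluded st = excluded st0 \<and> pending st = pending st0 \<and>
     sols (inc st) (exc st) = sols (inc st0) (exc st0)"

text \<open>The sum bounding \<open>i\<close> is the potential of a search. A scanned arc, a
  finished vertex and a reservation each raise it by one. Forcing gives up the reservation but gains
  an included edge and at least one arc.\<close>

definition running :: "(nat \<times> bool) list \<Rightarrow> nat \<Rightarrow> (nat \<Rightarrow> nat) \<Rightarrow> (nat \<Rightarrow> nat \<Rightarrow> nat) \<Rightarrow> bool" where
  "running st0 i R A \<longleftrightarrow> (\<exists>st res Q qh xs ys L. explored st res Q qh xs ys L \<and>
     search_rep st res Q qh ys L R A \<and> (res \<noteq> 0 \<longrightarrow> length L + 2 \<le> 2 * k) \<and> same_problem st0 st \<and>
     i \<le> length L + qh + 2 * length (included st) + (if res = 0 then 0 else 1))"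

definition stopped :: "(nat \<times> bool) list \<Rightarrow> nat list \<Rightarrow> (nat \<times> bool) list \<Rightarrow> (nat \<Rightarrow> nat) \<Rightarrow> nat list \<Rightarrow> bool" where
  "stopped st0 Y0 st R Y \<longleftrightarrow> valid st \<and> good st \<and>
     (R rSt = 1 \<and> Y = Y0 \<and> length (excluded st) = Suc (length (excluded st0)) \<and>
        sols (inc st0) (exc st0) \<union> pending st0 = sols (inc st) (exc st) \<union> pending st \<or>
      R rSt = 2 \<and> same_problem st0 st \<and>
        (\<exists>L. Y = Y0 @ emit L \<and> distinct L \<and> symm (set L) \<and> sols (inc st0) (exc st0) = {set L}))"

definition stop_rep :: "(nat \<times> bool) list \<Rightarrow> (nat \<Rightarrow> nat) \<Rightarrow> (nat \<Rightarrow> nat \<Rightarrow> nat) \<Rightarrow> bool" where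
  "stop_rep st R A \<longleftrightarrow> stack_rep st R A \<and> link_rep (excluded st) A \<and>
     (\<exists>Q. queue_rep Q R A \<and> set Q \<subseteq> {..<n} \<and> length Q \<le> n \<and> length Q \<le> 2 * k + 1)"

text \<open>The second disjunct is the state after the last iteration; its extra
  \<open>60 * k\<close> pays for an output, which costs at most
  \<open>27 * (2 * k) + 6\<close>.\<close>

definition explore_inv :: "(nat \<times> bool) list \<Rightarrow> nat list \<Rightarrow> nat \<Rightarrow> nat \<Rightarrow> state \<Rightarrow> bool" where
  "explore_inv st0 Y0 T0 i = (\<lambda>(R, A, Y, T).
     R rSt = 0 \<and> R rOne = 1 \<and> running st0 i R A \<and> Y = Y0 \<and> T \<le> T0 + 150 * i \<or>
     R rOne = 1 \<and> (\<exists>st. stopped st0 Y0 st R Y \<and> stop_rep st R A) \<and> T \<le> T0 + 150 * i + 60 * k \<and> i \<le> 6 * k + 3)"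

lemma explored_length_L:
  assumes "explored st res Q qh xs ys L" "res \<noteq> 0 \<longrightarrow> length L + 2 \<le> 2 * k"
  shows "length L \<le> 2 * k"
  using explored_bound assms by (cases "res = 0") auto

text \<open>The queue is at most one longer than the list of scanned arcs, so the potential is at
  most \<open>2 * k + (2 * k + 1) + 2 * k + 1\<close>.\<close>

lemma running_bound: "running st0 i R A \<Longrightarrow> i < 6 * k + 3"
proof -
  assume "running st0 i R A"
  then obtain st res Q qh xs ys L where E: "explored st res Q qh xs ys L" "res \<noteq> 0 \<longrightarrow> length L + 2 \<le> 2 * k"
    and i: "i \<le> length L + qh + 2 * length (included st) + (if res = 0 then 0 else 1)"
    unfolding running_def by blast
  have "length L \<le> 2 * k" by (rule explored_length_L[OF E])
  moreover have "qh \<le> 1 + length L" using exploredD(6,14)[OF E(1)] by simp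
  moreover have "2 * length (included st) \<le> 2 * k"
    using explored_lengths(2)[OF E(1)] by (simp add: length_inc_list)
  ultimately show ?thesis using i by (simp split: if_splits)
qed

lemma search_rep_stop:
  assumes "explored st 0 Q qh xs ys L" "search_rep st 0 Q qh ys L R A"
    "\<And>r. r < 40 \<Longrightarrow> r \<noteq> rSt \<Longrightarrow> R' r = R r"
  shows "stop_rep st R' A" "R' rOne = 1"
proof -
  show "R' rOne = 1" using assms(2,3) by (auto simp: rep_defs)
  have "length Q \<le> 2 * k + 1"
    using exploredD(14)[OF assms(1)] explored_bound[OF assms(1)] by simp
  moreover have "stack_rep st R' A" "link_rep (excluded st) A" "queue_rep Q R' A"
    using assms(2,3) by (auto simp: rep_defs dels_def)
  ultimately show "stop_rep st R' A"
    using exploredD(4)[OF assms(1)] explored_length_Q[OF assms(1)] unfolding stop_rep_def by blast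
qed

lemma wp_explore_step:
  assumes "explore_inv st0 Y0 T0 i (R, A, Y, T)" "R rSt < R rOne"
  shows "wp M W explore_step (explore_inv st0 Y0 T0 (Suc i)) (R, A, Y, 3 + T)"
proof -
  have run: "running st0 i R A" "Y = Y0" "T \<le> T0 + 150 * i" "R rSt = 0"
    using assms by (auto simp: explore_inv_def stopped_def)
  obtain st res Q qh xs ys L where E: "explored st res Q qh xs ys L" and
    rep: "search_rep st res Q qh ys L R A" and l: "res \<noteq> 0 \<longrightarrow> length L + 2 \<le> 2 * k" and
    same: "same_problem st0 st" and
    i: "i \<le> length L + qh + 2 * length (included st) + (if res = 0 then 0 else 1)"
    using run(1) unfolding running_def by blast
  note D = exploredD[OF E] note lens = explored_lengths[OF E] note lL = explored_length_L[OF E l]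
  have r: "R rK = 2 * k" "R rInc = length (inc_list st)" "R rTl = length Q" "R rHd = qh" "R rRes = res"
    "R rN = n" "R rZero = 0" "R rOne = 1" "R rCnt = length L" "A aTw = tw" "A aTg = tg"
    "holds (A aS) (inc_list st)" "holds (A aT) L"
    using rep by (auto simp: rep_defs)
  have cont: "explore_inv st0 Y0 T0 (Suc i) (R', A', Y, T')"
    if "explored st' res' Q' qh' xs' ys' L'" "search_rep st' res' Q' qh' ys' L' R' A'"
      "res' \<noteq> 0 \<longrightarrow> length L' + 2 \<le> 2 * k" "same_problem st0 st'" "T' \<le> T + 150"
      "length L + qh + 2 * length (included st) + (if res = 0 then 0 else 1) <
       length L' + qh' + 2 * length (included st') + (if res' = 0 then 0 else 1)"
    for st' res' Q' qh' xs' ys' L' R' A' T'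
  proof -
    have "running st0 (Suc i) R' A'"
      unfolding running_def
      by (rule exI[of _ st'], rule exI[of _ res'], rule exI[of _ Q'], rule exI[of _ qh'], rule exI[of _ xs'],
          rule exI[of _ ys'], rule exI[of _ L']) (use that i in simp)
    then show ?thesis using that(2,5) run unfolding explore_inv_def by (auto simp: rep_defs)
  qed
  have ib: "Suc i \<le> 6 * k + 3" using running_bound[OF run(1)] by simp
  have emit_cost: "27 * (2 * k) + 6 \<le> 60 * k" using k_pos by simp
  show ?thesis
  proof (cases "2 * k \<le> length (inc_list st)")
    case True
    then have full: "card (inc st) = 2 * k" "length (inc_list st) = 2 * k"
      using lens(2) valid_card(1)[OF D(1)] length_inc_list[of st] by auto
    \<comment> \<open>A reserved edge would come with \<open>card (inc st) < 2 * k\<close>.\<close>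
    have res: "res = 0" using D(20) full by fastforce
    note E0 = E[unfolded res] note rep0 = rep[unfolded res]
    have sols: "sols (inc st0) (exc st0) = {set (inc_list st)}"
      using full_leaf[OF D(1,2) full(1)] same by (simp add: same_problem_def set_inc_list)
    have "wp M W (emit_loop aS rInc) (wp M W (CConst rSt 2) (explore_inv st0 Y0 T0 (Suc i))) (R, A, Y, 6 + T)"
    proof (rule wp_emit_loop[where L = "inc_list st"])
      fix R' T' assume R': "\<And>r. r < 40 \<Longrightarrow> R' r = R r" and T': "T' \<le> 6 + T + 27 * length (inc_list st) + 6"
      have "stop_rep st (R'(rSt := 2)) A" "(R'(rSt := 2)) rOne = 1"
        using search_rep_stop[OF E0 rep0, of "R'(rSt := 2)"] R' by auto
      moreover have "stopped st0 Y0 st (R'(rSt := 2)) (Y @ emit (inc_list st))"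
        unfolding stopped_def using D(1,2) same sols distinct_inc_list[OF D(1)] valid_symm(1)[OF D(1)] run(2)
        by (auto simp: set_inc_list)
      ultimately show "wp M W (CConst rSt 2) (explore_inv st0 Y0 T0 (Suc i)) (R', A, Y @ emit (inc_list st), T')"
        using T' run(3) full(2) emit_cost ib unfolding explore_inv_def by auto
    qed (use r lens valid_symm(1)[OF D(1)] symm_sub in \<open>auto simp: set_inc_list\<close>)
    then show ?thesis using True r by (simp add: explore_step_def)
  next
    case notfull: False
    then have cinc: "card (inc st) < 2 * k"
      using valid_card(1)[OF D(1)] length_inc_list[of st] by simp
    show ?thesis
    proof (cases "qh < length Q")
      case False
      then have qh: "qh = length Q" using D(6) by simp
      show ?thesis
      proof (cases "res = 0")
        case res: True
        note E0 = E[unfolded res] note rep0 = rep[unfolded res]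
        note leaf = explored_leaf[OF E0 qh]
        have "wp M W (emit_loop aT rCnt) (wp M W (CConst rSt 2) (explore_inv st0 Y0 T0 (Suc i))) (R, A, Y, 12 + T)"
        proof (rule wp_emit_loop[where L = L])
          fix R' T' assume R': "\<And>r. r < 40 \<Longrightarrow> R' r = R r" and T': "T' \<le> 12 + T + 27 * length L + 6"
          have "stop_rep st (R'(rSt := 2)) A" "(R'(rSt := 2)) rOne = 1"
            using search_rep_stop[OF E0 rep0, of "R'(rSt := 2)"] R' by auto
          moreover have "stopped st0 Y0 st (R'(rSt := 2)) (Y @ emit L)"
            unfolding stopped_def using D(1,2,8) same leaf(1,2) run(2)
            by (auto simp: same_problem_def intro!: exI[of _ L])
          ultimately show "wp M W (CConst rSt 2) (explore_inv st0 Y0 T0 (Suc i)) (R', A, Y @ emit L, T')"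
            using T' run(3) leaf(3) emit_cost ib unfolding explore_inv_def by auto
        qed (use r lens lL in auto)
        then show ?thesis using notfull qh res r by (simp add: explore_step_def)
      next
        case res: False
        have l': "length L + 2 \<le> 2 * k" using l res by simp
        note F = explored_force[OF E qh res l']
        have same': "same_problem st0 ((res, True) # st)"
          unfolding same_problem_def F(3)[symmetric] using same by (auto simp: same_problem_def)
        have "wp M W force_code (explore_inv st0 Y0 T0 (Suc i)) (R, A, Y, 12 + T)"
        proof (rule wp_force_code[OF E qh res l' rep])
          fix R' A' T' assume "tg res \<in> set Q" "T' \<le> 12 + T + 90"
            "search_rep ((res, True) # st) 0 Q qh [] (L @ [res, tw res]) R' A'"
          then show "explore_inv st0 Y0 T0 (Suc i) (R', A', Y, T')"
            by (intro cont[OF F(4)]) (auto simp: same')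
        next
          fix R' A' T' assume "tg res \<notin> set Q" "T' \<le> 12 + T + 90"
            "search_rep ((res, True) # st) 0 (Q @ [tg res]) qh (live (exc st) (tg res)) (L @ [res]) R' A'"
          then show "explore_inv st0 Y0 T0 (Suc i) (R', A', Y, T')"
            by (intro cont[OF F(5)]) (auto simp: same')
        qed
        then show ?thesis using notfull qh res r by (simp add: explore_step_def)
      qed
    next
      case qh: True
      then have rP: "R rP = hd (ys @ [Q ! qh])" using rep by (simp add: search_rep_def)
      show ?thesis
      proof (cases ys)
        case Nil
        have "wp M W next_code (explore_inv st0 Y0 T0 (Suc i)) (R, A, Y, 12 + T)"
          by (rule wp_next_code[OF E[unfolded Nil] qh rep[unfolded Nil]],
              rule cont[OF explored_next_vertex[OF E[unfolded Nil] qh]]) (use l same in auto)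
        moreover have "\<not> n \<le> R rP" using rP Nil explored_nth_less[OF E qh] by simp
        ultimately show ?thesis using notfull qh r by (simp add: explore_step_def)
      next
        case (Cons p ys')
        note Ep = E[unfolded Cons] note repp = rep[unfolded Cons]
        note c = explored_current[OF Ep qh]
        have p: "R rP = p" "p \<in> arcs" "n \<le> p" "p < M" using rP Cons c(1) arc_ge lt_M(3)[of p] by auto
        have fl: "A aFl p = (if p \<in> inc st then 1 else 0)" using rep p(2) by (simp add: rep_defs)
        have resW: "1 + res < W" using D(15) arc_less[of res] M_def W_large by (cases "res = 0") auto
        have check: "wp M W check_code (explore_inv st0 Y0 T0 (Suc i)) (R', A', Y, T')"
          if E': "explored st res' Q' qh xs' ys' L'" and rep': "search_rep st res' Q' qh ys' L' R' A'"
            and "length L' \<le> 2 * k" "T' \<le> T + 100"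
            and prog: "length L + (if res = 0 then 0 else 1) < length L' + (if res' = 0 then 0 else 1)"
          for R' A' T' res' Q' xs' L' ys'
        proof (rule wp_check_code[OF E' rep' that(3)])
          fix R'' A'' T'' assume b: "res' \<noteq> 0" "2 * k \<le> length L' + 1" and
            reps: "stack_rep ((res', False) # st) R'' A''" "queue_rep Q' R'' A''" "link_rep (res' # excluded st) A''"
            "R'' rSt = 1" "T'' \<le> T' + 18"
          note D' = exploredD[OF E']
          have big: "2 * k \<le> card (component (arcs - (exc st \<union> {res', tw res'})) (root st))"
            using explored_large[OF E' b(2)] b(1) by (simp add: deleted_def)
          note B = valid_branch[OF D'(1,2) D'(15)[OF b(1)] D'(16)[OF b(1)] D'(17)[OF b(1)] D'(19)[OF b(1)]
              big D'(20)[OF b(1)]]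
          have "length Q' \<le> 2 * k + 1" using D'(14) that(3) by simp
          then have "stop_rep ((res', False) # st) R'' A''"
            unfolding stop_rep_def using reps D'(4) explored_length_Q[OF E'] by auto
          moreover have "sols (inc st0) (exc st0) \<union> pending st0 =
              sols (inc ((res', False) # st)) (exc ((res', False) # st)) \<union> pending ((res', False) # st)"
            using B(3) same unfolding same_problem_def by metis
          moreover have "length (excluded ((res', False) # st)) = Suc (length (excluded st0))"
            using same by (simp add: same_problem_def)
          ultimately have "stop_rep ((res', False) # st) R'' A''" "stopped st0 Y0 ((res', False) # st) R'' Y"
            unfolding stopped_def using B(1,2) reps(4) run(2) by blast+
          moreover have "R'' rOne = 1" using reps(1) by (simp add: rep_defs)
          ultimately show "explore_inv st0 Y0 T0 (Suc i) (R'', A'', Y, T'')"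
            unfolding explore_inv_def using reps(5) that(4) run(3) ib by auto
        next
          fix R'' T'' assume "res' \<noteq> 0 \<Longrightarrow> length L' + 2 \<le> 2 * k" "search_rep st res' Q' qh ys' L' R'' A'" "T'' \<le> T' + 9"
          then show "explore_inv st0 Y0 T0 (Suc i) (R'', A', Y, T'')"
            using prog that(4) by (intro cont[OF E']) (auto simp: same)
        qed
        have "wp M W arc_code (explore_inv st0 Y0 T0 (Suc i)) (R, A, Y, 12 + T)"
        proof (cases "res = 0 \<and> p \<notin> inc st")
          case True
          then have res: "res = 0" and pi: "p \<notin> inc st" by auto
          note X = explored_reserve[OF Ep[unfolded res] qh pi cinc n_pos]
          have rep1: "search_rep st 0 Q qh (p # ys') L (R(rF := 0)) A"
            using repp res by (auto simp: rep_defs)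
          have "wp M W reserve_code (wp M W check_code (explore_inv st0 Y0 T0 (Suc i))) (R(rF := 0), A, Y, 21 + T)"
            by (rule wp_reserve_code[OF Ep[unfolded res] qh rep1 X], rule check[OF X(1)])
              (use lL res X(2) in auto)
          then show ?thesis using p fl r True resW by (simp add: arc_code_def)
        next
          case False
          then have ne: "res \<noteq> 0 \<or> p \<in> inc st" by auto
          note X = explored_scan[OF Ep qh ne]
          define x where "x = A aFl p + res"
          have x: "x \<noteq> 0" "x < W" unfolding x_def using ne fl resW by auto
          have rep1: "search_rep st res Q qh (p # ys') L (R(rF := x)) A"
            using repp by (auto simp: rep_defs)
          have lL': "length (L @ [p]) \<le> 2 * k"
          proof (cases "res = 0")
            case True
            then show ?thesis using explored_bound[OF X[unfolded True]] by simp
          next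
            case False
            then show ?thesis using l by simp
          qed
          have "wp M W scan_code (wp M W check_code (explore_inv st0 Y0 T0 (Suc i))) (R(rF := x), A, Y, 21 + T)"
            by (rule wp_scan_code[OF Ep qh rep1 lL _ X], rule check[OF X])
              (use lL' in auto)
          then show ?thesis using p r x unfolding x_def by (auto simp: arc_code_def)
        qed
        then show ?thesis using notfull qh r p by (simp add: explore_step_def)
      qed
    qed
  qed
qed

section \<open>A complete search with its set-up and clean-up\<close>

definition main_rep :: "(nat \<times> bool) list \<Rightarrow> (nat \<Rightarrow> nat) \<Rightarrow> (nat \<Rightarrow> nat \<Rightarrow> nat) \<Rightarrow> bool" where
  "main_rep st R A \<longleftrightarrow> stack_rep st R A \<and> link_rep (excluded st) A \<and> (\<forall>v < n. A aFl v = 0)"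

lemma wp_clear_code:
  assumes rep: "stop_rep st R A"
    and Q: "\<And>R' A' T'. main_rep st R' A' \<Longrightarrow> R' rSt = R rSt \<Longrightarrow> T' \<le> T + 24 * k + 18 \<Longrightarrow> Qp (R', A', Y, T')"
  shows "wp M W clear_code Qp (R, A, Y, T)"
proof -
  obtain Q where Q: "stack_rep st R A" "link_rep (excluded st) A" "queue_rep Q R A" "set Q \<subseteq> {..<n}"
    "length Q \<le> n" "length Q \<le> 2 * k + 1"
    using rep unfolding stop_rep_def by blast
  define I where "I = (\<lambda>i (R', A', Y', T'). (\<forall>r < 40. R' r = R r) \<and> R' 40 = i \<and> i \<le> length Q \<and>
    (\<forall>a. a \<noteq> aFl \<longrightarrow> A' a = A a) \<and> (\<forall>a \<in> arcs. A' aFl a = A aFl a) \<and>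
    (\<forall>v < n. v \<notin> set (drop i Q) \<longrightarrow> A' aFl v = 0) \<and>
    Y' = Y \<and> T' \<le> T + 3 + 12 * i)"
  have r: "R rTl = length Q" "R rOne = 1" "R rZero = 0" "holds (A aQ) Q"
    using Q by (auto simp: rep_defs)
  have "wp M W (CWhile 40 rTl (CLoad 41 aQ 40 ;; CStore aFl 41 rZero ;; CAdd 40 40 rOne)) Qp (R(40 := 0), A, Y, 3 + T)"
  proof (rule wp_While[where I = I and B = "length Q"])
    show "I 0 (R(40 := 0), A, Y, 3 + T)" using Q(3) by (auto simp: I_def queue_rep_def)
  next
    fix i R' A' Y' T' assume I: "I i (R', A', Y', T')" and lt: "R' 40 < R' rTl"
    then have i: "i < length Q" using r by (auto simp: I_def)
    have v: "Q ! i < n" using Q(4) nth_mem[OF i] by auto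
    have Ai: "A' aQ i = Q ! i" using I holds_nth[OF r(4) i] by (auto simp: I_def)
    have b: "i < M" "Q ! i < M" "i + 1 < W" using i Q(5) v M_def W_large by auto
    have d: "drop i Q = Q ! i # drop (Suc i) Q" using i by (simp add: Cons_nth_drop_Suc)
    have na: "Q ! i \<noteq> a" if "a \<in> arcs" for a using v arc_ge[OF that] by simp
    have R': "R' rOne = 1" "R' rZero = 0" "R' 40 = i" using I r by (auto simp: I_def)
    show "wp M W (CLoad 41 aQ 40 ;; CStore aFl 41 rZero ;; CAdd 40 40 rOne) (I (Suc i)) (R', A', Y', 3 + T')"
      using I R' b Ai i na d by (auto simp: I_def)
  next
    fix i R' A' Y' T' assume "I i (R', A', Y', T')" "R' 40 < R' rTl"
    then show "i < length Q" using r by (auto simp: I_def)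
  next
    fix i R' A' Y' T' assume I: "I i (R', A', Y', T')" and "\<not> R' 40 < R' rTl"
    then have i: "i = length Q" using r by (auto simp: I_def)
    have "Qp (R', A', Y, 3 + T')"
      by (rule assms(2)) (use I Q i in \<open>auto simp: I_def main_rep_def rep_defs\<close>)
    then show "Qp (R', A', Y', 3 + T')" using I by (auto simp: I_def)
  qed
  then show ?thesis by (simp add: clear_code_def)
qed

lemma wp_start_code:
  assumes rep: "main_rep st R A" and st: "valid st" "good st" and s0: "R rSt = 0"
    and Q: "\<And>R' A'. search_rep st 0 [root st] 0 (live (exc st) (root st)) [] R' A' \<Longrightarrow> Qp (R', A', Y, 30 + T)"
  shows "wp M W start_code Qp (R, A, Y, T)"
proof -
  have ne: "included st \<noteq> []" using st by (simp add: good_def)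
  let ?a = "last (included st)"
  have a: "?a \<in> arcs" using valid_arcs(1)[OF st(1)] ne by auto
  obtain l where l: "inc_list st = ?a # l"
    using ne unfolding inc_list_def by (cases "included st" rule: rev_cases) auto
  have r: "R rZero = 0" "R rOne = 1" "A aTw = tw" "A aTg = tg" "A aNx = fst (lk (excluded st))"
    using rep by (auto simp: main_rep_def rep_defs)
  have A0: "A aS 0 = ?a" using rep l by (auto simp: main_rep_def rep_defs holds_def)
  have v: "root st < n" "tg (tw ?a) = root st" "root st \<noteq> b" if "b \<in> arcs" for b
    using root_less[OF st] arc_ge[OF that] by (auto simp: root_def)
  have v': "root st < n" "tg (tw ?a) = root st" using v[OF a] by auto
  have b: "?a < M" "tw ?a < M" "0 < M" "root st < M"
    using lt_M(3)[OF a] lt_M(3)[OF tw_in[OF a]] lt_M(2)[OF v'(1)] M_def by auto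
  have f: "fst (lk (excluded st)) (root st) = hd (live (exc st) (root st) @ [root st])"
    by (rule lk_first[OF valid_deletable[OF st(1)] v'(1)])
  have na: "root st \<notin> arcs" using v(3) by blast
  show ?thesis
    unfolding start_code_def
    apply (simp add: r A0 b v' del: tg_tw)
    apply (rule Q)
    using rep f s0 na by (auto simp: main_rep_def rep_defs dels_def holds_def)
qed

text \<open>The constant collects \<open>30\<close> for the start,
  \<open>150 * (6 * k + 3) + 60 * k\<close> for the loop and \<open>24 * k + 21\<close> for
  clearing, rounded up with \<open>k >= 1\<close>.\<close>

lemma wp_explore_code:
  assumes rep: "main_rep st R A" and st: "valid st" "good st" and s0: "R rSt = 0"
    and Q: "\<And>st' R' A' Y' T'. main_rep st' R' A' \<Longrightarrow> stopped st Y st' R' Y' \<Longrightarrow>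
      T' \<le> T + 2000 * k \<Longrightarrow> Qp (R', A', Y', T')"
  shows "wp M W explore_code Qp (R, A, Y, T)"
  unfolding explore_code_def wp_Seq
proof (rule wp_start_code[OF rep st s0])
  fix R' A' assume rep': "search_rep st 0 [root st] 0 (live (exc st) (root st)) [] R' A'"
  show "wp M W (CWhile rSt rOne explore_step) (wp M W clear_code Qp) (R', A', Y, 30 + T)"
  proof (rule wp_While[where I = "explore_inv st Y (30 + T)" and B = "6 * k + 3"])
    have "running st 0 R' A'"
      unfolding running_def same_problem_def using explored_init[OF st] rep' by fastforce
    then show "explore_inv st Y (30 + T) 0 (R', A', Y, 30 + T)"
      unfolding explore_inv_def using rep' by (auto simp: rep_defs)
  next
    fix i R A Y' T'
    assume "explore_inv st Y (30 + T) i (R, A, Y', T')" "R rSt < R rOne"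
    then show "wp M W explore_step (explore_inv st Y (30 + T) (Suc i)) (R, A, Y', 3 + T')"
      by (rule wp_explore_step)
  next
    fix i R A Y' T'
    assume "explore_inv st Y (30 + T) i (R, A, Y', T')" "R rSt < R rOne"
    then show "i < 6 * k + 3" using running_bound by (auto simp: explore_inv_def stopped_def)
  next
    fix i R A Y' T'
    assume I: "explore_inv st Y (30 + T) i (R, A, Y', T')" and "\<not> R rSt < R rOne"
    then obtain st' where st': "stopped st Y st' R Y'" "stop_rep st' R A" and T': "T' \<le> 30 + T + 150 * i + 60 * k" "i \<le> 6 * k + 3"
      by (auto simp: explore_inv_def)
    show "wp M W clear_code Qp (R, A, Y', 3 + T')"
    proof (rule wp_clear_code[OF st'(2)])
      fix R1 A1 T1 assume 1: "main_rep st' R1 A1" "R1 rSt = R rSt" "T1 \<le> 3 + T' + 24 * k + 18"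
      have "stopped st Y st' R1 Y'" using st'(1) 1(2) by (simp add: stopped_def)
      then show "Qp (R1, A1, Y', T1)"
        using 1 T' k_pos by (intro Q) auto
    qed
  qed
qed

section \<open>Backtracking to the latest exclusion\<close>

definition backtracked :: "(nat \<times> bool) list \<Rightarrow> (nat \<times> bool) list \<Rightarrow> bool" where
  "backtracked st st' \<longleftrightarrow> valid st' \<and> good st' \<and> length (excluded st) = Suc (length (excluded st')) \<and>
     pending st = sols (inc st') (exc st') \<union> pending st'"

text \<open>Every pass that does not end the loop pops an included edge, of which there are at most
  \<open>k\<close>; this is recorded by \<open>length (included s) + i <= k\<close>.\<close>

definition backtrack_inv :: "(nat \<times> bool) list \<Rightarrow> nat \<Rightarrow> nat \<Rightarrow> (nat \<Rightarrow> nat) \<Rightarrow> (nat \<Rightarrow> nat \<Rightarrow> nat) \<Rightarrow> nat \<Rightarrow> bool" where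
  "backtrack_inv st T0 i R A T \<longleftrightarrow> const_regs R \<and> T \<le> T0 + 100 * i \<and> i \<le> k + 1 \<and>
     (R rGo = 1 \<and> (\<exists>s. main_rep s R A \<and> valid s \<and> excluded s = excluded st \<and> pending s = pending st \<and>
        length (included s) + i \<le> k) \<or>
      R rGo = 0 \<and> (R rSt = 3 \<and> excluded st = [] \<and> pending st = {} \<or>
        R rSt = 0 \<and> (\<exists>st'. main_rep st' R A \<and> backtracked st st')))"

lemma wp_backtrack_step:
  assumes I: "backtrack_inv st T0 i R A T" and go: "R rZero < R rGo"
    and Q: "\<And>R' A' T'. backtrack_inv st T0 (Suc i) R' A' T' \<Longrightarrow> Qp (R', A', Y, T')"
  shows "wp M W backtrack_step Qp (R, A, Y, 3 + T)"
proof -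
  have c: "const_regs R" "T \<le> T0 + 100 * i" using I by (auto simp: backtrack_inv_def)
  then have r: "R rZero = 0" "R rOne = 1" "R rTwo = 2" by (auto simp: const_regs_def)
  obtain s where s: "main_rep s R A" "valid s" "excluded s = excluded st" "pending s = pending st"
    "length (included s) + i \<le> k"
    using I go r by (auto simp: backtrack_inv_def)
  have go1: "R rGo = 1" using I go r by (auto simp: backtrack_inv_def)
  have top: "R rTop = length s" "R rInc = length (inc_list s)" "A aTw = tw"
    using s(1) by (auto simp: main_rep_def rep_defs)
  show ?thesis
  proof (cases s)
    case Nil
    have "Qp (R(rGo := 0, rSt := 3), A, Y, 12 + T)"
      by (rule Q) (use Nil s c in \<open>auto simp: backtrack_inv_def const_regs_def\<close>)
    then show ?thesis using Nil top r by (simp add: backtrack_step_def)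
  next
    case (Cons e s')
    obtain a b where e: "e = (a, b)" by (cases e)
    have v: "valid s'" "a \<in> arcs" "a \<notin> inc s'" "a \<notin> exc s'" using s(2) Cons e by auto
    have tw: "tw a \<in> arcs" "tw a \<notin> inc s'" "a < M" "tw a < M" "tw a \<noteq> a"
      using v valid_symm(1)[OF v(1)] symm_tw_iff lt_M(3) by auto
    have Za: "holds (A aZ) (rev (map fst s') @ [a])" using s(1) Cons e by (auto simp: main_rep_def rep_defs)
    then have a: "A aZ (length s') = a" using holds_nth[OF Za, of "length s'"] by (simp add: nth_append)
    note Zs = holds_append[OF Za]
    have lm: "length s' < M" using valid_length[OF v(1)] M_def by simp
    have fl: "A aFl a = (if b then 1 else 0)"
      using s(1) v(2,3) Cons e by (cases b) (auto simp: main_rep_def rep_defs)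
    have va: "v \<noteq> a" "v \<noteq> tw a" if "v < n" for v
      using that arc_ge[OF v(2)] arc_ge[OF tw(1)] by auto
    show ?thesis
    proof (cases b)
      case True
      have il: "inc_list s = inc_list s' @ [a, tw a]" using Cons e True by (simp add: inc_list_True)
      have "holds (A aS) (inc_list s')" using s(1) il by (auto simp: main_rep_def rep_defs intro: holds_append)
      then have rep: "main_rep s' (R(rA := a, rF := 1, rB := tw a, rTop := length s', rInc := length (inc_list s')))
          (A(aFl := (A aFl)(a := 0, tw a := 0)))"
        using s(1) Cons e True v tw Zs va by (auto simp: main_rep_def rep_defs)
      have "Qp (R(rA := a, rF := 1, rB := tw a, rTop := length s', rInc := length (inc_list s')),
          A(aFl := (A aFl)(a := 0, tw a := 0)), Y, 33 + T)"
        by (rule Q) (use rep Cons e True s v c go1 in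
          \<open>auto simp: backtrack_inv_def const_regs_def intro!: exI[of _ s']\<close>)
      then show ?thesis
        using top r a fl True il Cons e lm tw by (simp add: backtrack_step_def)
    next
      case False
      have g: "good ((a, True) # s')" using s(2) Cons e False by auto
      have v': "valid ((a, True) # s')" using v by simp
      have len: "length (inc_list s') + 2 \<le> 2 * k"
        using g valid_card(1)[OF v'] length_inc_list[of "(a, True) # s'"] inc_list_True[of a s']
        by (simp add: good_def)
      then have lw: "length (inc_list s') < M" "Suc (length (inc_list s')) < M" "Suc (length (inc_list s')) < W"
        "Suc (Suc (length (inc_list s'))) < W" using k_le_m M_def W_large by auto
      have il: "inc_list s = inc_list s'" using Cons e False by (simp add: inc_list_False)
      have ex: "excluded s = a # excluded s'" using Cons e False by simp
      have del: "deletable (a # excluded s')" using valid_deletable[OF s(2)] ex by simp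
      have lk: "A aNx = fst (lk (a # excluded s'))" "A aPv = snd (lk (a # excluded s'))" "holds (A aS) (inc_list s')"
        using s(1) ex il by (auto simp: main_rep_def rep_defs)
      have "wp M W (relink_edge rA) (wp M W (include_code ;; CConst rGo 0 ;; CConst rSt 0) Qp)
          (R(rA := a, rF := 0, rB := tw a), A, Y, 21 + T)"
      proof (rule wp_relink_edge[where D = "excluded s'" and x = a])
        fix R' assume "\<And>r. r < 40 \<Longrightarrow> R' r = (R(rA := a, rF := 0, rB := tw a)) r"
        then have R': "\<And>r. r < 40 \<Longrightarrow> R' r = (if r = rB then tw a else if r = rF then 0 else if r = rA then a else R r)"
          by auto
        let ?R = "R'(rInc := Suc (Suc (length (inc_list s'))), rGo := 0, rSt := 0)"
        let ?A = "A(aNx := fst (lk (excluded s')), aPv := snd (lk (excluded s')), aFl := (A aFl)(a := 1, tw a := 1),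
           aS := (A aS)(length (inc_list s') := a, Suc (length (inc_list s')) := tw a))"
        have rep: "main_rep ((a, True) # s') ?R ?A"
          using s(1) R' Cons e False il v tw va Za holds_snoc2[OF lk(3), of a "tw a"]
          by (auto simp: main_rep_def rep_defs inc_list_True)
        have bt: "backtracked st ((a, True) # s')"
          unfolding backtracked_def using v' g ex s(3,4) Cons e False by (auto simp flip: s(3,4))
        have "Qp (?R, ?A, Y, 72 + T)"
          by (rule Q) (use rep bt c s(5) R' in \<open>auto simp: backtrack_inv_def const_regs_def\<close>)
        then show "wp M W (include_code ;; CConst rGo 0 ;; CConst rSt 0) Qp
           (R', A(aNx := fst (lk (excluded s')), aPv := snd (lk (excluded s'))), Y, 27 + (21 + T))"
          using R' top il lw tw r by (simp add: include_code_def)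
      qed (use lk top del in auto)
      then show ?thesis
        using top r a fl False Cons e lm tw by (simp add: backtrack_step_def)
    qed
  qed
qed

lemma wp_backtrack_code:
  assumes rep: "main_rep st R A" and st: "valid st" "length (included st) \<le> k"
    and Q1: "\<And>R' A' T'. excluded st = [] \<Longrightarrow> pending st = {} \<Longrightarrow> const_regs R' \<Longrightarrow> R' rSt = 3 \<Longrightarrow>
      T' \<le> T + 206 * k \<Longrightarrow> Qp (R', A', Y, T')"
    and Q2: "\<And>st' R' A' T'. main_rep st' R' A' \<Longrightarrow> backtracked st st' \<Longrightarrow> R' rSt = 0 \<Longrightarrow>
      T' \<le> T + 206 * k \<Longrightarrow> Qp (R', A', Y, T')"
  shows "wp M W backtrack_code Qp (R, A, Y, T)"
proof -
  have "wp M W (CWhile rZero rGo backtrack_step) Qp (R(rGo := 1), A, Y, 3 + T)"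
  proof (rule wp_While[where I = "\<lambda>i (R', A', Y', T'). backtrack_inv st (3 + T) i R' A' T' \<and> Y' = Y" and B = "k + 1"])
    have "main_rep st (R(rGo := 1)) A" "const_regs (R(rGo := 1))"
      using rep by (auto simp: main_rep_def rep_defs)
    then show "case (R(rGo := 1), A, Y, 3 + T) of (R', A', Y', T') \<Rightarrow> backtrack_inv st (3 + T) 0 R' A' T' \<and> Y' = Y"
      using st by (auto simp: backtrack_inv_def)
  next
    fix i R' A' Y' T'
    assume "case (R', A', Y', T') of (R', A', Y', T') \<Rightarrow> backtrack_inv st (3 + T) i R' A' T' \<and> Y' = Y" "R' rZero < R' rGo"
    then show "wp M W backtrack_step (\<lambda>(R', A', Y', T'). backtrack_inv st (3 + T) (Suc i) R' A' T' \<and> Y' = Y) (R', A', Y', 3 + T')"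
      by (auto intro: wp_backtrack_step)
  next
    fix i R' A' Y' T'
    assume "case (R', A', Y', T') of (R', A', Y', T') \<Rightarrow> backtrack_inv st (3 + T) i R' A' T' \<and> Y' = Y" "R' rZero < R' rGo"
    then show "i < k + 1" by (auto simp: backtrack_inv_def)
  next
    fix i R' A' Y' T'
    assume "case (R', A', Y', T') of (R', A', Y', T') \<Rightarrow> backtrack_inv st (3 + T) i R' A' T' \<and> Y' = Y" "\<not> R' rZero < R' rGo"
    then have I: "backtrack_inv st (3 + T) i R' A' T'" "Y' = Y" "R' rGo = 0"
      by (auto simp: backtrack_inv_def const_regs_def)
    \<comment> \<open>This is \<open>6 + 100 * (k + 1) <= 206 * k\<close>, tight for
      \<open>k = 1\<close>.\<close>
    have t: "3 + T' \<le> T + 206 * k" using I(1) k_pos by (auto simp: backtrack_inv_def)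
    show "Qp (R', A', Y', 3 + T')"
      using I t by (auto simp: backtrack_inv_def intro: Q1 Q2)
  qed
  then show ?thesis by (simp add: backtrack_code_def)
qed

section \<open>The main loop and the number of its iterations\<close>

definition listing :: "nat list list \<Rightarrow> bool" where
  "listing Ls \<longleftrightarrow> distinct (map set Ls) \<and> (\<forall>L \<in> set Ls. distinct L \<and> symm (set L))"

text \<open>
  Every iteration raises twice the number of outputs plus the number of excluded edges (plus one
  after a branching) by exactly one; this bounds the number of iterations by twice the number of
  solutions.
\<close>

definition main_inv :: "nat \<Rightarrow> nat list \<Rightarrow> nat \<Rightarrow> nat \<Rightarrow> state \<Rightarrow> bool" where
  "main_inv x0 Y0 T0 i = (\<lambda>(R, A, Y, T). const_regs R \<and> T \<le> T0 + 2300 * k * i \<and>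
     (\<exists>Ls. listing Ls \<and> Y = Y0 @ concat (map emit Ls) \<and>
       (R rSt = 3 \<and> set ` set Ls = sols {} {} \<and> i + x0 \<le> 2 * length Ls + 1 \<or>
        (\<exists>st. main_rep st R A \<and> valid st \<and> length (included st) \<le> k \<and>
          (R rSt = 2 \<and> set ` set Ls \<union> pending st = sols {} {} \<and> set ` set Ls \<inter> pending st = {} \<and>
             i + x0 = 2 * length Ls + length (excluded st) \<or>
           R rSt = 1 \<and> good st \<and> set ` set Ls \<union> (sols (inc st) (exc st) \<union> pending st) = sols {} {} \<and>
             set ` set Ls \<inter> (sols (inc st) (exc st) \<union> pending st) = {} \<and>
             i + x0 = 2 * length Ls + length (excluded st) + 1)))))"

lemma good_included: "valid st \<Longrightarrow> good st \<Longrightarrow> length (included st) \<le> k"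
  using valid_card(1)[of st] by (simp add: good_def)

lemma listing_length: "listing Ls \<Longrightarrow> set ` set Ls \<subseteq> sols {} {} \<Longrightarrow> length Ls \<le> card (sols {} {})"
  using card_mono[OF finite_sols[of "{}" "{}"], of "set ` set Ls"] distinct_card[of "map set Ls"]
  by (simp add: listing_def)

text \<open>Both outcomes of a search raise the potential by one: a branching adds an excluded edge,
  an output adds two and gives up the extra one. The allowance \<open>290 * k\<close> covers the
  backtracking that may precede the search; with \<open>2000 * k + 3\<close> for the search it stays
  below \<open>2300 * k\<close>.\<close>

lemma main_explore:
  assumes rep: "main_rep st R A" and st: "valid st" "good st" and s0: "R rSt = 0"
    and Ls: "listing Ls" "Y = Y0 @ concat (map emit Ls)"
      "set ` set Ls \<union> (sols (inc st) (exc st) \<union> pending st) = sols {} {}"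
      "set ` set Ls \<inter> (sols (inc st) (exc st) \<union> pending st) = {}"
    and i: "i + x0 = 2 * length Ls + length (excluded st) + 1" and T: "T \<le> T0 + 2300 * k * i + 290 * k"
  shows "wp M W (CIf rThree rSt CSkip explore_code) (main_inv x0 Y0 T0 (Suc i)) (R, A, Y, T)"
proof -
  have r: "R rThree = 3" using rep by (auto simp: main_rep_def rep_defs)
  have "wp M W explore_code (main_inv x0 Y0 T0 (Suc i)) (R, A, Y, 3 + T)"
  proof (rule wp_explore_code[OF rep st s0])
    fix st' R' A' Y' T'
    assume rep': "main_rep st' R' A'" and stop: "stopped st Y st' R' Y'" and T': "T' \<le> 3 + T + 2000 * k"
    have c: "const_regs R'" using rep' by (auto simp: main_rep_def rep_defs)
    have T'': "T' \<le> T0 + 2300 * k * Suc i" using T T' k_pos by (simp add: algebra_simps)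
    have v: "valid st'" "good st'" using stop by (auto simp: stopped_def)
    note li = good_included[OF v]
    consider (branch) "R' rSt = 1" "Y' = Y" "length (excluded st') = Suc (length (excluded st))"
        "sols (inc st) (exc st) \<union> pending st = sols (inc st') (exc st') \<union> pending st'"
      | (leaf) L where "R' rSt = 2" "same_problem st st'" "Y' = Y @ emit L" "distinct L" "symm (set L)"
        "sols (inc st) (exc st) = {set L}"
      using stop unfolding stopped_def by blast
    then show "main_inv x0 Y0 T0 (Suc i) (R', A', Y', T')"
    proof cases
      case branch
      show ?thesis
        unfolding main_inv_def prod.case
        by (intro conjI c T'' exI[of _ Ls] Ls(1) disjI2 exI[of _ st'] rep' v li)
          (use branch Ls i in auto)
    next
      case leaf
      have disj: "sols (inc st) (exc st) \<inter> pending st = {}" by (rule sols_pending_disjoint) simp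
      have "set L \<notin> set ` set Ls" using Ls(4) leaf(6) by auto
      then have list: "listing (Ls @ [L])" using Ls(1) leaf by (auto simp: listing_def)
      have pend: "pending st' = pending st" "excluded st' = excluded st"
        using leaf(2) by (auto simp: same_problem_def)
      have "set ` set (Ls @ [L]) \<union> pending st' = sols {} {}" "set ` set (Ls @ [L]) \<inter> pending st' = {}"
        using Ls(3,4) leaf(6) disj pend by auto
      then show ?thesis
        unfolding main_inv_def prod.case
        by (intro conjI c T'' exI[of _ "Ls @ [L]"] list disjI2 exI[of _ st'] rep' v li disjI1)
          (use leaf Ls(2) pend i in auto)
    qed
  qed
  then show ?thesis using r s0 by simp
qed

lemma wp_main_loop:
  assumes rep: "main_rep st R A" and st: "valid st" "included st = []" "excluded st \<noteq> []"
    "pending st = sols {} {}"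
    and Q: "\<And>R' A' T' Ls. listing Ls \<Longrightarrow> set ` set Ls = sols {} {} \<Longrightarrow>
      T' \<le> T + 4600 * k * card (sols {} {}) + 6 \<Longrightarrow> Qp (R', A', Y @ concat (map emit Ls), T')"
  shows "wp M W main_loop Qp (R, A, Y, T)"
proof -
  let ?N = "card (sols {} {})" and ?x = "length (excluded st)"
  have "wp M W (CWhile rSt rThree (CIf rTwo rSt backtrack_code (CConst rSt 0) ;; CIf rThree rSt CSkip explore_code))
      Qp (R(rSt := 2), A, Y, 3 + T)"
  \<comment> \<open>This crude bound, in which the excluded edges are estimated by \<open>m\<close>,
    is for termination only; the sharp count is obtained in the exit case.\<close>
  proof (rule wp_While[where I = "main_inv ?x Y (3 + T)" and B = "2 * ?N + m + 2"])
    have "main_rep st (R(rSt := 2)) A" "const_regs (R(rSt := 2))"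
      using rep by (auto simp: main_rep_def rep_defs)
    then show "main_inv ?x Y (3 + T) 0 (R(rSt := 2), A, Y, 3 + T)"
      unfolding main_inv_def prod.case using st
      by (intro conjI exI[of _ "[]"] disjI2 exI[of _ st] disjI1) (auto simp: listing_def)
  next
    fix i R' A' Y' T'
    assume I: "main_inv ?x Y (3 + T) i (R', A', Y', T')" and lt: "R' rSt < R' rThree"
    have c: "const_regs R'" and T': "T' \<le> 3 + T + 2300 * k * i" using I by (auto simp: main_inv_def)
    have r: "R' rThree = 3" "R' rTwo = 2" using c by (auto simp: const_regs_def)
    obtain Ls st' where Ls: "listing Ls" "Y' = Y @ concat (map emit Ls)" and st': "main_rep st' R' A'" "valid st'"
      "length (included st') \<le> k" and
      d: "(R' rSt = 2 \<and> set ` set Ls \<union> pending st' = sols {} {} \<and> set ` set Ls \<inter> pending st' = {} \<and>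
             i + ?x = 2 * length Ls + length (excluded st') \<or>
           R' rSt = 1 \<and> good st' \<and> set ` set Ls \<union> (sols (inc st') (exc st') \<union> pending st') = sols {} {} \<and>
             set ` set Ls \<inter> (sols (inc st') (exc st') \<union> pending st') = {} \<and>
             i + ?x = 2 * length Ls + length (excluded st') + 1)"
      using I lt r unfolding main_inv_def by auto
    show "wp M W (CIf rTwo rSt backtrack_code (CConst rSt 0) ;; CIf rThree rSt CSkip explore_code)
        (main_inv ?x Y (3 + T) (Suc i)) (R', A', Y', 3 + T')"
      using d
    proof
      assume d: "R' rSt = 2 \<and> set ` set Ls \<union> pending st' = sols {} {} \<and> set ` set Ls \<inter> pending st' = {} \<and>
             i + ?x = 2 * length Ls + length (excluded st')"
      have "wp M W backtrack_code (wp M W (CIf rThree rSt CSkip explore_code) (main_inv ?x Y (3 + T) (Suc i)))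
         (R', A', Y', 6 + T')"
      proof (rule wp_backtrack_code[OF st'])
        fix R1 A1 T1
        assume a: "excluded st' = []" "pending st' = {}" "const_regs R1" "R1 rSt = 3" "T1 \<le> 6 + T' + 206 * k"
        have "main_inv ?x Y (3 + T) (Suc i) (R1, A1, Y', 3 + T1)"
          unfolding main_inv_def prod.case
          by (intro conjI exI[of _ Ls] disjI1) (use a Ls d T' k_pos in \<open>auto simp: algebra_simps\<close>)
        then show "wp M W (CIf rThree rSt CSkip explore_code) (main_inv ?x Y (3 + T) (Suc i)) (R1, A1, Y', T1)"
          using a by (simp add: const_regs_def)
      next
        fix st1 R1 A1 T1
        assume a: "main_rep st1 R1 A1" "backtracked st' st1" "R1 rSt = 0" "T1 \<le> 6 + T' + 206 * k"
        have b: "valid st1" "good st1" "length (excluded st') = Suc (length (excluded st1))"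
          "pending st' = sols (inc st1) (exc st1) \<union> pending st1"
          using a(2) by (auto simp: backtracked_def)
        show "wp M W (CIf rThree rSt CSkip explore_code) (main_inv ?x Y (3 + T) (Suc i)) (R1, A1, Y', T1)"
          by (rule main_explore[OF a(1) b(1,2) a(3) Ls]) (use d b a(4) T' k_pos in auto)
      qed
      then show ?thesis using d r by simp
    next
      assume d: "R' rSt = 1 \<and> good st' \<and> set ` set Ls \<union> (sols (inc st') (exc st') \<union> pending st') = sols {} {} \<and>
             set ` set Ls \<inter> (sols (inc st') (exc st') \<union> pending st') = {} \<and>
             i + ?x = 2 * length Ls + length (excluded st') + 1"
      have "main_rep st' (R'(rSt := 0)) A'" using st'(1) by (auto simp: main_rep_def rep_defs)
      then have "wp M W (CIf rThree rSt CSkip explore_code) (main_inv ?x Y (3 + T) (Suc i)) (R'(rSt := 0), A', Y', 9 + T')"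
        by (rule main_explore[where st = st' and Ls = Ls]) (use d st' Ls T' k_pos in auto)
      then show ?thesis using d r by simp
    qed
  next
    fix i R' A' Y' T'
    assume I: "main_inv ?x Y (3 + T) i (R', A', Y', T')" and lt: "R' rSt < R' rThree"
    have r: "R' rThree = 3" using I by (auto simp: const_regs_def main_inv_def)
    obtain Ls st' where Ls1: "listing Ls" and st1: "valid st'" and
      d: "(R' rSt = 2 \<and> set ` set Ls \<union> pending st' = sols {} {} \<and> set ` set Ls \<inter> pending st' = {} \<and>
             i + ?x = 2 * length Ls + length (excluded st') \<or>
           R' rSt = 1 \<and> good st' \<and> set ` set Ls \<union> (sols (inc st') (exc st') \<union> pending st') = sols {} {} \<and>
             set ` set Ls \<inter> (sols (inc st') (exc st') \<union> pending st') = {} \<and>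
             i + ?x = 2 * length Ls + length (excluded st') + 1)"
      using I lt r unfolding main_inv_def by auto
    have Ls: "listing Ls" "set ` set Ls \<subseteq> sols {} {}" using Ls1 d by blast+
    have st': "valid st'" "i \<le> 2 * length Ls + length (excluded st') + 1" using st1 d by auto
    have "length (excluded st') \<le> m"
      using valid_length[OF st'(1)] length_included_excluded[of st'] by simp
    then show "i < 2 * ?N + m + 2" using listing_length[OF Ls] st'(2) by simp
  next
    fix i R' A' Y' T'
    assume I: "main_inv ?x Y (3 + T) i (R', A', Y', T')" and lt: "\<not> R' rSt < R' rThree"
    have r: "R' rThree = 3" using I by (auto simp: const_regs_def main_inv_def)
    obtain Ls where Ls: "listing Ls" "Y' = Y @ concat (map emit Ls)" "set ` set Ls = sols {} {}"
      "i + ?x \<le> 2 * length Ls + 1" and T': "T' \<le> 3 + T + 2300 * k * i"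
      using I lt r unfolding main_inv_def by auto
    \<comment> \<open>At least one exclusion is present at the start. It absorbs the
      \<open>+ 1\<close> of the final state and leaves \<open>i <= 2 * ?N\<close>.\<close>
    have x: "0 < ?x" unfolding length_greater_0_conv by (rule st(3))
    have "length Ls \<le> ?N" using listing_length[OF Ls(1)] Ls(3) by simp
    with x Ls(4) have "i \<le> 2 * ?N" by linarith
    then have "2300 * k * i \<le> 2300 * k * (2 * ?N)" by (rule mult_le_mono2)
    also have "\<dots> = 4600 * k * ?N" by simp
    finally show "Qp (R', A', Y', 3 + T')" unfolding Ls(2) using T' by (intro Q Ls) linarith
  qed
  then show ?thesis by (simp add: main_loop_def)
qed

end

section \<open>Breadth-first construction of the arcs\<close>

definition insert_code :: "nat \<Rightarrow> nat \<Rightarrow> com" where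
  "insert_code v a = CLoad 41 aNx v ;; CStore aNx a 41 ;; CStore aPv a v ;; CStore aPv 41 a ;; CStore aNx v a"

definition range_code :: com where
  "range_code = CAdd rF rV rThree ;; CLoad rP aIn rF ;; CAdd rF rF rOne ;; CLoad rRes aIn rF"

definition arcs_code :: com where
  "arcs_code = CAdd rB rCnt rOne ;; CStore aTg rCnt rA ;; CStore aTg rB rV ;; CStore aTw rCnt rB ;;
     CStore aTw rB rCnt ;; insert_code rV rCnt ;; insert_code rA rB ;; CAdd rCnt rB rOne"

definition edge_code :: com where
  "edge_code = CIf rF rZero (CStore aFl rA rOne ;; CStore aQ rTl rA ;; CAdd rTl rTl rOne) CSkip ;; arcs_code"

definition bfs_step :: com where
  "bfs_step = CIf rRes rP
     (CStore aFl rV rTwo ;; CAdd rHd rHd rOne ;; CIf rTl rHd CSkip (CLoad rV aQ rHd ;; range_code))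
     (CLoad rA aIn rP ;; CAdd rP rP rOne ;; CLoad rF aFl rA ;; CIf rTwo rF CSkip edge_code)"

definition sentinel_code :: com where
  "sentinel_code = CConst rV 0 ;; CWhile rV rN (CStore aNx rV rV ;; CStore aPv rV rV ;; CAdd rV rV rOne)"

definition unmark_code :: com where
  "unmark_code = CConst rV 0 ;; CWhile rV rN (CStore aFl rV rZero ;; CAdd rV rV rOne)"

definition build_code :: com where
  "build_code = sentinel_code ;; CStore aQ rZero rZero ;; CStore aFl rZero rOne ;; CConst rHd 0 ;;
     CConst rTl 1 ;; CSub rCnt rN rZero ;; CConst rV 0 ;; range_code ;; CWhile rHd rTl bfs_step ;; unmark_code"

text \<open>The loop stops with \<open>k - 1\<close> edges left, the longest prefix that contains no
  solution. From here on \<open>rK\<close> is compared with numbers of arcs, hence its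
  doubling.\<close>

definition exclude_code :: com where
  "exclude_code = CConst rTop 0 ;; CConst rInc 0 ;; CSub rF rM rK ;; CAdd rF rF rOne ;; CAdd rK rK rK ;;
     CWhile rTop rF (CSub rCnt rCnt rTwo ;; unlink_edge rCnt ;; CStore aZ rTop rCnt ;; CAdd rTop rTop rOne)"

definition graphlet_code :: com where
  "graphlet_code = CConst rOne 1 ;; CConst rTwo 2 ;; CConst rThree 3 ;; CLoad rN aIn rZero ;;
     CLoad rM aIn rOne ;; CLoad rK aIn rTwo ;; CIf rK rM (build_code ;; exclude_code ;; main_loop) CSkip"

locale input_graph =
  fixes G :: graph and adj :: "nat list list" and n m k M W :: nat
  assumes simple: "simple_graph G" and connected: "connected_graph G" and verts: "verts G = {0..<n}"
    and edges: "card (edges G) = m" and adj: "adjacency_lists G adj" and k_pos: "0 < k"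
    and M_def: "M = n + 2 * m + 4" and W_large: "11 * M \<le> W"
begin

lemma n_pos: "0 < n"
  using connected verts by (auto simp: connected_graph_def)

lemma length_adj: "length adj = n"
  using adj verts by (simp add: adjacency_lists_def)

lemma edge_cases:
  assumes "e \<in> edges G"
  obtains u v where "e = {u, v}" "u \<noteq> v" "u < n" "v < n"
  using assms simple verts unfolding simple_graph_def card_2_iff by fastforce

lemma finite_edges: "finite (edges G)"
  using simple verts unfolding simple_graph_def by (meson PowI finite_Pow_iff finite_subset subsetI)

lemma adj_distinct: "v < n \<Longrightarrow> distinct (adj ! v)"
  and adj_set: "v < n \<Longrightarrow> set (adj ! v) = {u. {v, u} \<in> edges G}"
  using adj length_adj by (auto simp: adjacency_lists_def neighbours_def)

lemma edge_ends: "{u, v} \<in> edges G \<Longrightarrow> u < n \<and> v < n \<and> u \<noteq> v"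
  by (erule edge_cases) (auto simp: doubleton_eq_iff)

lemma incident:
  assumes "v < n"
  shows "{e \<in> edges G. v \<in> e} = (\<lambda>u. {v, u}) ` set (adj ! v)"
proof
  show "{e \<in> edges G. v \<in> e} \<subseteq> (\<lambda>u. {v, u}) ` set (adj ! v)"
  proof
    fix e assume "e \<in> {e \<in> edges G. v \<in> e}"
    then have e: "e \<in> edges G" "v \<in> e" by auto
    from e(1) obtain a b where "e = {a, b}" by (rule edge_cases)
    with e(2) obtain w where "e = {v, w}" by auto
    with e(1) show "e \<in> (\<lambda>u. {v, u}) ` set (adj ! v)" by (auto simp: adj_set[OF assms])
  qed
qed (auto simp: adj_set[OF assms])

text \<open>Handshake identity by double counting. It fixes the length of the input and the length
  of the breadth-first search.\<close>

lemma sum_degrees: "(\<Sum>v<n. length (adj ! v)) = 2 * m"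
proof -
  have deg: "length (adj ! v) = card {e \<in> edges G. v \<in> e}" if v: "v < n" for v
  proof -
    have "bij_betw (\<lambda>u. {v, u}) (set (adj ! v)) {e \<in> edges G. v \<in> e}"
      unfolding bij_betw_def
    proof
      show "inj_on (\<lambda>u. {v, u}) (set (adj ! v))" by (auto simp: inj_on_def doubleton_eq_iff)
      show "(\<lambda>u. {v, u}) ` set (adj ! v) = {e \<in> edges G. v \<in> e}"
        by (rule incident[OF v, symmetric])
    qed
    then have "card (set (adj ! v)) = card {e \<in> edges G. v \<in> e}" by (rule bij_betw_same_card)
    then show ?thesis using adj_distinct[OF v] by (simp add: distinct_card)
  qed
  have "(\<Sum>v<n. card {e \<in> edges G. v \<in> e}) = 2 * card (edges G)"
  proof (rule sum_multicount)
    show "\<forall>e \<in> edges G. card {v \<in> {..<n}. v \<in> e} = 2"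
    proof
      fix e assume "e \<in> edges G"
      then obtain u v where e: "e = {u, v}" "u \<noteq> v" "u < n" "v < n" by (rule edge_cases)
      then have "{w \<in> {..<n}. w \<in> e} = {u, v}" by auto
      then show "card {w \<in> {..<n}. w \<in> e} = 2" using e by simp
    qed
  qed (use finite_edges in auto)
  then show ?thesis using edges deg by simp
qed

definition offset :: "nat \<Rightarrow> nat" where
  "offset v = n + 4 + length (concat (take v adj))"

definition input :: "nat \<Rightarrow> nat" where
  "input i = (if i < length (graph_input G adj k) then graph_input G adj k ! i else 0)"

lemma offset_Suc: "v < n \<Longrightarrow> offset (Suc v) = offset v + length (adj ! v)"
  by (simp add: offset_def take_Suc_conv_app_nth length_adj)

lemma length_concat_take: "v \<le> n \<Longrightarrow> length (concat (take v adj)) = (\<Sum>u<v. length (adj ! u))"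
proof (induction v)
  case (Suc v)
  then show ?case by (simp add: take_Suc_conv_app_nth length_adj)
qed simp

lemma length_concat_adj: "length (concat adj) = 2 * m"
  using length_concat_take[of n] sum_degrees length_adj by simp

lemma offset_le: "v \<le> n \<Longrightarrow> offset v \<le> M"
proof -
  assume "v \<le> n"
  then have "(\<Sum>u<v. length (adj ! u)) \<le> (\<Sum>u<n. length (adj ! u))" by (intro sum_mono2) auto
  then show ?thesis using length_concat_take[OF \<open>v \<le> n\<close>] sum_degrees by (simp add: offset_def M_def)
qed

lemma length_input: "length (graph_input G adj k) = M"
  using length_concat_adj verts by (simp add: graph_input_def M_def)

lemma input_params: "input 0 = n" "input (Suc 0) = m" "input 2 = k"
  using length_input M_def verts edges by (simp_all add: input_def) (simp_all add: graph_input_def)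

lemma input_offset: "v \<le> n \<Longrightarrow> input (3 + v) = offset v"
  using length_input M_def verts
  by (simp add: input_def graph_input_def nth_append offset_def nth_Cons' del: upt_Suc)

lemma nth_concat_adj:
  assumes "v < n" "i < length (adj ! v)"
  shows "concat adj ! (length (concat (take v adj)) + i) = adj ! v ! i"
proof -
  have "concat adj = concat (take v adj) @ adj ! v @ concat (drop (Suc v) adj)"
    using id_take_nth_drop[of v adj] assms(1) length_adj by (metis concat.simps(2) concat_append)
  then show ?thesis using assms(2) by (simp add: nth_append)
qed

lemma input_adj:
  assumes "v < n" "i < length (adj ! v)"
  shows "input (offset v + i) = adj ! v ! i" "offset v + i < M"
proof -
  have "offset v + i < offset (Suc v)" using assms by (simp add: offset_Suc)
  also have "\<dots> \<le> M" by (rule offset_le) (use assms in simp)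
  finally show lt: "offset v + i < M" .
  show "input (offset v + i) = adj ! v ! i"
    unfolding input_def length_input using lt verts nth_concat_adj[OF assms]
    by (simp add: graph_input_def offset_def nth_append nth_Cons' del: upt_Suc)
qed

text \<open>
  The edges found so far are listed with the latest one first, each oriented away from the vertex
  being scanned. Edge number \<open>j\<close>, counted from the end of the list, gets the arcs \<open>n + 2 * j\<close> and
  \<open>n + 2 * j + 1\<close>.
\<close>

definition edges_of :: "(nat \<times> nat) list \<Rightarrow> nat set set" where
  "edges_of rp = (\<lambda>(u, v). {u, v}) ` set rp"

text \<open>The last condition ties each edge to vertex 0 or to an earlier edge; this makes all
  prefixes of the order of discovery connected.\<close>

fun built :: "(nat \<times> nat) list \<Rightarrow> bool" where
  "built [] = True"
| "built ((u, v) # rp) \<longleftrightarrow> built rp \<and> {u, v} \<in> edges G \<and> {u, v} \<notin> edges_of rp \<and>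
     (u = 0 \<or> u \<in> \<Union>(edges_of rp))"

text \<open>An edge is recorded when the first of its ends is scanned. So the recorded edges are
  those meeting a finished vertex, together with those already read at the current one.\<close>

definition bfs :: "(nat \<times> nat) list \<Rightarrow> nat list \<Rightarrow> nat \<Rightarrow> nat list \<Rightarrow> nat list \<Rightarrow> bool" where
  "bfs rp Q qh xs ys \<longleftrightarrow> distinct Q \<and> set Q \<subseteq> {..<n} \<and> 0 \<in> set Q \<and> qh \<le> length Q \<and>
     (qh < length Q \<longrightarrow> adj ! (Q ! qh) = xs @ ys) \<and> (qh = length Q \<longrightarrow> xs = []) \<and> built rp \<and>
     edges_of rp = {e \<in> edges G. e \<inter> set (take qh Q) \<noteq> {}} \<union> (\<lambda>v. {Q ! qh, v}) ` set xs \<and>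
     (\<forall>v \<in> set Q. v = 0 \<or> v \<in> \<Union>(edges_of rp)) \<and>
     (\<forall>v \<in> set (take qh Q). set (adj ! v) \<subseteq> set Q) \<and> set xs \<subseteq> set Q"

lemma bfsD:
  assumes "bfs rp Q qh xs ys"
  shows "distinct Q" "set Q \<subseteq> {..<n}" "0 \<in> set Q" "qh \<le> length Q" "qh < length Q \<Longrightarrow> adj ! (Q ! qh) = xs @ ys"
    "qh = length Q \<Longrightarrow> xs = []" "built rp"
    "edges_of rp = {e \<in> edges G. e \<inter> set (take qh Q) \<noteq> {}} \<union> (\<lambda>v. {Q ! qh, v}) ` set xs"
    "\<forall>v \<in> set Q. v = 0 \<or> v \<in> \<Union>(edges_of rp)" "\<forall>v \<in> set (take qh Q). set (adj ! v) \<subseteq> set Q" "set xs \<subseteq> set Q"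
  using assms unfolding bfs_def by blast+

lemma edges_of_Cons: "edges_of ((u, v) # rp) = insert {u, v} (edges_of rp)"
  by (simp add: edges_of_def)

lemma built_edges: "built rp \<Longrightarrow> edges_of rp \<subseteq> edges G \<and> card (edges_of rp) = length rp"
proof (induction rp rule: built.induct)
  case (2 u v rp)
  have "finite (edges_of rp)" by (simp add: edges_of_def)
  with 2 show ?case by (simp add: edges_of_Cons)
qed (simp add: edges_of_def)

lemma built_length: "built rp \<Longrightarrow> length rp \<le> m"
  using built_edges card_mono[OF finite_edges] edges by metis

lemma bfs_nth_less: "bfs rp Q qh xs ys \<Longrightarrow> i < length Q \<Longrightarrow> Q ! i < n"
  using bfsD(2) nth_mem by blast

lemma bfs_length: "bfs rp Q qh xs ys \<Longrightarrow> length Q \<le> n"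
  using bfsD(1,2)[of rp Q qh xs ys] card_mono[of "{..<n}" "set Q"] by (simp add: distinct_card)

lemma bfs_init: "bfs [] [0] 0 [] (adj ! 0)"
  using n_pos by (auto simp: bfs_def edges_of_def)

lemma bfs_next:
  assumes B: "bfs rp Q qh xs []" and qh: "qh < length Q"
  shows "bfs rp Q (Suc qh) [] (adj ! (Q ! Suc qh))"
proof -
  note D = bfsD[OF B]
  have t: "set (take (Suc qh) Q) = insert (Q ! qh) (set (take qh Q))"
    using qh by (simp add: take_Suc_conv_app_nth)
  have xs: "set (adj ! (Q ! qh)) = set xs" using D(5)[OF qh] by simp
  have e: "edges_of rp = {e \<in> edges G. e \<inter> set (take (Suc qh) Q) \<noteq> {}}"
    unfolding D(8) t xs[symmetric] incident[OF bfs_nth_less[OF B qh], symmetric] by auto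
  show ?thesis
    unfolding bfs_def using D(1-4,7,9) D(10,11) e qh t xs by auto
qed

text \<open>The edge was recorded when its other end \<open>v\<close> was scanned.\<close>

lemma bfs_skip:
  assumes B: "bfs rp Q qh xs (v # ys)" and qh: "qh < length Q" and v: "v \<in> set (take qh Q)"
  shows "bfs rp Q qh (xs @ [v]) ys"
proof -
  note D = bfsD[OF B]
  have "v \<in> set (adj ! (Q ! qh))" using D(5)[OF qh] by simp
  then have "{Q ! qh, v} \<in> edges G" using adj_set[OF bfs_nth_less[OF B qh]] by simp
  then have e: "edges_of rp = {e \<in> edges G. e \<inter> set (take qh Q) \<noteq> {}} \<union> (\<lambda>v. {Q ! qh, v}) ` set (xs @ [v])"
    unfolding D(8) using v by auto
  have "set (xs @ [v]) \<subseteq> set Q" using D(11) in_set_takeD[OF v] by simp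
  then show ?thesis
    unfolding bfs_def using D(1-5,7,9,10) e qh by simp
qed

lemma bfs_edge:
  assumes B: "bfs rp Q qh xs (v # ys)" and qh: "qh < length Q" and v: "v \<notin> set (take qh Q)"
  shows "bfs ((Q ! qh, v) # rp) (if v \<in> set Q then Q else Q @ [v]) qh (xs @ [v]) ys"
    "{Q ! qh, v} \<in> edges G"
proof -
  note D = bfsD[OF B]
  let ?u = "Q ! qh" and ?Q = "if v \<in> set Q then Q else Q @ [v]"
  have u: "?u < n" by (rule bfs_nth_less[OF B qh])
  have "v \<in> set (adj ! ?u)" using D(5)[OF qh] by simp
  then show uv: "{?u, v} \<in> edges G" using adj_set[OF u] by simp
  have "?u \<notin> set (take qh Q)"
    using D(1) qh by (auto simp: in_set_conv_nth nth_eq_iff_index_eq)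
  moreover have "v \<notin> set xs" using adj_distinct[OF u] D(5)[OF qh] by simp
  ultimately have new: "{?u, v} \<notin> edges_of rp"
    unfolding D(8) using v edge_ends[OF uv] by (auto simp: doubleton_eq_iff)
  have "built ((?u, v) # rp)"
    using D(7,9) new uv nth_mem[OF qh] by auto
  moreover have "edges_of ((?u, v) # rp) = {e \<in> edges G. e \<inter> set (take qh ?Q) \<noteq> {}} \<union> (\<lambda>w. {?Q ! qh, w}) ` set (xs @ [v])"
    unfolding edges_of_Cons D(8) using qh by (auto simp: nth_append)
  moreover have "\<forall>w \<in> set ?Q. w = 0 \<or> w \<in> \<Union>(edges_of ((?u, v) # rp))"
    using D(9) by (auto simp: edges_of_Cons)
  moreover have "distinct ?Q" "set ?Q \<subseteq> {..<n}" "0 \<in> set ?Q" "qh < length ?Q" "adj ! (?Q ! qh) = (xs @ [v]) @ ys"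
    "\<forall>v \<in> set (take qh ?Q). set (adj ! v) \<subseteq> set ?Q" "set (xs @ [v]) \<subseteq> set ?Q"
    using D(1-3,10,11) D(5)[OF qh] qh edge_ends[OF uv] by (auto simp: nth_append)
  ultimately show "bfs ((?u, v) # rp) ?Q qh (xs @ [v]) ys"
    unfolding bfs_def by simp
qed

text \<open>The queue is then closed under adjacency and contains 0, so by connectivity it holds all
  vertices, and every edge meets it.\<close>

lemma bfs_end:
  assumes B: "bfs rp Q qh xs ys" and qh: "qh = length Q"
  shows "edges_of rp = edges G" "length rp = m"
proof -
  note D = bfsD[OF B]
  have "v \<in> set Q" if "(0, v) \<in> {(x, y). {x, y} \<in> edges G}\<^sup>*" for v
    using that
  proof (induction rule: rtrancl_induct)
    case (step y z)
    then have "z \<in> set (adj ! y)" using adj_set[of y] edge_ends by auto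
    with step D(10) qh show ?case by auto
  qed (rule D(3))
  then have "{..<n} \<subseteq> set Q" using connected verts n_pos unfolding connected_graph_def by auto
  then have "e \<inter> set Q \<noteq> {}" if "e \<in> edges G" for e
    using edge_cases[OF that] by (metis disjoint_iff insertI1 lessThan_iff subsetD)
  then show "edges_of rp = edges G" using D(8) D(6)[OF qh] qh by auto
  then show "length rp = m" using built_edges[OF D(7)] edges by simp
qed

end

lemma segs_insert_front:
  assumes "\<And>w. w < n \<Longrightarrow> seg f w (out w) w"
    and "\<And>w. w < n \<Longrightarrow> distinct (out w)"
    and "\<And>w x. w < n \<Longrightarrow> x \<in> set (out w) \<Longrightarrow> n \<le> x \<and> x \<noteq> a"
    and "\<And>w w' x. w < n \<Longrightarrow> w' < n \<Longrightarrow> x \<in> set (out w) \<Longrightarrow> x \<in> set (out w') \<Longrightarrow> w = w'"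
    and "n \<le> a" "u < n" "w < n"
  shows "seg (insert_front u a f) w ((out(u := a # out u)) w) w"
proof (cases "w = u")
  case True
  have "u \<notin> set (out u)" "a \<notin> set (u # out u)" using assms(3)[of u u] assms(3)[of u a] assms(5,6) by auto
  then show ?thesis using True seg_insert_front[OF assms(1)[OF assms(6)] _ _ assms(2)[OF assms(6)]] by simp
next
  case False
  have h: "fst f u = hd (out u @ [u])" using seg_hd[OF assms(1)[OF assms(6)]] by simp
  have "hd (out u @ [u]) \<in> set (out u @ [u])" by (rule hd_in_set) simp
  then have h': "fst f u \<in> insert u (set (out u))" using h by simp
  have "x \<notin> insert u (set (out u)) \<and> x \<noteq> a" if "x \<in> insert w (set (out w))" for x
    using that False assms(3)[of u x] assms(3)[of w x] assms(4)[of u w x] assms(5,6,7)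
    by (metis insert_iff leD)
  then have "seg (insert_front u a f) w (out w) w"
    using h' by (intro seg_frame[OF assms(1)[OF assms(7)]]) (auto simp: insert_front_def)
  then show ?thesis using False by simp
qed

section \<open>Arc numbering and linked lists during the breadth-first search\<close>

context input_graph
begin

fun outl :: "(nat \<times> nat) list \<Rightarrow> nat \<Rightarrow> nat list" where
  "outl [] w = []"
| "outl ((u, v) # rp) w =
     (if w = u then [n + 2 * length rp] else if w = v then [n + 2 * length rp + 1] else []) @ outl rp w"

fun arrays :: "(nat \<times> nat) list \<Rightarrow> (nat \<Rightarrow> nat) \<Rightarrow> (nat \<Rightarrow> nat) \<Rightarrow> bool" where
  "arrays [] tg tw = True"
| "arrays ((u, v) # rp) tg tw \<longleftrightarrow> arrays rp tg tw \<and>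
     tg (n + 2 * length rp) = v \<and> tg (n + 2 * length rp + 1) = u \<and>
     tw (n + 2 * length rp) = n + 2 * length rp + 1 \<and> tw (n + 2 * length rp + 1) = n + 2 * length rp"

definition links :: "(nat \<times> nat) list \<Rightarrow> links \<Rightarrow> bool" where
  "links rp f \<longleftrightarrow> (\<forall>v < n. seg f v (outl rp v) v) \<and>
     (\<forall>x < n + 2 * length rp. fst f x < n + 2 * length rp \<and> snd f x < n + 2 * length rp)"

lemma arrays_upd: "arrays rp tg tw \<Longrightarrow> n + 2 * length rp \<le> x \<Longrightarrow>
    arrays rp (tg(x := y)) tw \<and> arrays rp tg (tw(x := y))"
  by (induction rp tg tw rule: arrays.induct) auto

lemma arrays_extend:
  assumes "arrays rp tg tw" "x = n + 2 * length rp"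
  shows "arrays ((u, v) # rp) (tg(x := v, Suc x := u)) (tw(x := Suc x, Suc x := x))"
proof -
  have "arrays rp (tg(x := v)) tw" using arrays_upd[OF assms(1), of x v] assms(2) by simp
  then have "arrays rp (tg(x := v, Suc x := u)) tw" using arrays_upd[of rp _ tw "Suc x" u] assms(2) by simp
  then have "arrays rp (tg(x := v, Suc x := u)) (tw(x := Suc x))"
    using arrays_upd[of rp _ tw x "Suc x"] assms(2) by simp
  then have "arrays rp (tg(x := v, Suc x := u)) (tw(x := Suc x, Suc x := x))"
    using arrays_upd[of rp _ _ "Suc x" x] assms(2) by simp
  then show ?thesis using assms(2) by simp
qed

lemma outl_range: "x \<in> set (outl rp w) \<Longrightarrow> n \<le> x \<and> x < n + 2 * length rp"
  by (induction rp w rule: outl.induct) (auto split: if_splits)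

lemma distinct_outl: "distinct (outl rp w)"
  by (induction rp w rule: outl.induct) (auto dest: outl_range)

lemma set_outl:
  assumes "built rp" "arrays rp tg tw"
  shows "x \<in> set (outl rp w) \<longleftrightarrow> n \<le> x \<and> x < n + 2 * length rp \<and> tg (tw x) = w"
  using assms
proof (induction rp rule: built.induct)
  case (2 u v rp)
  have uv: "u \<noteq> v" using 2 edge_ends[of u v] by auto
  consider "x = n + 2 * length rp" | "x = n + 2 * length rp + 1" | "x < n + 2 * length rp" | "n + 2 * length rp + 1 < x"
    by linarith
  then show ?case
    using 2 uv by cases (auto dest: outl_range)
qed simp

lemma links_extend:
  assumes "links rp f" "built rp" "arrays rp tg tw" "u < n" "v < n" "u \<noteq> v" "a = n + 2 * length rp"
  shows "links ((u, v) # rp) (insert_front v (Suc a) (insert_front u a f))"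
proof -
  let ?f = "insert_front u a f" and ?o = "(outl rp)(u := a # outl rp u)"
  have s: "\<And>w. w < n \<Longrightarrow> seg f w (outl rp w) w" using assms(1) by (simp add: links_def)
  have r: "n \<le> x" "x < a" if "x \<in> set (outl rp w)" for w x using outl_range[OF that] assms(7) by auto
  have dj: "w = w'" if "x \<in> set (outl rp w)" "x \<in> set (outl rp w')" for w w' x
    using that set_outl[OF assms(2,3)] by auto
  have 1: "seg ?f w (?o w) w" if "w < n" for w
  proof (rule segs_insert_front[OF s distinct_outl])
    show "n \<le> x \<and> x \<noteq> a" if "x \<in> set (outl rp w)" for w x using r[OF that] by simp
    show "w = w'" if "x \<in> set (outl rp w)" "x \<in> set (outl rp w')" for w w' x by (rule dj[OF that])
  qed (use that assms(4,7) in auto)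
  have 2: "seg (insert_front v (Suc a) ?f) w ((?o(v := Suc a # ?o v)) w) w" if "w < n" for w
  proof (rule segs_insert_front[OF 1])
    show "distinct (?o w)" for w using distinct_outl r[of a u] by auto
    show "n \<le> x \<and> x \<noteq> Suc a" if "x \<in> set (?o w)" for w x
      using that r[of x w] r[of x u] assms(7) by (cases "w = u") auto
    show "w = w'" if "x \<in> set (?o w)" "x \<in> set (?o w')" for w w' x
      using that dj[of x w w'] r[of x w] r[of x w'] by (cases "w = u"; cases "w' = u") auto
  qed (use that assms(5,7) in auto)
  have o: "(?o(v := Suc a # ?o v)) w = outl ((u, v) # rp) w" for w
    using assms(6,7) by auto
  have b: "\<forall>x < a. fst f x < a \<and> snd f x < a" using assms(1,7) by (simp add: links_def)
  have "fst (insert_front v (Suc a) ?f) x < a + 2 \<and> snd (insert_front v (Suc a) ?f) x < a + 2" if lt: "x < a + 2" for x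
  proof -
    have ua: "u < a" "v < a" using assms by auto
    consider "x < a" | "x = a" | "x = Suc a" using lt by linarith
    then show ?thesis
      by cases (use b ua in \<open>auto simp: insert_front_def less_SucI\<close>)
  qed
  then show ?thesis using 2 o assms(7) by (simp add: links_def)
qed

definition input_regs :: "(nat \<Rightarrow> nat) \<Rightarrow> bool" where
  "input_regs R \<longleftrightarrow> R rZero = 0 \<and> R rOne = 1 \<and> R rTwo = 2 \<and> R rThree = 3 \<and> R rN = n \<and> R rM = m \<and> R rK = k"

text \<open>The mark 2 separates finished vertices from queued ones; it is how the second end of an
  edge recognises the edge as recorded.\<close>

definition bfs_rep ::
  "(nat \<times> nat) list \<Rightarrow> nat list \<Rightarrow> nat \<Rightarrow> nat list \<Rightarrow> (nat \<Rightarrow> nat) \<Rightarrow> (nat \<Rightarrow> nat \<Rightarrow> nat) \<Rightarrow> bool" where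
  "bfs_rep rp Q qh xs R A \<longleftrightarrow> input_regs R \<and> R rHd = qh \<and> R rTl = length Q \<and> R rCnt = n + 2 * length rp \<and>
     holds (A aQ) Q \<and> A aIn = input \<and> arrays rp (A aTg) (A aTw) \<and> links rp (A aNx, A aPv) \<and>
     (\<forall>v < n. A aFl v = (if v \<in> set (take qh Q) then 2 else if v \<in> set Q then 1 else 0)) \<and>
     (\<forall>a \<ge> n. A aFl a = 0) \<and>
     (qh < length Q \<longrightarrow> R rV = Q ! qh \<and> R rP = offset (Q ! qh) + length xs \<and> R rRes = offset (Suc (Q ! qh)))"

lemma wp_insert_code:
  assumes "v < 40" "a < 40" "R v < M" "R a < M" "A aNx (R v) < M"
    and Q: "\<And>R'. (\<And>r. r < 40 \<Longrightarrow> R' r = R r) \<Longrightarrow>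
      Qp (R', A(aNx := fst (insert_front (R v) (R a) (A aNx, A aPv)),
        aPv := snd (insert_front (R v) (R a) (A aNx, A aPv))), Y, 15 + T)"
  shows "wp M W (insert_code v a) Qp (R, A, Y, T)"
proof -
  have "Qp (R(41 := A aNx (R v)), A(aNx := fst (insert_front (R v) (R a) (A aNx, A aPv)),
        aPv := snd (insert_front (R v) (R a) (A aNx, A aPv))), Y, 15 + T)"
    by (rule Q) auto
  then show ?thesis using assms by (simp add: insert_code_def insert_front_def fun_upd_twist)
qed

lemma wp_range_code:
  assumes "R rV = v" "v < n" "R rThree = 3" "R rOne = 1" "A aIn = input"
    and Q: "Qp (R(rF := Suc (3 + v), rP := offset v, rRes := offset (Suc v)), A, Y, 12 + T)"
  shows "wp M W range_code Qp (R, A, Y, T)"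
proof -
  have "input (3 + v) = offset v" "input (3 + Suc v) = offset (Suc v)"
    using assms(2) input_offset[of v] input_offset[of "Suc v"] by auto
  then have "input (v + 3) = offset v" "input (Suc (v + 3)) = offset (Suc v)"
    by (simp_all add: add.commute)
  moreover have "v + 3 < M" "Suc (v + 3) < M" "v + 3 < W" "Suc (v + 3) < W"
    using assms(2) M_def W_large by auto
  ultimately show ?thesis using assms by (simp add: range_code_def fun_upd_twist add.commute)
qed

text \<open>Finished vertices plus adjacency entries read. Each step raises it, and the handshake
  identity bounds it by \<open>n + 2 * m\<close>, which makes the construction linear.\<close>

definition progress :: "nat list \<Rightarrow> nat \<Rightarrow> nat list \<Rightarrow> nat" where
  "progress Q qh xs = qh + (\<Sum>v \<in> set (take qh Q). length (adj ! v)) + length xs"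

lemma progress_bound:
  assumes B: "bfs rp Q qh xs ys"
  shows "progress Q qh xs \<le> n + 2 * m" "qh < length Q \<Longrightarrow> progress Q qh xs < n + 2 * m"
proof -
  note D = bfsD[OF B]
  have qn: "length Q \<le> n" by (rule bfs_length[OF B])
  { assume qh: "qh < length Q"
    have "Q ! qh \<notin> set (take qh Q)" using D(1) qh by (auto simp: in_set_conv_nth nth_eq_iff_index_eq)
    then have "(\<Sum>v \<in> set (take qh Q). length (adj ! v)) + length (adj ! (Q ! qh)) =
        (\<Sum>v \<in> insert (Q ! qh) (set (take qh Q)). length (adj ! v))" by simp
    also have "\<dots> \<le> (\<Sum>v<n. length (adj ! v))"
      using bfs_nth_less[OF B qh] D(2) set_take_subset[of qh Q] by (intro sum_mono2) auto
    finally show "progress Q qh xs < n + 2 * m"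
      using D(5)[OF qh] qh qn sum_degrees by (simp add: progress_def) }
  note lt = this
  have "(\<Sum>v \<in> set (take qh Q). length (adj ! v)) \<le> (\<Sum>v<n. length (adj ! v))"
    using D(2) set_take_subset[of qh Q] by (intro sum_mono2) auto
  then show "progress Q qh xs \<le> n + 2 * m"
    using D(4,6) qn sum_degrees lt by (cases "qh = length Q") (auto simp: progress_def)
qed

definition bfs_inv :: "nat list \<Rightarrow> nat \<Rightarrow> nat \<Rightarrow> state \<Rightarrow> bool" where
  "bfs_inv Y0 T0 i = (\<lambda>(R, A, Y, T). Y = Y0 \<and> T \<le> T0 + 100 * i \<and>
     (\<exists>rp Q qh xs ys. bfs rp Q qh xs ys \<and> bfs_rep rp Q qh xs R A \<and> i \<le> progress Q qh xs))"

lemma wp_edge_code: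
  assumes B: "bfs rp Q qh xs (v # ys)" and qh: "qh < length Q" and v: "v \<notin> set (take qh Q)"
    and rep: "bfs_rep rp Q qh xs R A"
    and R': "\<And>r. r \<noteq> rA \<Longrightarrow> r \<noteq> rF \<Longrightarrow> r \<noteq> rP \<Longrightarrow> R1 r = R r" "R1 rA = v" "R1 rF = A aFl v" "R1 rP = Suc (R rP)"
    and Q: "\<And>R' A' T'. bfs_rep ((Q ! qh, v) # rp) (if v \<in> set Q then Q else Q @ [v]) qh (xs @ [v]) R' A' \<Longrightarrow>
      T' \<le> T + 63 \<Longrightarrow> Qp (R', A', Y, T')"
  shows "wp M W edge_code Qp (R1, A, Y, T)"
proof -
  note D = bfsD[OF B]
  let ?u = "Q ! qh" and ?a = "n + 2 * length rp"
  note E = bfs_edge[OF B qh v]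
  have ends: "?u < n" "v < n" "?u \<noteq> v" using edge_ends[OF E(2)] by auto
  have "length ((?u, v) # rp) \<le> m" by (rule built_length[OF bfsD(7)[OF E(1)]])
  then have a: "?a + 1 < n + 2 * m" "?a < M" "Suc ?a < M" "Suc ?a < W" "Suc (Suc ?a) < W" "?u < M" "v < M"
    using M_def W_large ends by auto
  have r: "R rZero = 0" "R rOne = 1" "R rTl = length Q" "R rCnt = ?a" "R rV = ?u" "holds (A aQ) Q"
    "arrays rp (A aTg) (A aTw)" "links rp (A aNx, A aPv)" "A aFl v = (if v \<in> set Q then 1 else 0)"
    using rep qh v ends by (auto simp: bfs_rep_def input_regs_def)
  have lq: "length Q < M" "Suc (length Q) < W" using bfs_length[OF B] M_def W_large by auto
  have nx: "A aNx x < ?a" "A aPv x < ?a" if "x < ?a" for x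
    using r(8) that by (auto simp: links_def)
  let ?f1 = "insert_front ?u ?a (A aNx, A aPv)"
  let ?f2 = "insert_front v (Suc ?a) ?f1"
  have nx1: "A aNx ?u < M" using nx[of ?u] ends a by simp
  have nx2: "fst ?f1 v < M" using nx[of v] ends a by (auto simp: insert_front_def)
  have lk: "links ((?u, v) # rp) ?f2"
    by (rule links_extend[OF r(8) D(7) r(7) ends refl])
  have ar: "arrays ((?u, v) # rp) ((A aTg)(?a := v, Suc ?a := ?u)) ((A aTw)(?a := Suc ?a, Suc ?a := ?a))"
    by (rule arrays_extend[OF r(7) refl])
  let ?Q = "if v \<in> set Q then Q else Q @ [v]"
  have main: "wp M W arcs_code Qp (R2, A2, Y, T2)"
    if R2: "\<And>r. r \<noteq> rA \<Longrightarrow> r \<noteq> rF \<Longrightarrow> r \<noteq> rP \<Longrightarrow> r \<noteq> rTl \<Longrightarrow> R2 r = R r" "R2 rA = v" "R2 rP = Suc (R rP)" "R2 rTl = length ?Q"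
      and A2: "\<And>x. x \<noteq> aFl \<Longrightarrow> x \<noteq> aQ \<Longrightarrow> A2 x = A x" "holds (A2 aQ) ?Q"
        "A2 aFl = (if v \<in> set Q then A aFl else (A aFl)(v := 1))" and T2: "T2 \<le> T + 12" for R2 A2 T2
  proof -
    have "wp M W (insert_code rV rCnt ;; insert_code rA rB ;; CAdd rCnt rB rOne) Qp
      (R2(rB := Suc ?a), A2(aTg := (A aTg)(?a := v, Suc ?a := ?u), aTw := (A aTw)(?a := Suc ?a, Suc ?a := ?a)), Y, 15 + T2)"
      (is "wp M W _ Qp (?R3, ?A3, Y, _)")
      unfolding wp_Seq
    proof (rule wp_insert_code)
      fix R4 assume "\<And>r. r < 40 \<Longrightarrow> R4 r = ?R3 r"
      then have R4: "\<And>r. r < 40 \<Longrightarrow> R4 r = (if r = rB then Suc ?a else R2 r)" by auto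
      let ?A4 = "?A3(aNx := fst ?f1, aPv := snd ?f1)"
      have "wp M W (insert_code rA rB) (wp M W (CAdd rCnt rB rOne) Qp) (R4, ?A4, Y, 15 + (15 + T2))"
      proof (rule wp_insert_code)
        fix R5 assume "\<And>r. r < 40 \<Longrightarrow> R5 r = R4 r"
        then have R5: "\<And>r. r < 40 \<Longrightarrow> R5 r = (if r = rB then Suc ?a else R2 r)" using R4 by simp
        let ?A5 = "?A4(aNx := fst ?f2, aPv := snd ?f2)"
        have "bfs_rep ((?u, v) # rp) ?Q qh (xs @ [v]) (R5(rCnt := Suc (Suc ?a))) ?A5"
          using rep lk ar R5 R2 A2 qh ends v
          by (auto simp: bfs_rep_def input_regs_def nth_append)
        then have "Qp (R5(rCnt := Suc (Suc ?a)), ?A5, Y, 48 + T2)" by (rule Q) (use T2 in simp)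
        then show "wp M W (CAdd rCnt rB rOne) Qp (R5, ?A4(aNx := fst (insert_front (R4 rA) (R4 rB) (?A4 aNx, ?A4 aPv)),
           aPv := snd (insert_front (R4 rA) (R4 rB) (?A4 aNx, ?A4 aPv))), Y, 15 + (15 + (15 + T2)))"
          using R5 R4 R2 r a by simp
      qed (use R4 R2 a nx2 in auto)
      then show "wp M W (insert_code rA rB) (wp M W (CAdd rCnt rB rOne) Qp) (R4, ?A3(aNx := fst (insert_front (?R3 rV) (?R3 rCnt) (?A3 aNx, ?A3 aPv)),
           aPv := snd (insert_front (?R3 rV) (?R3 rCnt) (?A3 aNx, ?A3 aPv))), Y, 15 + (15 + T2))"
        using R2 A2 r by simp
    qed (use R2 A2 r a nx1 in auto)
    then show ?thesis using R2 A2 r a by (simp add: arcs_code_def)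
  qed
  show ?thesis
  proof (cases "v \<in> set Q")
    case True
    then show ?thesis
      unfolding edge_code_def using r R' by simp (rule main, auto simp: r R')
  next
    case False
    then show ?thesis
      unfolding edge_code_def using r R' a lq by simp (rule main, auto simp: r R')
  qed
qed

end

context input_graph
begin

lemma wp_bfs_step:
  assumes I: "bfs_inv Y0 T0 i (R, A, Y, T)" and lt: "R rHd < R rTl"
  shows "wp M W bfs_step (bfs_inv Y0 T0 (Suc i)) (R, A, Y, 3 + T)"
proof -
  obtain rp Q qh xs ys where B: "bfs rp Q qh xs ys" and rep: "bfs_rep rp Q qh xs R A"
    and i: "i \<le> progress Q qh xs" and Y: "Y = Y0" and T: "T \<le> T0 + 100 * i"
    using I unfolding bfs_inv_def by auto
  note D = bfsD[OF B]
  have qh: "qh < length Q" using lt rep by (simp add: bfs_rep_def)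
  let ?u = "Q ! qh"
  have u: "?u < n" by (rule bfs_nth_less[OF B qh])
  have r: "R rZero = 0" "R rOne = 1" "R rTwo = 2" "R rThree = 3" "R rHd = qh" "R rTl = length Q" "R rV = ?u"
    "R rP = offset ?u + length xs" "R rRes = offset (Suc ?u)" "A aIn = input" "holds (A aQ) Q"
    using rep qh by (auto simp: bfs_rep_def input_regs_def)
  have off: "offset (Suc ?u) = offset ?u + length xs + length ys"
    using offset_Suc[OF u] D(5)[OF qh] by simp
  have b: "qh < M" "Suc qh < M" "Suc qh < W" "?u < M"
    using qh bfs_length[OF B] M_def W_large u by auto
  have cont: "bfs_inv Y0 T0 (Suc i) (R', A', Y, T')"
    if "bfs rp' Q' qh' xs' ys'" "bfs_rep rp' Q' qh' xs' R' A'" "progress Q qh xs < progress Q' qh' xs'" "T' \<le> T + 100"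
    for rp' Q' qh' xs' ys' R' A' T'
    using that i Y T unfolding bfs_inv_def by fastforce
  show ?thesis
  proof (cases ys)
    case Nil
    note N = bfs_next[OF B[unfolded Nil] qh]
    have unq: "?u \<notin> set (take qh Q)" using D(1) qh by (auto simp: in_set_conv_nth nth_eq_iff_index_eq)
    have t: "set (take (Suc qh) Q) = insert ?u (set (take qh Q))"
      using qh by (simp add: take_Suc_conv_app_nth)
    have prog: "progress Q qh xs < progress Q (Suc qh) []"
      using unq D(5)[OF qh] Nil unfolding progress_def t by simp
    let ?A = "A(aFl := (A aFl)(?u := 2))"
    have uQ: "?u \<in> set Q" using qh by simp
    have fl: "\<forall>v < n. ?A aFl v = (if v \<in> set (take (Suc qh) Q) then 2 else if v \<in> set Q then 1 else 0)"
      using rep uQ unfolding t by (auto simp: bfs_rep_def)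
    have fl': "\<forall>a \<ge> n. ?A aFl a = 0" using rep u by (auto simp: bfs_rep_def)
    show ?thesis
    proof (cases "length Q \<le> Suc qh")
      case True
      have "bfs_rep rp Q (Suc qh) [] (R(rHd := Suc qh)) ?A"
        using rep fl fl' True unfolding bfs_rep_def input_regs_def by simp
      then have "bfs_inv Y0 T0 (Suc i) (R(rHd := Suc qh), ?A, Y, 15 + T)"
        by (rule cont[OF N _ prog]) simp
      then show ?thesis using r b off Nil True by (simp add: bfs_step_def)
    next
      case False
      let ?v = "Q ! Suc qh"
      have v: "?v < n" using bfs_nth_less[OF B] False by simp
      have Av: "A aQ (Suc qh) = ?v" using holds_nth[OF r(11)] False by simp
      have "bfs_rep rp Q (Suc qh) [] (R(rHd := Suc qh, rV := ?v, rF := Suc (3 + ?v), rP := offset ?v, rRes := offset (Suc ?v))) ?A"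
        using rep fl fl' unfolding bfs_rep_def input_regs_def by simp
      then have 1: "bfs_inv Y0 T0 (Suc i) (R(rHd := Suc qh, rV := ?v, rF := Suc (3 + ?v), rP := offset ?v, rRes := offset (Suc ?v)), ?A, Y, 30 + T)"
        by (rule cont[OF N _ prog]) simp
      have "wp M W range_code (bfs_inv Y0 T0 (Suc i)) (R(rHd := Suc qh, rV := ?v), ?A, Y, 18 + T)"
        by (rule wp_range_code[where v = ?v]) (use r v 1 in auto)
      then show ?thesis using r b off Nil False Av by (simp add: bfs_step_def)
    qed
  next
    case (Cons v ys')
    have "adj ! ?u = xs @ v # ys'" using D(5)[OF qh] Cons by simp
    then have inp: "input (offset ?u + length xs) = v" "offset ?u + length xs < M"
      using input_adj[OF u, of "length xs"] by (auto simp: nth_append)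
    have "v \<in> set (adj ! ?u)" using D(5)[OF qh] Cons by simp
    then have v: "v < n" using adj_set[OF u] edge_ends[of ?u v] by simp
    then have vM: "v < M" using M_def by simp
    have fl: "A aFl v = (if v \<in> set (take qh Q) then 2 else if v \<in> set Q then 1 else 0)"
      using rep v by (simp add: bfs_rep_def)
    have pW: "Suc (offset ?u + length xs) < W" using inp(2) W_large by simp
    let ?R = "R(rA := v, rP := Suc (offset ?u + length xs), rF := A aFl v)"
    show ?thesis
    proof (cases "v \<in> set (take qh Q)")
      case True
      note S = bfs_skip[OF B[unfolded Cons] qh True]
      have "bfs_rep rp Q qh (xs @ [v]) ?R A"
        using rep r unfolding bfs_rep_def input_regs_def by simp
      then have "bfs_inv Y0 T0 (Suc i) (?R, A, Y, 18 + T)"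
        by (rule cont[OF S]) (simp_all add: progress_def)
      then show ?thesis using r b off Cons True inp fl v vM pW by (simp add: bfs_step_def)
    next
      case False
      note X = bfs_edge(1)[OF B[unfolded Cons] qh False]
      have tk: "take qh (if v \<in> set Q then Q else Q @ [v]) = take qh Q" using qh by simp
      have prog: "progress Q qh xs < progress (if v \<in> set Q then Q else Q @ [v]) qh (xs @ [v])"
        unfolding progress_def tk by simp
      have "wp M W edge_code (bfs_inv Y0 T0 (Suc i)) (?R, A, Y, 18 + T)"
        by (rule wp_edge_code[OF B[unfolded Cons] qh False rep])
          (use r cont[OF X _ prog] in auto)
      then show ?thesis using r b off Cons False inp fl v vM pW
        by (auto simp: bfs_step_def split: if_splits)
    qed
  qed
qed

lemma wp_sentinel_code:
  assumes "input_regs R" "A aNx = (\<lambda>_. 0)" "A aPv = (\<lambda>_. 0)"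
    and Q: "\<And>R' A' T'. input_regs R' \<Longrightarrow> (\<And>a. a \<noteq> aNx \<Longrightarrow> a \<noteq> aPv \<Longrightarrow> A' a = A a) \<Longrightarrow>
      links [] (A' aNx, A' aPv) \<Longrightarrow> T' \<le> T + 12 * n + 6 \<Longrightarrow> Qp (R', A', Y, T')"
  shows "wp M W sentinel_code Qp (R, A, Y, T)"
proof -
  define I where "I = (\<lambda>i (R', A', Y', T'). input_regs R' \<and> R' rV = i \<and> i \<le> n \<and>
    (\<forall>a. a \<noteq> aNx \<longrightarrow> a \<noteq> aPv \<longrightarrow> A' a = A a) \<and> (\<forall>v < i. A' aNx v = v \<and> A' aPv v = v) \<and>
    Y' = Y \<and> T' \<le> T + 3 + 12 * i)"
  have "wp M W (CWhile rV rN (CStore aNx rV rV ;; CStore aPv rV rV ;; CAdd rV rV rOne)) Qp (R(rV := 0), A, Y, 3 + T)"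
  proof (rule wp_While[where I = I and B = n])
    show "I 0 (R(rV := 0), A, Y, 3 + T)" using assms(1) by (auto simp: I_def input_regs_def)
  next
    fix i R' A' Y' T' assume I: "I i (R', A', Y', T')" and "R' rV < R' rN"
    then have i: "i < n" "R' rV = i" "R' rOne = 1" by (auto simp: I_def input_regs_def)
    have b: "i < M" "Suc i < W" using i M_def W_large by auto
    show "wp M W (CStore aNx rV rV ;; CStore aPv rV rV ;; CAdd rV rV rOne) (I (Suc i)) (R', A', Y', 3 + T')"
      using I i b by (auto simp: I_def input_regs_def less_Suc_eq)
  next
    fix i R' A' Y' T' assume "I i (R', A', Y', T')" "R' rV < R' rN"
    then show "i < n" by (auto simp: I_def input_regs_def)
  next
    fix i R' A' Y' T' assume I: "I i (R', A', Y', T')" and "\<not> R' rV < R' rN"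
    then have i: "i = n" by (auto simp: I_def input_regs_def)
    have "Qp (R', A', Y, 3 + T')"
      by (rule Q) (use I i in \<open>auto simp: I_def links_def\<close>)
    then show "Qp (R', A', Y', 3 + T')" using I by (auto simp: I_def)
  qed
  then show ?thesis by (simp add: sentinel_code_def)
qed

lemma wp_unmark_code:
  assumes "input_regs R" "\<forall>a \<ge> n. A aFl a = 0"
    and Q: "\<And>R' A' T'. input_regs R' \<Longrightarrow> R' rCnt = R rCnt \<Longrightarrow> (\<And>a. a \<noteq> aFl \<Longrightarrow> A' a = A a) \<Longrightarrow>
      (\<forall>x. A' aFl x = 0) \<Longrightarrow> T' \<le> T + 9 * n + 6 \<Longrightarrow> Qp (R', A', Y, T')"
  shows "wp M W unmark_code Qp (R, A, Y, T)"
proof -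
  define I where "I = (\<lambda>i (R', A', Y', T'). input_regs R' \<and> R' rV = i \<and> R' rCnt = R rCnt \<and> i \<le> n \<and>
    (\<forall>a. a \<noteq> aFl \<longrightarrow> A' a = A a) \<and> (\<forall>v. v < i \<or> n \<le> v \<longrightarrow> A' aFl v = 0) \<and>
    Y' = Y \<and> T' \<le> T + 3 + 9 * i)"
  have "wp M W (CWhile rV rN (CStore aFl rV rZero ;; CAdd rV rV rOne)) Qp (R(rV := 0), A, Y, 3 + T)"
  proof (rule wp_While[where I = I and B = n])
    show "I 0 (R(rV := 0), A, Y, 3 + T)" using assms(1,2) by (auto simp: I_def input_regs_def)
  next
    fix i R' A' Y' T' assume I: "I i (R', A', Y', T')" and "R' rV < R' rN"
    then have i: "i < n" "R' rV = i" "R' rOne = 1" by (auto simp: I_def input_regs_def)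
    have b: "i < M" "Suc i < W" using i M_def W_large by auto
    show "wp M W (CStore aFl rV rZero ;; CAdd rV rV rOne) (I (Suc i)) (R', A', Y', 3 + T')"
      using I i b by (auto simp: I_def input_regs_def less_Suc_eq)
  next
    fix i R' A' Y' T' assume "I i (R', A', Y', T')" "R' rV < R' rN"
    then show "i < n" by (auto simp: I_def input_regs_def)
  next
    fix i R' A' Y' T' assume I: "I i (R', A', Y', T')" and "\<not> R' rV < R' rN"
    then have i: "i = n" by (auto simp: I_def input_regs_def)
    have fl: "\<forall>x. A' aFl x = 0" using I i by (auto simp: I_def)
    have "Qp (R', A', Y, 3 + T')"
      by (rule Q) (use I i fl in \<open>auto simp: I_def\<close>)
    then show "Qp (R', A', Y', 3 + T')" using I by (auto simp: I_def)
  qed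
  then show ?thesis by (simp add: unmark_code_def)
qed

definition built_rep :: "(nat \<times> nat) list \<Rightarrow> (nat \<Rightarrow> nat) \<Rightarrow> (nat \<Rightarrow> nat \<Rightarrow> nat) \<Rightarrow> bool" where
  "built_rep rp R A \<longleftrightarrow> built rp \<and> edges_of rp = edges G \<and> length rp = m \<and> arrays rp (A aTg) (A aTw) \<and>
     links rp (A aNx, A aPv) \<and> (\<forall>x. A aFl x = 0) \<and> input_regs R \<and> R rCnt = n + 2 * m"

text \<open>Here \<open>121 * n\<close> is \<open>100 * n\<close> for the search,
  \<open>12 * n\<close> for the sentinels and \<open>9 * n\<close> for removing the marks;
  \<open>200 * m\<close> is \<open>100\<close> per adjacency entry.\<close>

lemma wp_build_code:
  assumes "input_regs R" "A aIn = input" "\<And>a. a \<noteq> aIn \<Longrightarrow> A a = (\<lambda>_. 0)"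
    and Q: "\<And>rp R' A' T'. built_rep rp R' A' \<Longrightarrow> T' \<le> T + 121 * n + 200 * m + 60 \<Longrightarrow> Qp (R', A', Y, T')"
  shows "wp M W build_code Qp (R, A, Y, T)"
  unfolding build_code_def wp_Seq[of _ _ sentinel_code]
proof (rule wp_sentinel_code[OF assms(1)])
  fix R1 A1 T1 assume 1: "input_regs R1" "\<And>a. a \<noteq> aNx \<Longrightarrow> a \<noteq> aPv \<Longrightarrow> A1 a = A a" "links [] (A1 aNx, A1 aPv)"
    "T1 \<le> T + 12 * n + 6"
  have r1: "R1 rZero = 0" "R1 rOne = 1" "R1 rThree = 3" "R1 rN = n" using 1(1) by (auto simp: input_regs_def)
  let ?A2 = "A1(aQ := (A1 aQ)(0 := 0), aFl := (A1 aFl)(0 := 1))"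
  let ?R2 = "R1(rHd := 0, rTl := 1, rCnt := n, rV := 0)"
  have z: "A1 aQ = (\<lambda>_. 0)" "A1 aFl = (\<lambda>_. 0)" "A1 aIn = input" using 1(2) assms(2,3) by auto
  have M0: "0 < M" using M_def by simp
  have "wp M W range_code (wp M W (CWhile rHd rTl bfs_step ;; unmark_code) Qp) (?R2, ?A2, Y, 18 + T1)"
  proof (rule wp_range_code[where v = 0])
    let ?R3 = "?R2(rF := Suc (3 + 0), rP := offset 0, rRes := offset (Suc 0))"
    show "wp M W (CWhile rHd rTl bfs_step ;; unmark_code) Qp (?R3, ?A2, Y, 12 + (18 + T1))"
      unfolding wp_Seq
    proof (rule wp_While[where I = "bfs_inv Y (30 + T1)" and B = "n + 2 * m"])
      have "bfs_rep [] [0] 0 [] ?R3 ?A2"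
        using 1(1,3) z n_pos by (auto simp: bfs_rep_def input_regs_def holds_def)
      then show "bfs_inv Y (30 + T1) 0 (?R3, ?A2, Y, 12 + (18 + T1))"
        unfolding bfs_inv_def using bfs_init by fastforce
    next
      fix i R A Y' T' assume "bfs_inv Y (30 + T1) i (R, A, Y', T')" "R rHd < R rTl"
      then show "wp M W bfs_step (bfs_inv Y (30 + T1) (Suc i)) (R, A, Y', 3 + T')" by (rule wp_bfs_step)
    next
      fix i R A Y' T' assume I: "bfs_inv Y (30 + T1) i (R, A, Y', T')" and lt: "R rHd < R rTl"
      then obtain rp Q qh xs ys where B: "bfs rp Q qh xs ys" "bfs_rep rp Q qh xs R A" "i \<le> progress Q qh xs"
        unfolding bfs_inv_def by auto
      then show "i < n + 2 * m" using progress_bound(2)[OF B(1)] lt by (simp add: bfs_rep_def)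
    next
      fix i R A Y' T' assume I: "bfs_inv Y (30 + T1) i (R, A, Y', T')" and lt: "\<not> R rHd < R rTl"
      then obtain rp Q qh xs ys where B: "bfs rp Q qh xs ys" "bfs_rep rp Q qh xs R A" "i \<le> progress Q qh xs"
        and Y': "Y' = Y" "T' \<le> 30 + T1 + 100 * i"
        unfolding bfs_inv_def by auto
      have qh: "qh = length Q" using lt B(2) bfsD(4)[OF B(1)] by (simp add: bfs_rep_def)
      note E = bfs_end[OF B(1) qh]
      have i: "i \<le> n + 2 * m" using progress_bound(1)[OF B(1)] B(3) by simp
      have rep: "input_regs R" "\<forall>a \<ge> n. A aFl a = 0" using B(2) by (auto simp: bfs_rep_def)
      show "wp M W unmark_code Qp (R, A, Y', 3 + T')"
        unfolding Y'(1)
      proof (rule wp_unmark_code[where R = R and A = A, OF rep])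
        fix R5 A5 T5 assume 5: "input_regs R5" "R5 rCnt = R rCnt" "\<And>a. a \<noteq> aFl \<Longrightarrow> A5 a = A a"
          "\<forall>x. A5 aFl x = 0" "T5 \<le> 3 + T' + 9 * n + 6"
        have "built_rep rp R5 A5"
          using 5 B(2) E bfsD(7)[OF B(1)] by (auto simp: built_rep_def bfs_rep_def)
        then show "Qp (R5, A5, Y, T5)" by (rule Q) (use 5(5) Y'(2) i 1(4) in simp)
      qed
    qed
  qed (use r1 z n_pos in auto)
  then show "wp M W (CStore aQ rZero rZero ;; CStore aFl rZero rOne ;; CConst rHd 0 ;; CConst rTl 1 ;;
     CSub rCnt rN rZero ;; CConst rV 0 ;; range_code ;; CWhile rHd rTl bfs_step ;; unmark_code) Qp (R1, A1, Y, T1)"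
    using r1 M0 by (simp add: fun_upd_twist)
qed (use assms(3) in auto)

end

section \<open>The initial decision stack\<close>

locale ordered_graph = machine_graph +
  assumes tw_even: "j < m \<Longrightarrow> tw (n + 2 * j) = Suc (n + 2 * j)"
    and prefix_rooted: "j \<le> m \<Longrightarrow> rooted 0 {n..<n + 2 * j}"
begin

text \<open>The head of a stack is its latest decision, so the edges count as excluded from number
  \<open>m - 1\<close> downwards.\<close>

definition tail_stack :: "nat \<Rightarrow> (nat \<times> bool) list" where
  "tail_stack l = map (\<lambda>j. (n + 2 * j, False)) [l..<m]"

lemma tail_stack_end [simp]: "tail_stack m = []"
  by (simp add: tail_stack_def)

lemma tail_stack_Cons: "l < m \<Longrightarrow> tail_stack l = (n + 2 * l, False) # tail_stack (Suc l)"
  by (simp add: tail_stack_def upt_conv_Cons)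

lemma length_tail_stack: "length (tail_stack l) = m - l"
  by (simp add: tail_stack_def)

lemma included_tail: "included (tail_stack l) = []"
  by (simp add: tail_stack_def included_def)

lemma exc_tail: "l \<le> m \<Longrightarrow> exc (tail_stack l) = {n + 2 * l..<n + 2 * m}"
proof (induction l rule: inc_induct)
  case (step l)
  have "{n + 2 * l..<n + 2 * m} = {n + 2 * Suc l..<n + 2 * m} \<union> {n + 2 * l, Suc (n + 2 * l)}"
    using step(2) by auto
  then show ?case using step by (simp add: tail_stack_Cons tw_even)
qed simp

lemma arc_even: "j < m \<Longrightarrow> n + 2 * j \<in> arcs" "j < m \<Longrightarrow> Suc (n + 2 * j) \<in> arcs"
  by (auto simp: arcs_def)

lemma prefix_symm: "j \<le> m \<Longrightarrow> symm {n..<n + 2 * j}"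
proof (induction j)
  case (Suc j)
  have "{n..<n + 2 * Suc j} = {n..<n + 2 * j} \<union> {n + 2 * j, tw (n + 2 * j)}"
    using Suc.prems by (auto simp: tw_even)
  then show ?case using Suc symm_Un[OF _ symm_pair[OF arc_even(1)], of "{n..<n + 2 * j}" j] by simp
qed simp

text \<open>The alternative of entry \<open>l\<close> lives in the prefix of \<open>l + 1\<close>
  edges, all later ones being excluded. The prefix is connected and has at least \<open>k\<close>
  edges, so it is the whole component and large enough.\<close>

lemma valid_tail:
  assumes "l \<le> m" "k \<le> Suc l"
  shows "valid (tail_stack l)"
  using assms
proof (induction l rule: inc_induct)
  case (step l)
  let ?a = "n + 2 * l" and ?P = "{n..<n + 2 * Suc l}"
  have l: "l < m" "Suc l \<le> m" using step by auto
  have a: "?a \<in> arcs" "tw ?a = Suc ?a" using l arc_even tw_even by auto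
  have exc: "exc (tail_stack (Suc l)) = {n + 2 * Suc l..<n + 2 * m}" by (rule exc_tail[OF l(2)])
  have inc: "inc (tail_stack (Suc l)) = {}" by (simp add: included_tail)
  have diff: "arcs - exc (tail_stack (Suc l)) = ?P" unfolding exc using l by (auto simp: arcs_def)
  have conn: "conn ?P" by (rule rooted_conn[OF prefix_symm[OF l(2)] prefix_rooted[OF l(2)]])
  have root: "root ((?a, True) # tail_stack (Suc l)) = src ?a" by (simp add: root_def included_tail)
  have aP: "?a \<in> ?P" by simp
  have "component ?P (src ?a) = ?P" using conn aP unfolding conn_def component_def by auto
  moreover have "card ?P = 2 * Suc l" by simp
  moreover have "rooted (src ?a) {?a, tw ?a}"
    using rooted_insert[of "src ?a" "{}" ?a] a by (auto simp: rooted_def)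
  moreover have "card {?a, tw ?a} \<le> 2 * k" using a k_pos by simp
  ultimately have "good ((?a, True) # tail_stack (Suc l))"
    unfolding good_def root using diff step.prems by (simp add: included_tail insert_commute)
  moreover have "?a \<notin> exc (tail_stack (Suc l))" unfolding exc by simp
  ultimately show ?case
    using step a inc by (simp add: tail_stack_Cons[OF l(1)])
qed simp

text \<open>A solution is filed under its edge of highest number: that entry includes the edge and
  keeps the later ones excluded.\<close>

lemma pending_tail:
  "l \<le> m \<Longrightarrow> pending (tail_stack l) = {F \<in> sols {} {}. F \<inter> {n + 2 * l..<n + 2 * m} \<noteq> {}}"
proof (induction l rule: inc_induct)
  case (step l)
  let ?a = "n + 2 * l"
  have l: "l < m" using step by auto
  have a: "tw ?a = Suc ?a" "?a \<in> arcs" using l tw_even arc_even by auto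
  have u: "{?a..<n + 2 * m} = {n + 2 * Suc l..<n + 2 * m} \<union> {?a, Suc ?a}" using l by auto
  have F: "?a \<in> F \<longleftrightarrow> Suc ?a \<in> F" if "F \<in> sols {} {}" for F
    using that a symm_tw_iff[of F ?a] by (simp add: sols_def)
  have "sols (inc ((?a, True) # tail_stack (Suc l))) (exc (tail_stack (Suc l))) =
     {F \<in> sols {} {}. {?a, Suc ?a} \<subseteq> F \<and> F \<inter> {n + 2 * Suc l..<n + 2 * m} = {}}"
    using l a by (auto simp: sols_def included_tail exc_tail)
  then have "pending (tail_stack l) = {F \<in> sols {} {}. {?a, Suc ?a} \<subseteq> F \<and> F \<inter> {n + 2 * Suc l..<n + 2 * m} = {}} \<union>
     {F \<in> sols {} {}. F \<inter> {n + 2 * Suc l..<n + 2 * m} \<noteq> {}}"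
    using step by (simp add: tail_stack_Cons[OF l])
  also have "\<dots> = {F \<in> sols {} {}. F \<inter> {?a..<n + 2 * m} \<noteq> {}}"
    unfolding u using F by blast
  finally show ?case .
qed simp

lemma pending_all: "pending (tail_stack (k - 1)) = sols {} {}"
proof -
  have "F \<inter> {n + 2 * (k - 1)..<n + 2 * m} \<noteq> {}" if "F \<in> sols {} {}" for F
  proof
    assume "F \<inter> {n + 2 * (k - 1)..<n + 2 * m} = {}"
    moreover have "F \<subseteq> {n..<n + 2 * m}" "card F = 2 * k" using that by (auto simp: sols_def symm_def arcs_def)
    ultimately have "F \<subseteq> {n..<n + 2 * (k - 1)}" by force
    then have "card F \<le> 2 * (k - 1)" using card_mono[of "{n..<n + 2 * (k - 1)}" F] by simp
    then show False using \<open>card F = 2 * k\<close> k_pos by simp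
  qed
  then show ?thesis using pending_tail[of "k - 1"] k_le_m by auto
qed

lemma wp_exclude_code:
  assumes R: "R rZero = 0" "R rOne = 1" "R rTwo = 2" "R rThree = 3" "R rN = n" "R rM = m" "R rK = k" "R rCnt = n + 2 * m"
    and A: "A aTg = tg" "A aTw = tw" "A aNx = fst f0" "A aPv = snd f0" "\<forall>x. A aFl x = 0"
    and Q: "\<And>R' A' T'. main_rep (tail_stack (k - 1)) R' A' \<Longrightarrow> T' \<le> T + 40 * m + 60 \<Longrightarrow> Qp (R', A', Y, T')"
  shows "wp M W exclude_code Qp (R, A, Y, T)"
proof -
  let ?x = "m - k + 1"
  let ?R = "R(rTop := 0, rInc := 0, rF := ?x, rK := 2 * k)"
  define I where "I = (\<lambda>i (R', A', Y', T'). const_regs R' \<and> R' rTop = i \<and> R' rInc = 0 \<and> R' rF = ?x \<and> i \<le> ?x \<and>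
    R' rCnt = n + 2 * (m - i) \<and> A' aTg = tg \<and> A' aTw = tw \<and> (\<forall>x. A' aFl x = 0) \<and>
    link_rep (excluded (tail_stack (m - i))) A' \<and> holds (A' aZ) (rev (map fst (tail_stack (m - i)))) \<and>
    Y' = Y \<and> T' \<le> T + 15 + 39 * i)"
  have xm: "?x \<le> m" "m - ?x = k - 1" using k_le_m k_pos by auto
  have "wp M W (CWhile rTop rF (CSub rCnt rCnt rTwo ;; unlink_edge rCnt ;; CStore aZ rTop rCnt ;; CAdd rTop rTop rOne))
     Qp (?R, A, Y, 15 + T)"
  proof (rule wp_While[where I = I and B = ?x])
    show "I 0 (?R, A, Y, 15 + T)" using R A by (auto simp: I_def const_regs_def link_rep_def)
  next
    fix i R' A' Y' T' assume I: "I i (R', A', Y', T')" and "R' rTop < R' rF"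
    then have i: "i < ?x" by (simp add: I_def)
    let ?l = "m - Suc i"
    have l: "?l < m" "Suc ?l = m - i" "k \<le> Suc ?l" using i xm by auto
    have ts: "tail_stack ?l = (n + 2 * ?l, False) # tail_stack (m - i)"
      using tail_stack_Cons[OF l(1)] l(2) by simp
    have del: "deletable ((n + 2 * ?l) # excluded (tail_stack (m - i)))"
      using valid_deletable[OF valid_tail[of ?l]] l ts by simp
    have r: "const_regs R'" "R' rTwo = 2" "R' rOne = 1" "R' rTop = i" "R' rCnt = n + 2 * (m - i)" "A' aTw = tw"
      "A' aNx = fst (lk (excluded (tail_stack (m - i))))" "A' aPv = snd (lk (excluded (tail_stack (m - i))))"
      using I by (auto simp: I_def const_regs_def link_rep_def)
    have cnt: "n + 2 * (m - i) - 2 = n + 2 * ?l" using l by simp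
    have b: "i < M" "Suc i < W" using i xm M_def W_large by auto
    have "length (map fst (tail_stack (m - i))) = i" using i xm by (simp add: length_tail_stack)
    then have Z: "holds ((A' aZ)(i := n + 2 * ?l)) (rev (map fst (tail_stack ?l)))"
      using I holds_snoc[of "A' aZ" "rev (map fst (tail_stack (m - i)))" "n + 2 * ?l"] by (simp add: I_def ts)
    have "wp M W (unlink_edge rCnt) (wp M W (CStore aZ rTop rCnt ;; CAdd rTop rTop rOne) (I (Suc i)))
      (R'(rCnt := n + 2 * ?l), A', Y', 6 + T')"
    proof (rule wp_unlink_edge[where x = "n + 2 * ?l" and D = "excluded (tail_stack (m - i))"])
      fix R1 assume "\<And>r. r < 40 \<Longrightarrow> R1 r = (R'(rCnt := n + 2 * ?l)) r"
      then have R1: "\<And>r. r < 40 \<Longrightarrow> R1 r = (if r = rCnt then n + 2 * ?l else R' r)" by auto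
      let ?D = "(n + 2 * ?l) # excluded (tail_stack (m - i))"
      have ex: "excluded (tail_stack ?l) = ?D" using ts by simp
      have "I (Suc i) (R1(rTop := Suc i), A'(aNx := fst (lk ?D), aPv := snd (lk ?D), aZ := (A' aZ)(i := n + 2 * ?l)), Y', 39 + T')"
        using I R1 i Z unfolding I_def prod.case ex link_rep_def const_regs_def by simp
      then show "wp M W (CStore aZ rTop rCnt ;; CAdd rTop rTop rOne) (I (Suc i))
         (R1, A'(aNx := fst (lk ?D), aPv := snd (lk ?D)), Y', 27 + (6 + T'))"
        using R1 r b by simp
    qed (use r del in auto)
    then show "wp M W (CSub rCnt rCnt rTwo ;; unlink_edge rCnt ;; CStore aZ rTop rCnt ;; CAdd rTop rTop rOne) (I (Suc i)) (R', A', Y', 3 + T')"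
      using r cnt by simp
  next
    fix i R' A' Y' T' assume "I i (R', A', Y', T')" "R' rTop < R' rF"
    then show "i < ?x" by (simp add: I_def)
  next
    fix i R' A' Y' T' assume I: "I i (R', A', Y', T')" and "\<not> R' rTop < R' rF"
    then have i: "i = ?x" by (simp add: I_def)
    have il: "inc_list (tail_stack (k - 1)) = []" by (simp add: inc_list_def included_tail)
    have "Qp (R', A', Y, 3 + T')"
      by (rule Q) (use I i xm il k_le_m k_pos in
        \<open>auto simp: I_def main_rep_def rep_defs included_tail length_tail_stack\<close>)
    then show "Qp (R', A', Y', 3 + T')" using I by (simp add: I_def)
  qed
  moreover have "Suc (m - k) < W" "k + k < W" using k_le_m M_def W_large by auto
  ultimately show ?thesis using R by (simp add: exclude_code_def mult_2)
qed

lemma wp_enumerate: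
  assumes R: "R rZero = 0" "R rOne = 1" "R rTwo = 2" "R rThree = 3" "R rN = n" "R rM = m" "R rK = k" "R rCnt = n + 2 * m"
    and A: "A aTg = tg" "A aTw = tw" "A aNx = fst f0" "A aPv = snd f0" "\<forall>x. A aFl x = 0"
    and Q: "\<And>R' A' T' Ls. listing Ls \<Longrightarrow> set ` set Ls = sols {} {} \<Longrightarrow>
      T' \<le> T + 40 * m + 70 + 4600 * k * card (sols {} {}) \<Longrightarrow> Qp (R', A', Y @ concat (map emit Ls), T')"
  shows "wp M W (exclude_code ;; main_loop) Qp (R, A, Y, T)"
  unfolding wp_Seq
proof (rule wp_exclude_code[OF R A])
  fix R' A' T' assume 1: "main_rep (tail_stack (k - 1)) R' A'" "T' \<le> T + 40 * m + 60"
  have l: "k - 1 < m" using k_le_m k_pos by simp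
  show "wp M W main_loop Qp (R', A', Y, T')"
  proof (rule wp_main_loop[OF 1(1)])
    show "valid (tail_stack (k - 1))" by (rule valid_tail) (use l in auto)
    show "excluded (tail_stack (k - 1)) \<noteq> []" using tail_stack_Cons[OF l] by simp
  qed (use included_tail pending_all 1(2) in \<open>auto intro!: Q\<close>)
qed

end

section \<open>From arc sets to graphlets\<close>

locale graphlet_graph = ordered_graph +
  fixes G :: graph
  assumes edge_image: "edges G = (\<lambda>a. {src a, tg a}) ` arcs"
    and edge_inj: "a \<in> arcs \<Longrightarrow> b \<in> arcs \<Longrightarrow> {src a, tg a} = {src b, tg b} \<Longrightarrow> b = a \<or> b = tw a"
begin

definition ends :: "nat \<Rightarrow> nat set" where "ends a = {src a, tg a}"

lemma ends_tw: "a \<in> arcs \<Longrightarrow> ends (tw a) = ends a"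
  by (auto simp: ends_def)

lemma ends_eq_iff: "a \<in> arcs \<Longrightarrow> b \<in> arcs \<Longrightarrow> ends a = ends b \<longleftrightarrow> b = a \<or> b = tw a"
  using edge_inj[of a b] ends_tw unfolding ends_def by blast

text \<open>On a symmetric set \<open>ends\<close> is two-to-one, its fibres being the pairs of
  opposite arcs.\<close>

lemma card_ends:
  assumes "symm F"
  shows "card F = 2 * card (ends ` F)"
proof -
  have "card {b \<in> F. ends b = e} = 2" if "e \<in> ends ` F" for e
  proof -
    obtain a where a: "a \<in> F" "e = ends a" using \<open>e \<in> ends ` F\<close> by auto
    have "a \<in> arcs" "tw a \<in> F" using a assms by (auto simp: symm_def)
    then have "{b \<in> F. ends b = e} = {a, tw a}"
      using a ends_eq_iff symm_sub[OF assms] by auto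
    then show ?thesis using tw_ne[OF \<open>a \<in> arcs\<close>] by simp
  qed
  then have "(\<Sum>e \<in> ends ` F. card {b \<in> F. ends b = e}) = 2 * card (ends ` F)" by simp
  moreover have "card F = (\<Sum>e \<in> ends ` F. card {b \<in> F. ends b = e})"
    using sum.image_gen[OF symm_fin[OF assms], of "\<lambda>_. 1 :: nat" ends] by simp
  ultimately show ?thesis by simp
qed

lemma ends_rel:
  assumes "symm F"
  shows "{(x, y). {x, y} \<in> ends ` F} = {(src a, tg a) | a. a \<in> F}"
proof -
  have "\<exists>a. x = src a \<and> y = tg a \<and> a \<in> F" if "b \<in> F" "{x, y} = {src b, tg b}" for x y b
    using that symm_tw[OF assms] symm_sub[OF assms] unfolding doubleton_eq_iff by (metis src_tw subsetD tg_tw)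
  then show ?thesis by (auto simp: ends_def)
qed

lemma Union_ends:
  assumes "symm F"
  shows "\<Union>(ends ` F) = src ` F"
proof -
  have "tg a \<in> src ` F" if "a \<in> F" for a
    using that symm_tw[OF assms that] symm_sub[OF assms] by (metis image_eqI src_tw subsetD)
  then show ?thesis by (auto simp: ends_def)
qed

text \<open>The vertices of the induced graph are the sources of \<open>F\<close> and the adjacency
  relations coincide. The empty set is exceptional because \<open>connected_graph\<close> asks for a
  vertex.\<close>

lemma connected_ends:
  assumes "symm F" "F \<noteq> {}"
  shows "connected_graph (edge_induced (ends ` F)) \<longleftrightarrow> conn F"
  using assms(2) Union_ends[OF assms(1)]
  by (simp add: connected_graph_def edge_induced_def ends_rel[OF assms(1)] conn_def reach_def)

lemma ends_image_inj:
  assumes "symm F" "symm F'" "ends ` F = ends ` F'"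
  shows "F = F'"
proof -
  have *: "A \<subseteq> B" if "symm A" "symm B" "ends ` A \<subseteq> ends ` B" for A B
  proof
    fix a assume a: "a \<in> A"
    then obtain b where b: "b \<in> B" "ends b = ends a" using \<open>ends ` A \<subseteq> ends ` B\<close> by force
    have "a \<in> arcs" "b \<in> arcs"
      using subsetD[OF symm_sub[OF \<open>symm A\<close>] a] subsetD[OF symm_sub[OF \<open>symm B\<close>] b(1)] .
    then have "a = b \<or> a = tw b" using b ends_eq_iff[of b a] by simp
    then show "a \<in> B" using b symm_tw[OF \<open>symm B\<close>] by auto
  qed
  show ?thesis using *[OF assms(1,2)] *[OF assms(2,1)] assms(3) by auto
qed

lemma graphlets_eq: "edge_graphlets G k = (\<lambda>F. edge_induced (ends ` F)) ` sols {} {}"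
proof
  show "edge_graphlets G k \<subseteq> (\<lambda>F. edge_induced (ends ` F)) ` sols {} {}"
  proof
    fix H assume "H \<in> edge_graphlets G k"
    then obtain E where E: "H = edge_induced E" "E \<subseteq> edges G" "card E = k" "connected_graph (edge_induced E)"
      by (auto simp: edge_graphlets_def)
    let ?F = "{a \<in> arcs. ends a \<in> E}"
    have symm: "symm ?F" using ends_tw by (auto simp: symm_def)
    have im: "ends ` ?F = E" using E(2) edge_image by (auto simp: ends_def)
    have "?F \<noteq> {}" using im E(3) k_pos by force
    then have "?F \<in> sols {} {}"
      using symm E im card_ends[OF symm] connected_ends[OF symm] by (simp add: sols_def)
    then show "H \<in> (\<lambda>F. edge_induced (ends ` F)) ` sols {} {}" using im E(1) by (intro image_eqI[of _ _ ?F]) auto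
  qed
  show "(\<lambda>F. edge_induced (ends ` F)) ` sols {} {} \<subseteq> edge_graphlets G k"
  proof
    fix H assume "H \<in> (\<lambda>F. edge_induced (ends ` F)) ` sols {} {}"
    then obtain F where F: "H = edge_induced (ends ` F)" "symm F" "conn F" "card F = 2 * k"
      by (auto simp: sols_def)
    have "F \<noteq> {}" using F(4) k_pos by auto
    then have "connected_graph (edge_induced (ends ` F))" using connected_ends[OF F(2)] F(3) by simp
    moreover have "card (ends ` F) = k" using card_ends[OF F(2)] F(4) by simp
    moreover have "ends ` F \<subseteq> edges G" using symm_sub[OF F(2)] edge_image by (auto simp: ends_def)
    ultimately show "H \<in> edge_graphlets G k" using F(1) by (auto simp: edge_graphlets_def)
  qed
qed

lemma induced_inj: "inj_on (\<lambda>F. edge_induced (ends ` F)) (sols {} {})"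
  using ends_image_inj by (auto simp: inj_on_def edge_induced_def sols_def)

lemma card_graphlets: "card (edge_graphlets G k) = card (sols {} {})"
  unfolding graphlets_eq by (rule card_image[OF induced_inj])

definition edge_list :: "nat list \<Rightarrow> (nat \<times> nat) list" where
  "edge_list L = map (\<lambda>a. (src a, tg a)) (filter (\<lambda>a. a < tw a) L)"

text \<open>Exactly one arc of each opposite pair passes the filter, and symmetry puts it into
  \<open>L\<close>.\<close>

lemma edge_list_set:
  assumes "symm (set L)"
  shows "edge_of ` set (edge_list L) = ends ` set L"
proof -
  have "\<exists>b. b \<in> set L \<and> b < tw b \<and> ends b = ends a" if a: "a \<in> set L" for a
  proof (cases "a < tw a")
    case False
    have "a \<in> arcs" "tw a \<in> set L" using a assms by (auto simp: symm_def)
    moreover have "tw a < a" using False tw_ne[OF \<open>a \<in> arcs\<close>] by (meson linorder_neqE_nat)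
    ultimately show ?thesis using ends_tw[of a] by (intro exI[of _ "tw a"]) auto
  qed (use a in auto)
  then have "ends ` set L \<subseteq> ends ` {a \<in> set L. a < tw a}"
    by (intro subsetI, elim imageE) (metis (mono_tags, lifting) image_eqI mem_Collect_eq)
  moreover have "edge_of ` set (edge_list L) = ends ` {a \<in> set L. a < tw a}"
    by (auto simp: edge_list_def edge_of_def ends_def image_image)
  ultimately show ?thesis by auto
qed

lemma edge_list_distinct:
  assumes "symm (set L)" "distinct L"
  shows "distinct (map edge_of (edge_list L))"
proof -
  have "inj_on ends {a \<in> set L. a < tw a}"
    using ends_eq_iff symm_sub[OF assms(1)] tw_inv by (fastforce simp: inj_on_def)
  moreover have "map edge_of (edge_list L) = map ends (filter (\<lambda>a. a < tw a) L)"
    by (simp add: edge_list_def edge_of_def ends_def)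
  ultimately show ?thesis using assms(2) by (simp add: distinct_map)
qed

lemma emit_edge_list: "emit L = concat (map (\<lambda>p. [fst p, snd p]) (edge_list L))"
  by (simp add: emit_def edge_list_def comp_def)

lemma listing_enumerates:
  assumes "listing Ls" "set ` set Ls = sols {} {}"
  shows "enumerates_edge_graphlets G k (concat (map emit Ls))"
proof -
  let ?\<phi> = "\<lambda>F. edge_induced (ends ` F)"
  have L: "distinct L" "symm (set L)" if "L \<in> set Ls" for L using that assms(1) by (auto simp: listing_def)
  have m: "map (\<lambda>L. edge_induced (edge_of ` set L)) (map edge_list Ls) = map ?\<phi> (map set Ls)"
    using edge_list_set[OF L(2)] by simp
  have d: "distinct (map ?\<phi> (map set Ls))"
    using assms induced_inj by (subst distinct_map) (simp add: listing_def)
  have e: "set (map ?\<phi> (map set Ls)) = edge_graphlets G k"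
    unfolding graphlets_eq assms(2)[symmetric] by (simp add: image_image)
  have c: "concat (map emit Ls) = concat (map (\<lambda>L. concat (map (\<lambda>p. [fst p, snd p]) L)) (map edge_list Ls))"
    by (simp add: comp_def emit_edge_list[abs_def])
  have f: "\<forall>L \<in> set (map edge_list Ls). distinct (map edge_of L)"
    using edge_list_distinct L by auto
  show ?thesis
    unfolding enumerates_edge_graphlets_def
    by (rule exI[of _ "map edge_list Ls"], unfold m, intro conjI c f d e)
qed

end

section \<open>The constructed arrays satisfy the hypotheses of the enumeration\<close>

context input_graph
begin

lemma arrays_nth:
  assumes "arrays rp tg tw" "j < length rp"
  shows "tg (n + 2 * j) = snd (rev rp ! j)" "tg (Suc (n + 2 * j)) = fst (rev rp ! j)"
    "tw (n + 2 * j) = Suc (n + 2 * j)" "tw (Suc (n + 2 * j)) = n + 2 * j"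
proof -
  have "tg (n + 2 * j) = snd (rev rp ! j) \<and> tg (Suc (n + 2 * j)) = fst (rev rp ! j) \<and>
    tw (n + 2 * j) = Suc (n + 2 * j) \<and> tw (Suc (n + 2 * j)) = n + 2 * j"
    using assms by (induction rp tg tw rule: arrays.induct) (auto simp: nth_append less_Suc_eq)
  then show "tg (n + 2 * j) = snd (rev rp ! j)" "tg (Suc (n + 2 * j)) = fst (rev rp ! j)"
    "tw (n + 2 * j) = Suc (n + 2 * j)" "tw (Suc (n + 2 * j)) = n + 2 * j" by auto
qed

lemma arc_cases:
  assumes "a \<in> {n..<n + 2 * l}"
  obtains j where "j < l" "a = n + 2 * j" | j where "j < l" "a = Suc (n + 2 * j)"
proof -
  obtain d where d: "a = n + d" "d < 2 * l" using assms by (metis add_less_cancel_left atLeastLessThan_iff le_Suc_ex)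
  show ?thesis
  proof (cases "even d")
    case True
    then show ?thesis using d that(1) by (auto elim!: evenE)
  next
    case False
    then show ?thesis using d that(2) by (auto elim!: oddE)
  qed
qed

lemma built_distinct: "built rp \<Longrightarrow> distinct (map (\<lambda>(u, v). {u, v}) rp)"
  by (induction rp rule: built.induct) (auto simp: edges_of_def)

lemma built_nth:
  assumes "built rp" "j < length rp"
  shows "{fst (rev rp ! j), snd (rev rp ! j)} \<in> edges G"
proof -
  have "rev rp ! j \<in> set rp" using assms(2) nth_mem[of j "rev rp"] by simp
  then show ?thesis using built_edges[OF assms(1)] by (force simp: edges_of_def split: prod.splits)
qed

lemma built_ends:
  assumes "arrays rp tg tw" "w \<in> \<Union>(edges_of rp)"
  shows "\<exists>a \<in> {n..<n + 2 * length rp}. tg (tw a) = w"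
  using assms
proof (induction rp tg tw rule: arrays.induct)
  case (2 u v rp tg tw)
  show ?case
  proof (cases "w \<in> \<Union>(edges_of rp)")
    case True
    then show ?thesis using 2 by fastforce
  next
    case False
    then have "w = u \<or> w = v" using 2(3) by (auto simp: edges_of_Cons)
    then show ?thesis
      using 2(2) by (auto intro: bexI[of _ "n + 2 * length rp"] bexI[of _ "n + 2 * length rp + 1"])
  qed
qed (simp add: edges_of_def)

text \<open>The first end of the newest edge is 0 or occurs in an older edge, so it is reached by
  induction; the new arc then reaches the second end.\<close>

lemma built_rooted:
  assumes "built rp" "arrays rp tg tw" "j \<le> length rp" "a \<in> {n..<n + 2 * j}"
  shows "(0, tg (tw a)) \<in> {(tg (tw b), tg b) | b. b \<in> {n..<n + 2 * j}}\<^sup>*"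
  using assms
proof (induction rp arbitrary: j a rule: built.induct)
  case (2 u v rp)
  show ?case
  proof (cases "j \<le> length rp")
    case True
    then show ?thesis using 2 by auto
  next
    case False
    then have j: "j = Suc (length rp)" using 2 by simp
    let ?x = "n + 2 * length rp"
    let ?r = "\<lambda>j. {(tg (tw b), tg b) | b. b \<in> {n..<n + 2 * j}}"
    have mono: "(?r (length rp))\<^sup>* \<subseteq> (?r j)\<^sup>*" by (intro rtrancl_mono) (use j in auto)
    have old: "(0, tg (tw b)) \<in> (?r j)\<^sup>*" if "b \<in> {n..<n + 2 * length rp}" for b
      using 2(1)[of "length rp" b] 2(2,3) that mono by auto
    have x: "tg (tw ?x) = u" "tg ?x = v" "tg (tw (Suc ?x)) = v" using 2(3) by auto
    have u: "(0, u) \<in> (?r j)\<^sup>*"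
    proof (cases "u = 0")
      case False
      then have "u \<in> \<Union>(edges_of rp)" using 2(2) by simp
      then obtain b where "b \<in> {n..<n + 2 * length rp}" "tg (tw b) = u" using built_ends 2(3) by force
      then show ?thesis using old by blast
    qed simp
    have "(u, v) \<in> ?r j" using x j by force
    then have v: "(0, v) \<in> (?r j)\<^sup>*" using u by (rule rtrancl_into_rtrancl[rotated])
    have "a \<in> {n..<n + 2 * length rp} \<or> a = ?x \<or> a = Suc ?x" using 2(5) j by auto
    then show ?thesis using old u v x by auto
  qed
qed simp

lemma built_graph:
  assumes rep: "built_rep rp R A" and km: "k \<le> m"
  shows "graphlet_graph n m k (A aTg) (A aTw) (outl rp) (A aNx, A aPv) M W G"
proof -
  let ?tg = "A aTg" and ?tw = "A aTw"
  have r: "built rp" "edges_of rp = edges G" "length rp = m" "arrays rp ?tg ?tw" "links rp (A aNx, A aPv)"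
    using rep by (auto simp: built_rep_def)
  note an = arrays_nth[OF r(4), unfolded r(3)]
  note bn = built_nth[OF r(1), unfolded r(3)]
  have ne: "fst (rev rp ! j) < n \<and> snd (rev rp ! j) < n \<and> fst (rev rp ! j) \<noteq> snd (rev rp ! j)" if "j < m" for j
    using edge_ends[OF bn[OF that]] .
  interpret arc_graph n m k ?tg ?tw
  proof
    fix a assume "a \<in> {n..<n + 2 * m}"
    then show "?tw a \<in> {n..<n + 2 * m}" "?tw (?tw a) = a" "?tw a \<noteq> a" "?tg a < n" "?tg (?tw a) \<noteq> ?tg a"
      using an ne by (cases rule: arc_cases; force)+
  qed (rule k_pos)
  interpret linked_graph n m k ?tg ?tw "outl rp" "(A aNx, A aPv)"
  proof
    fix v assume v: "v < n"
    show "distinct (outl rp v)" by (rule distinct_outl)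
    show "set (outl rp v) = {a \<in> arcs. src a = v}"
      by (intro set_eqI) (simp add: set_outl[OF r(1,4)] r(3) arcs_def)
  next
    show "linked (A aNx, A aPv) (outl rp)" using r(5) by (simp add: linked_def links_def)
  next
    fix x assume "x < n + 2 * m"
    then show "fst (A aNx, A aPv) x < n + 2 * m \<and> snd (A aNx, A aPv) x < n + 2 * m"
      using r(3,5) by (simp add: links_def)
  qed
  interpret machine_graph n m k ?tg ?tw "outl rp" "(A aNx, A aPv)" M W
    by unfold_locales (use M_def W_large km n_pos in auto)
  interpret ordered_graph n m k ?tg ?tw "outl rp" "(A aNx, A aPv)" M W
  proof
    fix j assume "j < m" then show "?tw (n + 2 * j) = Suc (n + 2 * j)" using an by simp
  next
    fix j assume "j \<le> m"
    then show "rooted 0 {n..<n + 2 * j}"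
      using built_rooted[OF r(1,4)] r(3) unfolding rooted_def reach_def src_def by (simp del: tg_tw)
  qed
  have ends: "{src a, ?tg a} = {fst (rev rp ! j), snd (rev rp ! j)}"
    if "j < m" "a = n + 2 * j \<or> a = Suc (n + 2 * j)" for a j
    using that(2) an[OF that(1)] unfolding src_def by (auto simp del: tg_tw)
  have set_rp: "edges G = (\<lambda>j. {fst (rev rp ! j), snd (rev rp ! j)}) ` {..<m}"
  proof -
    have "edges G = (\<lambda>(u, v). {u, v}) ` set (rev rp)" using r(2) by (simp add: edges_of_def)
    also have "set (rev rp) = (\<lambda>j. rev rp ! j) ` {..<m}"
      using r(3) by (metis atLeast_upt list.set_map length_rev map_nth)
    finally show ?thesis by (simp add: image_image case_prod_beta)
  qed
  have dist: "i = j" if "i < m" "j < m"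
    "{fst (rev rp ! i), snd (rev rp ! i)} = {fst (rev rp ! j), snd (rev rp ! j)}" for i j
  proof -
    have "distinct (map (\<lambda>(u, v). {u, v}) (rev rp))" using built_distinct[OF r(1)] by (simp flip: rev_map)
    then show ?thesis
      using that r(3) nth_eq_iff_index_eq[of "map (\<lambda>(u, v). {u, v}) (rev rp)" i j] by (simp add: case_prod_beta)
  qed
  show ?thesis
  proof
    show "edges G = (\<lambda>a. {src a, ?tg a}) ` arcs"
    proof
      show "edges G \<subseteq> (\<lambda>a. {src a, ?tg a}) ` arcs"
      proof
        fix e assume "e \<in> edges G"
        then obtain j where j: "j < m" "e = {fst (rev rp ! j), snd (rev rp ! j)}" unfolding set_rp by auto
        then have "e = {src (n + 2 * j), ?tg (n + 2 * j)}" using ends[OF j(1), of "n + 2 * j"] by simp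
        then show "e \<in> (\<lambda>a. {src a, ?tg a}) ` arcs" by (rule image_eqI) (rule arc_even(1)[OF j(1)])
      qed
      show "(\<lambda>a. {src a, ?tg a}) ` arcs \<subseteq> edges G"
      proof
        fix e assume "e \<in> (\<lambda>a. {src a, ?tg a}) ` arcs"
        then obtain a where a: "a \<in> {n..<n + 2 * m}" "e = {src a, ?tg a}" by (auto simp: arcs_def)
        from a(1) show "e \<in> edges G"
          by (cases rule: arc_cases) (use a(2) ends bn in auto)
      qed
    qed
  next
    fix a b assume a: "a \<in> arcs" and b: "b \<in> arcs" and eq: "{src a, ?tg a} = {src b, ?tg b}"
    obtain i where i: "i < m" "a = n + 2 * i \<or> a = Suc (n + 2 * i)" using a unfolding arcs_def by (rule arc_cases) auto
    obtain j where j: "j < m" "b = n + 2 * j \<or> b = Suc (n + 2 * j)" using b unfolding arcs_def by (rule arc_cases) auto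
    have "i = j" by (rule dist[OF i(1) j(1)]) (use ends[OF i] ends[OF j] eq in simp)
    then show "b = a \<or> b = ?tw a" using i j an by auto
  qed
qed

end

section \<open>The program\<close>

context input_graph
begin

lemma no_graphlets:
  assumes "m < k"
  shows "edge_graphlets G k = {}"
proof -
  have "card F \<noteq> k" if "F \<subseteq> edges G" for F
    using card_mono[OF finite_edges that] edges assms by simp
  then show ?thesis by (auto simp: edge_graphlets_def)
qed

definition time_bound :: nat where
  "time_bound = 121 * n + 240 * m + 160 + 4600 * k * card (edge_graphlets G k)"

lemma wp_graphlet_code:
  "wp M W graphlet_code (\<lambda>(R, A, Y, T). enumerates_edge_graphlets G k Y \<and> T \<le> time_bound)
     ((\<lambda>_. 0), (\<lambda>a. if a = aIn then input else (\<lambda>_. 0)), [], 0)"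
proof -
  let ?A = "\<lambda>a. if a = aIn then input else (\<lambda>_. 0)"
  let ?R = "(\<lambda>_. 0)(rOne := 1, rTwo := 2, rThree := 3, rN := n, rM := m, rK := k)"
  let ?Q = "\<lambda>(R, A, Y, T). enumerates_edge_graphlets G k Y \<and> T \<le> time_bound"
  have b: "0 < M" "Suc 0 < M" "2 < M" using M_def by auto
  have "wp M W (CIf rK rM (build_code ;; exclude_code ;; main_loop) CSkip) ?Q (?R, ?A, [], 18)"
  proof (cases "k \<le> m")
    case True
    have "wp M W build_code (wp M W (exclude_code ;; main_loop) ?Q) (?R, ?A, [], 21)"
    proof (rule wp_build_code)
      fix rp R A T assume rep: "built_rep rp R A" and T: "T \<le> 21 + 121 * n + 200 * m + 60"
      interpret g: graphlet_graph n m k "A aTg" "A aTw" "outl rp" "(A aNx, A aPv)" M W G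
        by (rule built_graph[OF rep True])
      show "wp M W (exclude_code ;; main_loop) ?Q (R, A, [], T)"
        by (rule g.wp_enumerate) (use rep T g.listing_enumerates g.card_graphlets in
            \<open>auto simp: built_rep_def input_regs_def time_bound_def\<close>)
    qed (auto simp: input_regs_def)
    then show ?thesis using True by simp
  next
    case False
    then have "enumerates_edge_graphlets G k []"
      using no_graphlets by (simp add: enumerates_edge_graphlets_def)
    then show ?thesis using False by (simp add: time_bound_def)
  qed
  then show ?thesis
    using b input_params by (simp add: graphlet_code_def)
qed

end

section \<open>The prologue and the complete machine program\<close>

fun run_block :: "nat \<Rightarrow> nat \<Rightarrow> instr list \<Rightarrow> config \<Rightarrow> config option" where
  "run_block S W [] \<sigma> = Some \<sigma>"
| "run_block S W (i # is) \<sigma> =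
     (case exec_instr S W i \<sigma> of None \<Rightarrow> None
      | Some \<sigma>' \<Rightarrow> if pc \<sigma>' = Suc (pc \<sigma>) then run_block S W is \<sigma>' else None)"

lemma run_block_steps:
  assumes "run_block S W is \<sigma> = Some \<sigma>'" "P = pre @ is @ post" "length pre = pc \<sigma>"
  shows "(ram_step S W P ^^ length is) \<sigma> \<sigma>' \<and> pc \<sigma>' = length pre + length is"
  using assms
proof (induction "is" arbitrary: \<sigma> pre)
  case (Cons i "is")
  obtain \<sigma>1 where 1: "exec_instr S W i \<sigma> = Some \<sigma>1" "pc \<sigma>1 = Suc (pc \<sigma>)" "run_block S W is \<sigma>1 = Some \<sigma>'"
    using Cons.prems(1) by (auto split: option.splits if_splits)
  have a: "(ram_step S W P ^^ 1) \<sigma> \<sigma>1"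
    by (rule ram_step_run[OF _ Cons.prems(3) 1(1)]) (use Cons.prems in simp)
  have b: "(ram_step S W P ^^ length is) \<sigma>1 \<sigma>' \<and> pc \<sigma>' = length (pre @ [i]) + length is"
    by (rule Cons.IH[OF 1(3)]) (use Cons.prems 1 in auto)
  show ?case using ram_steps_trans[OF a conjunct1[OF b]] b by simp
qed simp

text \<open>Register 90 is still 0, so the first load reads \<open>n\<close>. Then
  \<open>M = n + 2 * m + 4\<close> is formed and its multiples become the base addresses. Register
  100 keeps its 0, which makes the input array 0.\<close>

definition prologue :: "instr list" where
  "prologue = [Load 91 90, SetConst 92 1, Load 93 92, Add 91 91 93, Add 91 91 93, SetConst 92 4, Add 91 91 92,
     Add 101 100 91, Add 102 101 91, Add 103 102 91, Add 104 103 91, Add 105 104 91, Add 106 105 91,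
     Add 107 106 91, Add 108 107 91, Add 109 108 91, Add 110 109 91]"

definition program :: "instr list" where
  "program = prologue @ compile 17 graphlet_code @ [Halt]"

lemma wf_graphlet_code: "wf_com graphlet_code"
  by (simp add: graphlet_code_def build_code_def sentinel_code_def range_code_def bfs_step_def edge_code_def
      arcs_code_def insert_code_def unmark_code_def exclude_code_def unlink_edge_def unlink_code_def
      main_loop_def backtrack_code_def backtrack_step_def relink_edge_def relink_code_def include_code_def
      explore_code_def start_code_def explore_step_def emit_loop_def force_code_def enqueue_code_def
      arc_code_def reserve_code_def scan_code_def check_code_def next_code_def clear_code_def)

lemma less_11_cases: "(\<forall>a < 11. P a) \<longleftrightarrow> P 0 \<and> P 1 \<and> P 2 \<and> P 3 \<and> P 4 \<and> P 5 \<and> P 6 \<and> P 7 \<and> P 8 \<and> P 9 \<and> P (10 :: nat)"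
proof -
  have "a < 11 \<longleftrightarrow> a = 0 \<or> a = 1 \<or> a = 2 \<or> a = 3 \<or> a = 4 \<or> a = 5 \<or> a = 6 \<or> a = 7 \<or> a = 8 \<or> a = 9 \<or> a = 10"
    for a :: nat by arith
  then show ?thesis by (simp only: imp_disjL all_conj_distrib simp_thms)
qed

context input_graph
begin

lemma prologue_run:
  assumes S: "11 * M \<le> S" and W: "\<forall>x \<in> set (graph_input G adj k). x < W"
  shows "\<exists>\<sigma>. (ram_step S W program ^^ 17) (init_config (graph_input G adj k)) \<sigma> \<and> pc \<sigma> = 17 \<and>
    represents M W ((\<lambda>_. 0), (\<lambda>a. if a = aIn then input else (\<lambda>_. 0)), [], 0) \<sigma>"
proof -
  let ?\<sigma> = "init_config (graph_input G adj k)"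
  have mem: "mem ?\<sigma> = input" by (simp add: init_config_def input_def fun_eq_iff)
  have ilt: "input i < W" for i
    using W W_large M_def nth_mem[of i "graph_input G adj k"] by (auto simp: input_def)
  have MW: "M < W" "11 * M \<le> W" "4 < W" "n < W" "m < W" "n + m < W" "n + m + m < W" using M_def W_large by auto
  have MS: "0 < S" "Suc 0 < S" using S M_def by auto
  have M': "n + m + m + 4 = M" using M_def by simp
  let ?r = "(\<lambda>_. 0)(91 := M, 92 := 4, 93 := m, 101 := M, 102 := 2 * M, 103 := 3 * M, 104 := 4 * M, 105 := 5 * M,
    106 := 6 * M, 107 := 7 * M, 108 := 8 * M, 109 := 9 * M, 110 := 10 * M)"
  have run: "run_block S W prologue ?\<sigma> = Some \<lparr>pc = 17, regs = ?r, mem = input, outs = []\<rparr>"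
    using MW MS ilt M'
    by (simp add: prologue_def set_reg_def init_config_def mem[unfolded init_config_def, simplified] input_params)
      (auto simp: fun_eq_iff)
  have rep: "represents M W ((\<lambda>_. 0), (\<lambda>a. if a = aIn then input else (\<lambda>_. 0)), [], 0)
     \<lparr>pc = 17, regs = ?r, mem = input, outs = []\<rparr>"
  proof -
    \<comment> \<open>The input fills exactly the \<open>M\<close> cells of array 0, so all other
      arrays start out as zero.\<close>
    have "input (a * M + i) = 0" if "a \<noteq> 0" for a i
    proof -
      have "M \<le> a * M" using that by simp
      then have "\<not> a * M + i < M" by linarith
      then show ?thesis unfolding input_def length_input by (rule if_not_P)
    qed
    then have "\<forall>a < 11. \<forall>i < M. input (a * M + i) = (if a = aIn then input else (\<lambda>_. 0)) i" by simp
    moreover have "\<forall>a < 11. ?r (100 + a) = a * M" unfolding less_11_cases by simp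
    moreover have "\<forall>r. ?r r < W" using MW by auto
    ultimately show ?thesis using ilt by (auto simp: represents_def)
  qed
  have "length prologue = 17" by (simp add: prologue_def)
  then show ?thesis
    using run_block_steps[OF run, of program "[]" "compile 17 graphlet_code @ [Halt]"] rep
    by (auto simp: program_def init_config_def)
qed

lemma program_correct:
  assumes S: "11 * M \<le> S" and W: "\<forall>x \<in> set (graph_input G adj k). x < W"
  shows "\<exists>t ys. ram_computes S W program (graph_input G adj k) t ys \<and>
    enumerates_edge_graphlets G k ys \<and> t \<le> 17 + time_bound"
proof -
  obtain \<sigma> where \<sigma>: "(ram_step S W program ^^ 17) (init_config (graph_input G adj k)) \<sigma>" "pc \<sigma> = 17"
    "represents M W ((\<lambda>_. 0), (\<lambda>a. if a = aIn then input else (\<lambda>_. 0)), [], 0) \<sigma>"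
    using prologue_run[OF assms] by blast
  obtain R A Y T where ex: "exec M W graphlet_code ((\<lambda>_. 0), (\<lambda>a. if a = aIn then input else (\<lambda>_. 0)), [], 0) (R, A, Y, T)"
    and en: "enumerates_edge_graphlets G k Y" and T: "T \<le> time_bound"
    using wp_graphlet_code unfolding wp_def by auto
  have len: "length prologue = 17" by (simp add: prologue_def)
  have "simulated M S W program (length prologue + comp_len graphlet_code)
      ((\<lambda>_. 0), (\<lambda>a. if a = aIn then input else (\<lambda>_. 0)), [], 0) \<sigma> (R, A, Y, T)"
    by (rule compile_correct[OF ex wf_graphlet_code S W_large, where post = "[Halt]"])
      (use W_large M_def \<sigma> len in \<open>auto simp: program_def\<close>)
  then obtain t \<sigma>' where s: "(ram_step S W program ^^ t) \<sigma> \<sigma>'" "pc \<sigma>' = 17 + comp_len graphlet_code"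
    "represents M W (R, A, Y, T) \<sigma>'" "t \<le> T"
    unfolding simulated_def len by auto
  have "program ! pc \<sigma>' = Halt" "pc \<sigma>' < length program"
    using s(2) len by (simp_all add: program_def nth_append)
  moreover have "outs \<sigma>' = Y" using s(3) by (simp add: represents_def)
  moreover have "length (graph_input G adj k) \<le> S" using length_input S by simp
  ultimately have "ram_computes S W program (graph_input G adj k) (17 + t) Y"
    unfolding ram_computes_def using W ram_steps_trans[OF \<sigma>(1) s(1)] by blast
  then show ?thesis using en s(4) T by (intro exI[of _ "17 + t"] exI[of _ Y]) simp
qed

lemma input_bound: "x \<in> set (graph_input G adj k) \<Longrightarrow> x \<le> M + k"
proof -
  assume "x \<in> set (graph_input G adj k)"
  then consider "x = n" | "x = m" | "x = k" | v where "v \<le> n" "x = offset v" | "x \<in> set (concat adj)"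
    using verts edges unfolding graph_input_def offset_def
    by (fastforce simp: less_Suc_eq_le simp del: upt_Suc)
  then show ?thesis
  proof cases
    case (4 v)
    then show ?thesis using offset_le[of v] by simp
  next
    case 5
    then obtain xs where "xs \<in> set adj" "x \<in> set xs" by auto
    then obtain v where "v < n" "x \<in> set (adj ! v)" using length_adj by (metis in_set_conv_nth)
    then show ?thesis using adj_set[of v] edge_ends[of v x] M_def by auto
  qed (use M_def in auto)
qed

end

theorem theorem9:
  "\<exists>(P :: instr list) (c_time :: nat) (c_space :: nat) (c_word :: nat).
     \<forall>(G :: graph) (adj :: nat list list) (n :: nat) (m :: nat) (k :: nat).
       simple_graph G \<and> connected_graph G \<and> verts G = {0..<n} \<and> card (edges G) = m \<and>
       adjacency_lists G adj \<and> k > 0 \<longrightarrow>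
       (\<exists>t ys.
          ram_computes (c_space * (n + m)) ((n + m + k) ^ c_word) P (graph_input G adj k) t ys \<and>
          enumerates_edge_graphlets G k ys \<and>
          t \<le> c_time * (n + m + k * card (edge_graphlets G k)))"
proof (rule exI[of _ program], rule exI[of _ 5000], rule exI[of _ 55], rule exI[of _ 8], intro allI impI)
  fix G :: graph and adj :: "nat list list" and n m k :: nat
  assume *: "simple_graph G \<and> connected_graph G \<and> verts G = {0..<n} \<and> card (edges G) = m \<and>
       adjacency_lists G adj \<and> k > 0"
  let ?M = "n + 2 * m + 4" and ?W = "(n + m + k) ^ 8"
  have n: "0 < n" using * by (auto simp: connected_graph_def)
  \<comment> \<open>As \<open>n\<close> and \<open>k\<close> are positive, the base is at least 2.
    Seven of the eight factors give the constant 128, enough for all addresses below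
    \<open>11 * ?M\<close> and for \<open>k\<close> itself, which may exceed
    \<open>m\<close>.\<close>
  have "2 ^ 7 \<le> (n + m + k) ^ 7" using n * by (intro power_mono) auto
  then have "128 * (n + m + k) \<le> (n + m + k) ^ 7 * (n + m + k)" by (intro mult_le_mono1) simp
  also have "\<dots> = ?W" by (simp flip: power_Suc2)
  finally have W: "128 * (n + m + k) \<le> ?W" .
  interpret input_graph G adj n m k ?M ?W
    by unfold_locales (use * W n in auto)
  have "\<forall>x \<in> set (graph_input G adj k). x < ?W"
  proof
    fix x assume "x \<in> set (graph_input G adj k)"
    then have "x \<le> ?M + k" by (rule input_bound)
    also have "\<dots> < 128 * (n + m + k)" using n by simp
    also note W
    finally show "x < ?W" .
  qed
  \<comment> \<open>The origin of the space constant: \<open>n >= 1\<close> turns the additive 44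
    into \<open>44 * n\<close>, and \<open>11 + 44 = 55\<close>.\<close>
  moreover have "11 * ?M \<le> 55 * (n + m)" using n by simp
  ultimately obtain t ys where t: "ram_computes (55 * (n + m)) ?W program (graph_input G adj k) t ys"
    "enumerates_edge_graphlets G k ys" "t \<le> 17 + time_bound"
    using program_correct by blast
  have "17 + time_bound \<le> 5000 * (n + m + k * card (edge_graphlets G k))"
    using n by (simp add: time_bound_def algebra_simps)
  with t show "\<exists>t ys. ram_computes (55 * (n + m)) ?W program (graph_input G adj k) t ys \<and>
      enumerates_edge_graphlets G k ys \<and> t \<le> 5000 * (n + m + k * card (edge_graphlets G k))"
    by (meson order_trans)
qed

end
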